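(* Let $H$ be an infinite dimensional separable Hilbert space, viewed as an abelian Polish group under addition with the norm topology. Then $H$ admits a faithful spatial action, and $H$ also admits a faithful whirly near-action.
   Context: Actions are on standard Lebesgue spaces $(X,\mathcal{X},\mu)$, i.e. (nonatomic) standard probability spaces; sets are identified modulo null sets. $\mathrm{Aut}(X,\mathcal{X},\mu)$ is the Polish group of equivalence classes (mod null sets) of invertible measure preserving transformations, with the topology whose neighborhoods of the identity are generated by the sets $\{T:\mu(A\triangle TA)<\varepsilon\}$, $A\in\mathcal{X}$, $\varepsilon>0$. A near-action of a Polish group $G$ on $(X,\mathcal{X},\mu)$ is (equivalently) a continuous homomorphism $G\to\mathrm{Aut}(X,\mathcal{X},\mu)$. A spatial $G$-action is a Borel map $G\times X\to X$ with $ex=x$ and $g(hx)=(gh)x$ for all $g,h\in G$ and all $x\in X$, each $g$ preserving $\mu$; it induces a near-action. An action is faithful if the induced homomorphism $G\to\mathrm{Aut}(X,\mathcal{X},\mu)$ is injective. A near-action is whirly if for all $A,B\in\mathcal{X}$ of positive measure, every neighborhood of the identity of $G$ contains some $g$ with $\mu(A\cap gB)>0$. *)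

theory Defs
  imports "HOL-Probability.Probability" "HOL-Algebra.Coset"
begin

definition nonatomic :: "'a measure \<Rightarrow> bool" where
  "nonatomic M \<longleftrightarrow>
     \<not> (\<exists>A\<in>sets M. measure M A > 0 \<and>
          (\<forall>B\<in>sets M. B \<subseteq> A \<longrightarrow> measure M B = 0 \<or> measure M B = measure M A))"

definition standard_borel_space :: "'a measure \<Rightarrow> bool" where
  "standard_borel_space M \<longleftrightarrow>
     (\<exists>T. topspace T = space M \<and> completely_metrizable_space T \<and> second_countable T \<and>
          sets M = sigma_sets (space M) {U. openin T U})"

text \<open>
  Existence of an action on some standard Lebesgue space is asserted below for spaces whose
  carrier is a subset of \<open>nat \<Rightarrow> real\<close>. This is no restriction, because every Polish space is
  homeomorphic to a subspace of \<open>nat \<Rightarrow> real\<close>.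
\<close>
definition standard_lebesgue_space :: "'a measure \<Rightarrow> bool" where
  "standard_lebesgue_space M \<longleftrightarrow> prob_space M \<and> standard_borel_space M \<and> nonatomic M"


definition inv_mpt :: "'a measure \<Rightarrow> ('a \<Rightarrow> 'a) set" where
  "inv_mpt M = {f. bij_betw f (space M) (space M) \<and>
                   f \<in> measurable M M \<and> the_inv_into (space M) f \<in> measurable M M \<and>
                   distr M M f = M}"

text \<open>
  Functions are total, so their values outside the carrier of \<open>M\<close> are irrelevant; the
  almost everywhere identification also removes this redundancy.
\<close>
definition aut_class :: "'a measure \<Rightarrow> ('a \<Rightarrow> 'a) \<Rightarrow> ('a \<Rightarrow> 'a) set" where
  "aut_class M f = {h \<in> inv_mpt M. AE x in M. h x = f x}"

definition Aut :: "'a measure \<Rightarrow> ('a \<Rightarrow> 'a) set monoid" where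
  "Aut M = \<lparr>carrier = aut_class M ` inv_mpt M,
            mult = (\<lambda>S T. \<Union>f\<in>S. \<Union>g\<in>T. aut_class M (f \<circ> g)),
            one = aut_class M id\<rparr>"

text \<open>
  The image of a measurable set under a class of transformations. It is defined up to null sets
  only: lemma \<open>aut_image_AE\<close> below shows that the representative does not matter.
\<close>
definition aut_image :: "('a \<Rightarrow> 'a) set \<Rightarrow> 'a set \<Rightarrow> 'a set" where
  "aut_image T A = (SOME f. f \<in> T) ` A"

definition aut_nhd :: "'a measure \<Rightarrow> 'a set \<Rightarrow> real \<Rightarrow> ('a \<Rightarrow> 'a) set set" where
  "aut_nhd M A \<epsilon> = {T \<in> carrier (Aut M). measure M (sym_diff A (aut_image T A)) < \<epsilon>}"

text \<open>
  The group topology whose neighbourhoods of the identity are generated by the sets \<open>aut_nhd\<close>: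
  the left translates of these sets form a subbase.
\<close>
definition aut_topology :: "'a measure \<Rightarrow> ('a \<Rightarrow> 'a) set topology" where
  "aut_topology M = topology_generated_by
     {S <#\<^bsub>Aut M\<^esub> aut_nhd M A \<epsilon> | S A \<epsilon>. S \<in> carrier (Aut M) \<and> A \<in> sets M \<and> \<epsilon> > 0}"


definition additive_group :: "'g::group_add monoid" where
  "additive_group = \<lparr>carrier = UNIV, mult = (+), one = 0\<rparr>"

definition near_action ::
    "'a measure \<Rightarrow> ('g::topological_group_add \<Rightarrow> ('a \<Rightarrow> 'a) set) \<Rightarrow> bool" where
  "near_action M \<phi> \<longleftrightarrow>
     \<phi> \<in> hom additive_group (Aut M) \<and> continuous_map euclidean (aut_topology M) \<phi>"

definition spatial_action ::
    "'a measure \<Rightarrow> ('g::topological_group_add \<Rightarrow> 'a \<Rightarrow> 'a) \<Rightarrow> bool" where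
  "spatial_action M a \<longleftrightarrow>
     (\<lambda>(g, x). a g x) \<in> measurable (borel \<Otimes>\<^sub>M M) M \<and>
     (\<forall>x\<in>space M. a 0 x = x) \<and>
     (\<forall>g h. \<forall>x\<in>space M. a g (a h x) = a (g + h) x) \<and>
     (\<forall>g. distr M M (a g) = M)"

definition induced_near_action ::
    "'a measure \<Rightarrow> ('g \<Rightarrow> 'a \<Rightarrow> 'a) \<Rightarrow> 'g \<Rightarrow> ('a \<Rightarrow> 'a) set" where
  "induced_near_action M a = (\<lambda>g. aut_class M (a g))"

definition faithful :: "('g \<Rightarrow> ('a \<Rightarrow> 'a) set) \<Rightarrow> bool" where
  "faithful \<phi> \<longleftrightarrow> inj \<phi>"

definition whirly ::
    "'a measure \<Rightarrow> ('g::topological_group_add \<Rightarrow> ('a \<Rightarrow> 'a) set) \<Rightarrow> bool" where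
  "whirly M \<phi> \<longleftrightarrow>
     (\<forall>A\<in>sets M. \<forall>B\<in>sets M. measure M A > 0 \<longrightarrow> measure M B > 0 \<longrightarrow>
        (\<forall>U. open U \<longrightarrow> 0 \<in> U \<longrightarrow> (\<exists>g\<in>U. measure M (A \<inter> aut_image (\<phi> g) B) > 0)))"


lemma inv_mptD:
  assumes "f \<in> inv_mpt M"
  shows "bij_betw f (space M) (space M)" "f \<in> measurable M M"
    "the_inv_into (space M) f \<in> measurable M M" "distr M M f = M"
  using assms by (auto simp: inv_mpt_def)

lemma AE_inv_mpt:
  assumes f: "f \<in> inv_mpt M" and P: "AE x in M. P x"
  shows "AE x in M. P (f x)"
proof -
  from P have "AE x in distr M M f. P x"
    by (subst inv_mptD(4)[OF f])
  then obtain N where N: "N \<in> null_sets (distr M M f)"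
      "{x \<in> space M. \<not> P x} \<subseteq> N"
    by (auto simp: eventually_ae_filter)
  have "f -` N \<inter> space M \<in> null_sets M"
    using N(1) inv_mptD(2)[OF f]
    by (auto simp: null_sets_def emeasure_distr measurable_sets)
  moreover have "{x \<in> space M. \<not> P (f x)} \<subseteq> f -` N \<inter> space M"
    using N(2) measurable_space[OF inv_mptD(2)[OF f]] by blast
  ultimately show ?thesis
    by (rule AE_I')
qed

lemma inv_mpt_id: "id \<in> inv_mpt M"
proof -
  have "the_inv_into (space M) id \<in> measurable M M \<longleftrightarrow> id \<in> measurable M M"
    by (rule measurable_cong) (simp add: the_inv_into_f_eq)
  then show ?thesis
    by (simp add: inv_mpt_def id_def bij_betw_def)
qed

lemma inv_mpt_comp:
  assumes f: "f \<in> inv_mpt M" and g: "g \<in> inv_mpt M"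
  shows "f \<circ> g \<in> inv_mpt M"
proof -
  note F = inv_mptD[OF f] and G = inv_mptD[OF g]
  have bij: "bij_betw (f \<circ> g) (space M) (space M)"
    using F(1) G(1) by (rule bij_betw_trans[rotated])
  have eq: "the_inv_into (space M) (f \<circ> g) x =
        (the_inv_into (space M) g \<circ> the_inv_into (space M) f) x" if "x \<in> space M" for x
    using F(1) G(1) that
    by (metis bij_betw_def the_inv_into_comp)
  have "the_inv_into (space M) g \<circ> the_inv_into (space M) f \<in> measurable M M"
    using F(3) G(3) by (rule measurable_comp)
  then have "the_inv_into (space M) (f \<circ> g) \<in> measurable M M"
    by (subst measurable_cong[OF eq]) auto
  moreover have "distr M M (f \<circ> g) = M"
    using F(2,4) G(2,4) by (metis distr_distr)
  ultimately show ?thesis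
    using bij F(2) G(2) by (simp add: inv_mpt_def measurable_comp)
qed

lemma inv_mpt_inv:
  assumes f: "f \<in> inv_mpt M"
  shows "the_inv_into (space M) f \<in> inv_mpt M"
proof -
  let ?g = "the_inv_into (space M) f"
  note F = inv_mptD[OF f]
  have inj: "inj_on f (space M)" and im: "f ` space M = space M"
    using F(1) by (auto simp: bij_betw_def)
  have bij: "bij_betw ?g (space M) (space M)"
    using F(1) by (rule bij_betw_the_inv_into)
  have gf: "?g (f x) = x" if "x \<in> space M" for x
    using that inj by (simp add: the_inv_into_f_f)
  have "the_inv_into (space M) ?g x = f x" if "x \<in> space M" for x
    using that gf bij im
    by (metis bij_betw_def imageI the_inv_into_f_eq)
  then have "the_inv_into (space M) ?g \<in> measurable M M \<longleftrightarrow> f \<in> measurable M M"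
    by (rule measurable_cong)
  moreover have "distr M M ?g = M"
  proof -
    have "distr M M ?g = distr (distr M M f) M ?g"
      using F(4) by simp
    also have "\<dots> = distr M M (?g \<circ> f)"
      using F(2,3) by (simp add: distr_distr)
    also have "\<dots> = distr M M (\<lambda>x. x)"
      by (rule distr_cong) (auto simp: gf)
    finally show ?thesis by (simp add: distr_id)
  qed
  ultimately show ?thesis
    using F bij by (simp add: inv_mpt_def)
qed

lemma aut_class_eq_iff:
  assumes "f \<in> inv_mpt M"
  shows "aut_class M f = aut_class M g \<longleftrightarrow> (AE x in M. f x = g x)"
proof
  assume eq: "aut_class M f = aut_class M g"
  have "f \<in> aut_class M f"
    using assms by (simp add: aut_class_def)
  then have "f \<in> aut_class M g"
    by (simp only: eq)
  then show "AE x in M. f x = g x"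
    by (simp add: aut_class_def)
next
  assume *: "AE x in M. f x = g x"
  have "(AE x in M. h x = f x) \<longleftrightarrow> (AE x in M. h x = g x)" for h
  proof
    assume "AE x in M. h x = f x"
    with * show "AE x in M. h x = g x" by eventually_elim simp
  next
    assume "AE x in M. h x = g x"
    with * show "AE x in M. h x = f x" by eventually_elim simp
  qed
  then show "aut_class M f = aut_class M g"
    by (simp add: aut_class_def)
qed

lemma carrier_Aut: "carrier (Aut M) = aut_class M ` inv_mpt M"
  by (simp add: Aut_def)

lemma Aut_mult:
  assumes f: "f \<in> inv_mpt M" and g: "g \<in> inv_mpt M"
  shows "aut_class M f \<otimes>\<^bsub>Aut M\<^esub> aut_class M g = aut_class M (f \<circ> g)"
proof -
  have "aut_class M (f' \<circ> g') = aut_class M (f \<circ> g)"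
    if f': "f' \<in> aut_class M f" and g': "g' \<in> aut_class M g" for f' g'
  proof -
    have "AE x in M. f' (g' x) = f (g' x)"
      using AE_inv_mpt[of g' M "\<lambda>y. f' y = f y"] f' g' by (auto simp: aut_class_def)
    moreover have "AE x in M. g' x = g x"
      using g' by (simp add: aut_class_def)
    ultimately have "AE x in M. (f' \<circ> g') x = (f \<circ> g) x"
      by eventually_elim simp
    then show ?thesis
      using f' g' by (subst aut_class_eq_iff) (auto simp: aut_class_def inv_mpt_comp)
  qed
  then have "(\<Union>f'\<in>aut_class M f. \<Union>g'\<in>aut_class M g. aut_class M (f' \<circ> g')) =
      (\<Union>f'\<in>aut_class M f. \<Union>g'\<in>aut_class M g. aut_class M (f \<circ> g))"
    by simp
  moreover have "aut_class M f \<noteq> {}" "aut_class M g \<noteq> {}"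
    using f g by (auto simp: aut_class_def)
  ultimately show ?thesis
    by (simp add: Aut_def)
qed

lemma group_Aut: "group (Aut M)"
proof (rule groupI)
  fix S T R
  assume "S \<in> carrier (Aut M)" "T \<in> carrier (Aut M)"
  then show "S \<otimes>\<^bsub>Aut M\<^esub> T \<in> carrier (Aut M)"
    by (auto simp: Aut_mult inv_mpt_comp carrier_Aut)
next
  show "\<one>\<^bsub>Aut M\<^esub> \<in> carrier (Aut M)"
    by (simp add: Aut_def inv_mpt_id)
next
  fix S T R
  assume "S \<in> carrier (Aut M)" "T \<in> carrier (Aut M)" "R \<in> carrier (Aut M)"
  then show "S \<otimes>\<^bsub>Aut M\<^esub> T \<otimes>\<^bsub>Aut M\<^esub> R = S \<otimes>\<^bsub>Aut M\<^esub> (T \<otimes>\<^bsub>Aut M\<^esub> R)"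
    by (auto simp: Aut_mult inv_mpt_comp comp_assoc carrier_Aut)
next
  fix S
  assume "S \<in> carrier (Aut M)"
  then obtain f where f: "f \<in> inv_mpt M" "S = aut_class M f"
    by (auto simp: Aut_def)
  have one: "\<one>\<^bsub>Aut M\<^esub> = aut_class M id"
    by (simp add: Aut_def)
  show "\<one>\<^bsub>Aut M\<^esub> \<otimes>\<^bsub>Aut M\<^esub> S = S"
    using f by (simp add: one Aut_mult inv_mpt_id)
  let ?g = "the_inv_into (space M) f"
  have "AE x in M. (?g \<circ> f) x = id x"
    using inv_mptD(1)[OF f(1)] by (intro AE_I2) (simp add: bij_betw_def the_inv_into_f_f)
  then have "aut_class M ?g \<otimes>\<^bsub>Aut M\<^esub> S = \<one>\<^bsub>Aut M\<^esub>"
    using f by (simp add: one Aut_mult inv_mpt_inv inv_mpt_comp aut_class_eq_iff)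
  moreover have "aut_class M ?g \<in> carrier (Aut M)"
    using inv_mpt_inv[OF f(1)] by (simp add: Aut_def)
  ultimately show "\<exists>T\<in>carrier (Aut M). T \<otimes>\<^bsub>Aut M\<^esub> S = \<one>\<^bsub>Aut M\<^esub>"
    by blast
qed

lemma aut_image_AE:
  assumes f: "f \<in> inv_mpt M" and A: "A \<subseteq> space M"
  shows "AE x in M. x \<in> aut_image (aut_class M f) A \<longleftrightarrow> x \<in> f ` A"
proof -
  define h where "h = (SOME h. h \<in> aut_class M f)"
  have "f \<in> aut_class M f"
    using f by (simp add: aut_class_def)
  then have "h \<in> aut_class M f"
    unfolding h_def by (rule someI[of "\<lambda>h. h \<in> aut_class M f"])
  then have h: "h \<in> inv_mpt M" and ae: "AE x in M. h x = f x"
    by (auto simp: aut_class_def)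
  let ?f' = "the_inv_into (space M) f" and ?h' = "the_inv_into (space M) h"
  have mem: "x \<in> k ` A \<longleftrightarrow> the_inv_into (space M) k x \<in> A"
    if k: "k \<in> inv_mpt M" and x: "x \<in> space M" for k x
  proof -
    note b = inv_mptD(1)[OF k]
    have "k (the_inv_into (space M) k x) = x"
      using b x by (simp add: bij_betw_def f_the_inv_into_f)
    moreover have "the_inv_into (space M) k (k y) = y" if "y \<in> A" for y
      using b that A by (auto simp: bij_betw_def the_inv_into_f_f)
    ultimately show ?thesis
      by (metis imageE imageI)
  qed
  have "AE x in M. h (?h' x) = f (?h' x)"
    using AE_inv_mpt[OF inv_mpt_inv[OF h] ae] .
  then have "AE x in M. ?h' x = ?f' x"
    using AE_space
  proof eventually_elim
    case (elim x)
    have "h (?h' x) = x" "?h' x \<in> space M"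
      using inv_mptD(1)[OF h] elim(2)
      by (auto simp: bij_betw_def f_the_inv_into_f intro!: the_inv_into_into)
    then have "f (?h' x) = x"
      using elim(1) by simp
    then show ?case
      using inv_mptD(1)[OF f] \<open>?h' x \<in> space M\<close> by (simp add: bij_betw_def the_inv_into_f_eq)
  qed
  then have "AE x in M. x \<in> h ` A \<longleftrightarrow> x \<in> f ` A"
    using AE_space by eventually_elim (simp add: mem f h)
  then show ?thesis
    by (simp add: aut_image_def h_def)
qed

end

theory Submission
  imports Defs "HOL-Complex_Analysis.Great_Picard" "HOL-Real_Asymp.Real_Asymp"
begin

text \<open>
  Both actions live on spaces of real sequences, whose coordinates are indexed by a dense sequence
  \<open>d\<close> in \<open>H\<close>.

  \<^bold>\<open>The spatial action\<close> rotates a countable product of circles: \<open>h\<close> rotates the \<open>n\<close>-th circle by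
  the angle \<open>h \<bullet> d n\<close>, measured in full turns. If \<open>g\<close> and \<open>h\<close> act in the same way, then \<open>g - h\<close>
  has integer inner product with every \<open>d n\<close>, hence by density with every vector, so \<open>g = h\<close>.

  \<^bold>\<open>The whirly near-action\<close> is the shift of the stationary Gaussian process \<open>(Y h)\<close>, \<open>h \<in> H\<close>, with
  covariance \<open>exp (- \<parallel>g - h\<parallel>\<^sup>2 / 2)\<close>. The process is realised through its values at the points
  \<open>d n\<close>; the value at another point is an almost sure limit, so translation by \<open>h\<close> is defined almost
  everywhere only. It preserves the law of the process because the covariance is translation
  invariant. It is faithful and continuous because the covariance separates points and is
  continuous.

  Suppose that the shifts of \<open>B\<close> by all vectors of norm below \<open>r0\<close> meet \<open>A\<close> in null sets. For
  trigonometric polynomials \<open>f\<close> and \<open>g\<close> in finitely many coordinates, infinite dimension provides a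
  vector \<open>h\<close> of norm \<open>r\<close> orthogonal to all points \<open>d j\<close> involved. Shifting by such an \<open>h\<close> multiplies
  all covariances between the coordinates of \<open>f\<close> and those of \<open>g\<close> by \<open>\<rho> = exp (- r\<^sup>2 / 2)\<close>, and
  therefore the correlation of \<open>f\<close> with the shift of \<open>g\<close> is a power series in \<open>\<rho>\<close>. This is the action
  of the Ornstein-Uhlenbeck semigroup on the Wiener chaos decomposition; the coefficients are bounded
  in terms of the \<open>L\<^sup>2\<close> norms of \<open>f\<close> and \<open>g\<close>, and the constant coefficient is the product of the means
  (\<open>trig_polys_correlation\<close>). Now let \<open>f\<close> and \<open>g\<close> tend in \<open>L\<^sup>2\<close> to the indicators of \<open>A\<close> and \<open>B\<close>. The
  power series tend to zero at every \<open>\<rho>\<close> above \<open>exp (- r0\<^sup>2 / 2)\<close>, hence by Montel's theorem and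
  analytic continuation (\<open>bounded_power_series_vanishing\<close>) also at \<open>\<rho> = 0\<close>, where their values tend
  to the product of the measures of \<open>A\<close> and \<open>B\<close>. So one of the two sets is null.

  Two tools serve throughout: the density of trigonometric polynomials in \<open>L\<^sup>2\<close> of every finite measure
  (\<open>trig_polys_L2_dense\<close>), which also shows that characteristic functions determine measures on
  sequences, and a Cholesky decomposition of positive semidefinite kernels, which builds the Gaussian
  process from independent normal variables.
\<close>

section \<open>Density of an algebra of bounded functions\<close>

text \<open>
  Squared norms obey the triangle inequality up to a factor, which is all that the \<open>L\<^sup>2\<close> estimates below
  need.
\<close>

lemma norm_add_sq_le: "(norm (a + b))\<^sup>2 \<le> 2 * (norm a)\<^sup>2 + 2 * (norm b)\<^sup>2"
  for a b :: "'b::real_normed_vector"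
proof -
  have "(norm (a + b))\<^sup>2 \<le> (norm a + norm b)\<^sup>2"
    by (intro power_mono norm_triangle_ineq) auto
  also have "\<dots> \<le> 2 * (norm a)\<^sup>2 + 2 * (norm b)\<^sup>2"
    using zero_le_power2[of "norm a - norm b"] by (simp add: power2_eq_square algebra_simps)
  finally show ?thesis .
qed

locale bounded_function_algebra = finite_measure M for M :: "'a measure" +
  fixes E :: "('a \<Rightarrow> complex) set"
  assumes E_measurable [measurable]: "e \<in> E \<Longrightarrow> e \<in> borel_measurable M"
    and E_bounded: "e \<in> E \<Longrightarrow> \<exists>c. \<forall>x\<in>space M. norm (e x) \<le> c"
    and E_const: "(\<lambda>_. c) \<in> E"
    and E_add: "e \<in> E \<Longrightarrow> e' \<in> E \<Longrightarrow> (\<lambda>x. e x + e' x) \<in> E"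
    and E_mult: "e \<in> E \<Longrightarrow> e' \<in> E \<Longrightarrow> (\<lambda>x. e x * e' x) \<in> E"
begin

abbreviation sq_dist :: "('a \<Rightarrow> real) \<Rightarrow> ('a \<Rightarrow> complex) \<Rightarrow> real" where
  "sq_dist f e \<equiv> \<integral>x. (norm (complex_of_real (f x) - e x))\<^sup>2 \<partial>M"

text \<open>
  Boundedness is part of the definition because it makes the closure an algebra: a product is
  approximated by first replacing one factor, and the bound on the other factor keeps the error small.
\<close>

definition L2_closure :: "('a \<Rightarrow> real) set" where
  "L2_closure = {f \<in> borel_measurable M. (\<exists>c. \<forall>x\<in>space M. \<bar>f x\<bar> \<le> c) \<and>
     (\<forall>\<epsilon>>0. \<exists>e\<in>E. sq_dist f e < \<epsilon>)}"

lemma integrable_bounded: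
  fixes g :: "'a \<Rightarrow> real"
  assumes "g \<in> borel_measurable M" "\<And>x. x \<in> space M \<Longrightarrow> \<bar>g x\<bar> \<le> c"
  shows "integrable M g"
  using assms by (intro integrable_const_bound[where B = c]) auto

lemma integrable_dist_sq:
  assumes f: "f \<in> borel_measurable M" "\<And>x. x \<in> space M \<Longrightarrow> \<bar>f x\<bar> \<le> c" and e: "e \<in> E"
  shows "integrable M (\<lambda>x. (norm (complex_of_real (f x) - e x))\<^sup>2)"
proof -
  from E_bounded[OF e] obtain d where d: "\<And>x. x \<in> space M \<Longrightarrow> norm (e x) \<le> d" by auto
  have "(norm (complex_of_real (f x) - e x))\<^sup>2 \<le> (c + d)\<^sup>2" if "x \<in> space M" for x
  proof (rule power_mono)
    have "norm (complex_of_real (f x) - e x) \<le> \<bar>f x\<bar> + norm (e x)"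
      using norm_triangle_ineq4[of "complex_of_real (f x)" "e x"] by simp
    then show "norm (complex_of_real (f x) - e x) \<le> c + d"
      using f(2)[OF that] d[OF that] by linarith
  qed auto
  then show ?thesis
    using e f(1) by (intro integrable_bounded[where c = "(c + d)\<^sup>2"]) auto
qed

lemma L2_closureE:
  assumes "f \<in> L2_closure"
  obtains c where "f \<in> borel_measurable M" "\<And>x. x \<in> space M \<Longrightarrow> \<bar>f x\<bar> \<le> c" "c > 0"
    "\<And>\<epsilon>. \<epsilon> > 0 \<Longrightarrow> \<exists>e\<in>E. sq_dist f e < \<epsilon>"
proof -
  from assms obtain c where "\<forall>x\<in>space M. \<bar>f x\<bar> \<le> c" by (auto simp: L2_closure_def)
  then have "\<And>x. x \<in> space M \<Longrightarrow> \<bar>f x\<bar> \<le> \<bar>c\<bar> + 1" by fastforce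
  with assms that[of "\<bar>c\<bar> + 1"] show ?thesis by (auto simp: L2_closure_def)
qed

lemma L2_closure_of_E:
  assumes "(\<lambda>x. complex_of_real (f x)) \<in> E"
  shows "f \<in> L2_closure"
proof -
  have "f \<in> borel_measurable M"
    using measurable_compose[OF E_measurable[OF assms] borel_measurable_Re] by simp
  moreover obtain c where "\<forall>x\<in>space M. norm (complex_of_real (f x)) \<le> c"
    using E_bounded[OF assms] by auto
  ultimately show ?thesis
    using assms by (auto simp: L2_closure_def intro!: bexI[OF _ assms])
qed

lemma L2_closure_const: "(\<lambda>_. c) \<in> L2_closure"
  by (rule L2_closure_of_E) (rule E_const)

lemma L2_closure_add:
  assumes "f \<in> L2_closure" "g \<in> L2_closure"
  shows "(\<lambda>x. f x + g x) \<in> L2_closure"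
proof -
  obtain c where f: "f \<in> borel_measurable M" "\<And>x. x \<in> space M \<Longrightarrow> \<bar>f x\<bar> \<le> c" "c > 0"
    "\<And>\<epsilon>. \<epsilon> > 0 \<Longrightarrow> \<exists>e\<in>E. sq_dist f e < \<epsilon>"
    using assms(1) by (rule L2_closureE) (rule that; assumption)
  obtain d where g: "g \<in> borel_measurable M" "\<And>x. x \<in> space M \<Longrightarrow> \<bar>g x\<bar> \<le> d" "d > 0"
    "\<And>\<epsilon>. \<epsilon> > 0 \<Longrightarrow> \<exists>e\<in>E. sq_dist g e < \<epsilon>"
    using assms(2) by (rule L2_closureE) (rule that; assumption)
  have bd: "\<bar>f x + g x\<bar> \<le> c + d" if "x \<in> space M" for x
    using f(2)[OF that] g(2)[OF that] by linarith
  have meas: "(\<lambda>x. f x + g x) \<in> borel_measurable M"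
    using f(1) g(1) by simp
  have "\<exists>e\<in>E. (\<integral>x. (norm (complex_of_real (f x + g x) - e x))\<^sup>2 \<partial>M) < \<epsilon>" if "\<epsilon> > 0" for \<epsilon>
  proof -
    from f(4)[of "\<epsilon>/4"] g(4)[of "\<epsilon>/4"] that obtain e e' where
      e: "e \<in> E" "sq_dist f e < \<epsilon>/4" and
      e': "e' \<in> E" "sq_dist g e' < \<epsilon>/4" by auto
    have "(\<integral>x. (norm (complex_of_real (f x + g x) - (e x + e' x)))\<^sup>2 \<partial>M)
        \<le> (\<integral>x. 2 * (norm (complex_of_real (f x) - e x))\<^sup>2 + 2 * (norm (complex_of_real (g x) - e' x))\<^sup>2 \<partial>M)"
      using norm_add_sq_le[of "complex_of_real (f _) - e _" "complex_of_real (g _) - e' _"]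
      by (intro integral_mono integrable_dist_sq[OF meas bd E_add[OF e(1) e'(1)]] Bochner_Integration.integrable_add
          integrable_mult_right integrable_dist_sq[OF f(1,2) e(1)] integrable_dist_sq[OF g(1,2) e'(1)])
         (auto simp: algebra_simps)
    also have "\<dots> < \<epsilon>"
      using e(2) e'(2) integrable_dist_sq[OF f(1,2) e(1)] integrable_dist_sq[OF g(1,2) e'(1)] by simp
    finally show ?thesis using E_add[OF e(1) e'(1)] by (rule rev_bexI[rotated])
  qed
  with meas bd show ?thesis by (auto simp: L2_closure_def)
qed

lemma L2_closure_mult:
  assumes "f \<in> L2_closure" "g \<in> L2_closure"
  shows "(\<lambda>x. f x * g x) \<in> L2_closure"
proof -
  obtain c where f: "f \<in> borel_measurable M" "\<And>x. x \<in> space M \<Longrightarrow> \<bar>f x\<bar> \<le> c" "c > 0"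
    "\<And>\<epsilon>. \<epsilon> > 0 \<Longrightarrow> \<exists>e\<in>E. sq_dist f e < \<epsilon>"
    using assms(1) by (rule L2_closureE) (rule that; assumption)
  obtain d where g: "g \<in> borel_measurable M" "\<And>x. x \<in> space M \<Longrightarrow> \<bar>g x\<bar> \<le> d" "d > 0"
    "\<And>\<epsilon>. \<epsilon> > 0 \<Longrightarrow> \<exists>e\<in>E. sq_dist g e < \<epsilon>"
    using assms(2) by (rule L2_closureE) (rule that; assumption)
  have bd: "\<bar>f x * g x\<bar> \<le> c * d" if "x \<in> space M" for x
    using f(2)[OF that] g(2)[OF that] by (auto simp: abs_mult intro!: mult_mono)
  have meas: "(\<lambda>x. f x * g x) \<in> borel_measurable M"
    using f(1) g(1) by simp
  have "\<exists>e\<in>E. (\<integral>x. (norm (complex_of_real (f x * g x) - e x))\<^sup>2 \<partial>M) < \<epsilon>" if "\<epsilon> > 0" for \<epsilon>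
  proof -
    from f(4)[of "\<epsilon>/(4*d\<^sup>2)"] that g(3) obtain e where
      e: "e \<in> E" "sq_dist f e < \<epsilon>/(4*d\<^sup>2)" by auto
    from E_bounded[OF e(1)] obtain b0 where "\<And>x. x \<in> space M \<Longrightarrow> norm (e x) \<le> b0" by auto
    then have b: "norm (e x) \<le> \<bar>b0\<bar> + 1" if "x \<in> space M" for x using that by fastforce
    define b where "b = \<bar>b0\<bar> + 1"
    have b0: "b > 0" by (simp add: b_def)
    from g(4)[of "\<epsilon>/(4*b\<^sup>2)"] that b0 obtain e' where
      e': "e' \<in> E" "sq_dist g e' < \<epsilon>/(4*b\<^sup>2)" by auto
    have pt: "(norm (complex_of_real (f x * g x) - (e x * e' x)))\<^sup>2
        \<le> 2 * d\<^sup>2 * (norm (complex_of_real (f x) - e x))\<^sup>2 + 2 * b\<^sup>2 * (norm (complex_of_real (g x) - e' x))\<^sup>2"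
      if x: "x \<in> space M" for x
    proof -
      have "complex_of_real (f x * g x) - (e x * e' x) =
          of_real (g x) * (of_real (f x) - e x) + e x * (of_real (g x) - e' x)"
        by (simp add: algebra_simps)
      then have "(norm (complex_of_real (f x * g x) - (e x * e' x)))\<^sup>2 \<le>
         2 * (norm (of_real (g x) * (of_real (f x) - e x)))\<^sup>2 + 2 * (norm (e x * (of_real (g x) - e' x)))\<^sup>2"
        using norm_add_sq_le by metis
      also have "\<dots> = 2 * ((g x)\<^sup>2 * (norm (of_real (f x) - e x))\<^sup>2) + 2 * ((norm (e x))\<^sup>2 * (norm (of_real (g x) - e' x))\<^sup>2)"
        by (simp add: norm_mult power_mult_distrib)
      also have "\<dots> \<le> 2 * (d\<^sup>2 * (norm (of_real (f x) - e x))\<^sup>2) + 2 * (b\<^sup>2 * (norm (of_real (g x) - e' x))\<^sup>2)"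
      proof -
        have "(g x)\<^sup>2 \<le> d\<^sup>2" using g(2)[OF x] g(3) by (simp add: abs_le_square_iff[symmetric])
        moreover have "(norm (e x))\<^sup>2 \<le> b\<^sup>2" using b[OF x] by (intro power_mono) (auto simp: b_def)
        ultimately show ?thesis by (intro add_mono mult_left_mono mult_right_mono) auto
      qed
      finally show ?thesis by (simp add: mult.assoc)
    qed
    note i1 = integrable_dist_sq[OF f(1,2) e(1)] and i2 = integrable_dist_sq[OF g(1,2) e'(1)]
    have "(\<integral>x. (norm (complex_of_real (f x * g x) - (e x * e' x)))\<^sup>2 \<partial>M)
        \<le> (\<integral>x. 2 * d\<^sup>2 * (norm (complex_of_real (f x) - e x))\<^sup>2 + 2 * b\<^sup>2 * (norm (complex_of_real (g x) - e' x))\<^sup>2 \<partial>M)"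
      by (intro integral_mono integrable_dist_sq[OF meas bd E_mult[OF e(1) e'(1)]] Bochner_Integration.integrable_add
          integrable_mult_right i1 i2 pt)
    also have "\<dots> = 2 * d\<^sup>2 * sq_dist f e
       + 2 * b\<^sup>2 * sq_dist g e'"
      using i1 i2 by simp
    also have "\<dots> < 2 * d\<^sup>2 * (\<epsilon>/(4*d\<^sup>2)) + 2 * b\<^sup>2 * (\<epsilon>/(4*b\<^sup>2))"
      using b0 g(3) e(2) e'(2) by (intro add_strict_mono mult_strict_left_mono) auto
    also have "\<dots> = \<epsilon>" using b0 g(3) by (simp add: field_simps)
    finally show ?thesis using E_mult[OF e(1) e'(1)] by (rule rev_bexI[rotated])
  qed
  with meas bd show ?thesis by (auto simp: L2_closure_def)
qed

lemma L2_closure_lim: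
  assumes F: "\<And>n. F n \<in> L2_closure" and bd: "\<And>n x. x \<in> space M \<Longrightarrow> \<bar>F n x\<bar> \<le> c"
    and lim: "\<And>x. x \<in> space M \<Longrightarrow> (\<lambda>n. F n x) \<longlonglongrightarrow> f x"
  shows "f \<in> L2_closure"
proof -
  have Fm [measurable]: "F n \<in> borel_measurable M" for n
    using F[of n] by (auto simp: L2_closure_def)
  have meas [measurable]: "f \<in> borel_measurable M"
    using lim by (rule borel_measurable_LIMSEQ_real) auto
  have bf: "\<bar>f x\<bar> \<le> c" if "x \<in> space M" for x
    using tendsto_rabs[OF lim[OF that]] bd[OF that] by (intro LIMSEQ_le_const2) auto
  have "(\<lambda>n. \<integral>x. (f x - F n x)\<^sup>2 \<partial>M) \<longlonglongrightarrow> (\<integral>x. 0 \<partial>M)"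
  proof (rule integral_dominated_convergence[where w = "\<lambda>_. (2 * c)\<^sup>2"])
    show "AE x in M. (\<lambda>n. (f x - F n x)\<^sup>2) \<longlonglongrightarrow> 0"
    proof (rule AE_I2)
      fix x assume "x \<in> space M"
      from tendsto_power[OF tendsto_diff[OF tendsto_const[of "f x"] lim[OF this]], of 2]
      show "(\<lambda>n. (f x - F n x)\<^sup>2) \<longlonglongrightarrow> 0" by simp
    qed
    show "AE x in M. norm ((f x - F n x)\<^sup>2) \<le> (2 * c)\<^sup>2" for n
    proof (rule AE_I2)
      fix x assume x: "x \<in> space M"
      have "\<bar>f x - F n x\<bar> \<le> \<bar>2 * c\<bar>" using bf[OF x] bd[OF x, of n] by linarith
      then show "norm ((f x - F n x)\<^sup>2) \<le> (2 * c)\<^sup>2"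
        unfolding real_norm_def abs_of_nonneg[OF zero_le_power2] using abs_le_square_iff by blast
    qed
  qed (use meas Fm in measurable)
  then have conv: "(\<lambda>n. \<integral>x. (f x - F n x)\<^sup>2 \<partial>M) \<longlonglongrightarrow> 0" by simp
  have "\<exists>e\<in>E. sq_dist f e < \<epsilon>" if "\<epsilon> > 0" for \<epsilon>
  proof -
    from order_tendstoD(2)[OF conv, of "\<epsilon>/4"] that obtain n where n: "(\<integral>x. (f x - F n x)\<^sup>2 \<partial>M) < \<epsilon>/4"
      by (auto simp: eventually_sequentially)
    have "\<forall>\<epsilon>>0. \<exists>e\<in>E. sq_dist (F n) e < \<epsilon>"
      using F[of n] by (simp add: L2_closure_def)
    moreover have "\<epsilon>/4 > 0" using that by simp
    ultimately obtain e where e: "e \<in> E" "sq_dist (F n) e < \<epsilon>/4"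
      by blast
    have i1: "integrable M (\<lambda>x. (f x - F n x)\<^sup>2)"
    proof (rule integrable_bounded)
      fix x assume x: "x \<in> space M"
      have "\<bar>f x - F n x\<bar> \<le> \<bar>2 * c\<bar>" using bf[OF x] bd[OF x, of n] by linarith
      then show "\<bar>(f x - F n x)\<^sup>2\<bar> \<le> (2 * c)\<^sup>2"
        unfolding abs_of_nonneg[OF zero_le_power2] using abs_le_square_iff by blast
    qed (use meas Fm in measurable)
    note i2 = integrable_dist_sq[OF Fm bd e(1), of n]
    have "sq_dist f e
        \<le> (\<integral>x. 2 * (f x - F n x)\<^sup>2 + 2 * (norm (complex_of_real (F n x) - e x))\<^sup>2 \<partial>M)"
    proof (intro integral_mono integrable_dist_sq[OF meas bf e(1)] Bochner_Integration.integrable_add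
          integrable_mult_right i1 i2)
      fix x
      show "(norm (complex_of_real (f x) - e x))\<^sup>2 \<le> 2 * (f x - F n x)\<^sup>2 + 2 * (norm (complex_of_real (F n x) - e x))\<^sup>2"
        using norm_add_sq_le[of "complex_of_real (f x - F n x)" "complex_of_real (F n x) - e x"]
        by (simp only: norm_of_real power2_abs) (simp add: algebra_simps)
    qed
    also have "\<dots> < \<epsilon>" using i1 i2 n e(2) by simp
    finally show ?thesis using e(1) by blast
  qed
  with meas bf show ?thesis by (auto simp: L2_closure_def)
qed

lemma L2_closure_polynomial:
  assumes "real_polynomial_function p" "f \<in> L2_closure"
  shows "(\<lambda>x. p (f x)) \<in> L2_closure"
  using assms(1)
proof (induction rule: real_polynomial_function.induct)
  case (linear l)
  have "l (f x) = f x * l 1" for x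
    using linear.hyps by (metis linear_simps(5) mult.right_neutral real_scaleR_def)
  then show ?case
    using L2_closure_mult[OF assms(2) L2_closure_const[of "l 1"]] by simp
next
  case (const c)
  then show ?case by (rule L2_closure_const)
next
  case (add p q)
  then show ?case by (intro L2_closure_add)
next
  case (mult p q)
  then show ?case by (intro L2_closure_mult)
qed

text \<open>
  By Weierstrass approximation on the bounded range of \<open>f\<close>, polynomials suffice.
\<close>

lemma L2_closure_continuous:
  fixes \<phi> :: "real \<Rightarrow> real"
  assumes \<phi>: "continuous_on UNIV \<phi>" and f: "f \<in> L2_closure"
  shows "(\<lambda>x. \<phi> (f x)) \<in> L2_closure"
proof -
  obtain c where c: "\<And>x. x \<in> space M \<Longrightarrow> \<bar>f x\<bar> \<le> c"
    using f by (auto simp: L2_closure_def)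
  have cont: "continuous_on {-c..c} \<phi>" using \<phi> by (rule continuous_on_subset) simp
  have "\<exists>p. real_polynomial_function p \<and> (\<forall>y\<in>{-c..c}. \<bar>\<phi> y - p y\<bar> < inverse (Suc n))" for n
  proof -
    obtain p where "real_polynomial_function p" "\<And>y. y \<in> {-c..c} \<Longrightarrow> \<bar>\<phi> y - p y\<bar> < inverse (Suc n)"
      by (rule Stone_Weierstrass_real_polynomial_function[OF compact_Icc cont, of "inverse (Suc n)"]) auto
    then show ?thesis by blast
  qed
  then obtain p where p: "\<And>n. real_polynomial_function (p n)"
    "\<And>n y. y \<in> {-c..c} \<Longrightarrow> \<bar>\<phi> y - p n y\<bar> < inverse (Suc n)" by metis
  have "bounded (\<phi> ` {-c..c})"
    by (intro compact_imp_bounded compact_continuous_image cont) simp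
  then obtain b where b: "\<And>y. y \<in> {-c..c} \<Longrightarrow> \<bar>\<phi> y\<bar> \<le> b"
    unfolding bounded_iff real_norm_def by blast
  have in_int: "f x \<in> {-c..c}" if "x \<in> space M" for x using c[OF that] by auto
  show ?thesis
  proof (rule L2_closure_lim[where F = "\<lambda>n x. p n (f x)" and c = "b + 1"])
    show "(\<lambda>x. p n (f x)) \<in> L2_closure" for n
      by (rule L2_closure_polynomial[OF p(1) f])
    fix x assume x: "x \<in> space M"
    have le1: "inverse (real (Suc n)) \<le> 1" for n by (simp add: inverse_le_1_iff)
    show "\<bar>p n (f x)\<bar> \<le> b + 1" for n
      using p(2)[OF in_int[OF x], of n] b[OF in_int[OF x]] le1[of n] by linarith
    show "(\<lambda>n. p n (f x)) \<longlonglongrightarrow> \<phi> (f x)"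
    proof (rule LIM_zero_cancel, rule LIMSEQ_norm_0)
      fix n
      show "norm (p n (f x) - \<phi> (f x)) < 1 / real (Suc n)"
        using p(2)[OF in_int[OF x], of n] by (simp add: abs_minus_commute inverse_eq_divide)
    qed
  qed
qed

text \<open>
  The indicator is a bounded limit of the piecewise linear functions
  \<open>min 1 (max 0 (n (f x - a)))\<close>.
\<close>

lemma L2_closure_superlevel:
  assumes f: "f \<in> L2_closure"
  shows "(\<lambda>x. indicator {x \<in> space M. f x > a} x) \<in> L2_closure"
proof (rule L2_closure_lim[where F = "\<lambda>n x. min 1 (max 0 (real n * (f x - a)))" and c = 1])
  show "(\<lambda>x. min 1 (max 0 (real n * (f x - a)))) \<in> L2_closure" for n
    by (rule L2_closure_continuous[OF _ f, of "\<lambda>y. min 1 (max 0 (real n * (y - a)))"])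
       (intro continuous_intros)
  show "\<bar>min 1 (max 0 (real n * (f x - a)))\<bar> \<le> 1" for n x by auto
  fix x assume x: "x \<in> space M"
  show "(\<lambda>n. min 1 (max 0 (real n * (f x - a)))) \<longlonglongrightarrow> indicator {x \<in> space M. f x > a} x"
  proof (cases "f x > a")
    case False
    then have "min 1 (max 0 (real n * (f x - a))) = 0" for n
      using mult_nonneg_nonpos[of "real n" "f x - a"] by simp
    then show ?thesis using False by (simp add: indicator_def)
  next
    case True
    obtain N where N: "1 < real N * (f x - a)"
      using reals_Archimedean3[of "f x - a"] True by fastforce
    have "min 1 (max 0 (real n * (f x - a))) = 1" if "n \<ge> N" for n
    proof -
      have "real N * (f x - a) \<le> real n * (f x - a)" using that True by (intro mult_right_mono) auto
      then show ?thesis using N by simp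
    qed
    then have "\<forall>\<^sub>F n in sequentially. min 1 (max 0 (real n * (f x - a))) = 1"
      by (auto simp: eventually_sequentially)
    then show ?thesis using True x by (simp add: indicator_def tendsto_eventually)
  qed
qed

definition approximable :: "'a set set" where
  "approximable = {A \<in> sets M. (\<lambda>x. indicator A x) \<in> L2_closure}"

lemma sigma_algebra_approximable: "sigma_algebra (space M) approximable"
  unfolding sigma_algebra_iff2
proof (intro conjI allI ballI impI)
  show "approximable \<subseteq> Pow (space M)"
    using sets.sets_into_space by (auto simp: approximable_def)
  show "{} \<in> approximable"
    using L2_closure_const[of 0] by (simp add: approximable_def indicator_def)
  show "space M - A \<in> approximable" if "A \<in> approximable" for A
  proof -
    have A: "A \<in> sets M" "(\<lambda>x. indicator A x) \<in> L2_closure" using that by (auto simp: approximable_def)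
    have "(\<lambda>x. 1 + (-1) * indicator A x) \<in> L2_closure"
      by (intro L2_closure_add L2_closure_mult L2_closure_const A)
    then have "(\<lambda>x. indicator (space M - A) x) \<in> L2_closure"
      by (rule L2_closure_lim[where c = 1]) (auto simp: indicator_def)
    then show ?thesis using A by (simp add: approximable_def)
  qed
  show "(\<Union>i. A i) \<in> approximable" if "range A \<subseteq> approximable" for A :: "nat \<Rightarrow> 'a set"
  proof -
    have A: "A i \<in> sets M" "(\<lambda>x. indicator (A i) x) \<in> L2_closure" for i
      using that by (auto simp: approximable_def)
    have prod: "(\<lambda>x. \<Prod>i<n. 1 + (-1) * indicator (A i) x) \<in> L2_closure" for n :: nat
    proof (induction n)
      case 0
      then show ?case using L2_closure_const[of 1] by simp
    next
      case (Suc n)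
      then show ?case
        by (simp only: prod.lessThan_Suc) (intro L2_closure_add L2_closure_mult L2_closure_const A)
    qed
    have prod_val: "(\<Prod>i<n. 1 + (-1) * indicator (A i) x) = (if \<exists>i<n. x \<in> A i then 0 else 1 :: real)" for n x
      by (auto simp: prod_zero_iff indicator_def intro!: prod.neutral)
    have "(\<lambda>x. indicator (\<Union>i. A i) x) \<in> L2_closure"
    proof (rule L2_closure_lim[where c = 1])
      show "(\<lambda>x. 1 + (-1) * (\<Prod>i<n. 1 + (-1) * indicator (A i) x)) \<in> L2_closure" for n
        by (intro L2_closure_add L2_closure_mult L2_closure_const prod)
      show "\<bar>1 + (-1) * (\<Prod>i<n. 1 + (-1) * indicator (A i) x)\<bar> \<le> (1::real)" for n x
        unfolding prod_val by simp
      fix x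
      show "(\<lambda>n. 1 + (-1) * (\<Prod>i<n. 1 + (-1) * indicator (A i) x)) \<longlonglongrightarrow> (indicator (\<Union>i. A i) x :: real)"
      proof (cases "\<exists>i. x \<in> A i")
        case False
        then show ?thesis unfolding prod_val by (simp add: indicator_def)
      next
        case True
        then obtain i where "x \<in> A i" by auto
        then have "\<forall>\<^sub>F n in sequentially. 1 + (-1) * (\<Prod>i<n. 1 + (-1) * indicator (A i) x) = (indicator (\<Union>i. A i) x :: real)"
          unfolding prod_val eventually_sequentially
          by (intro exI[of _ "Suc i"]) (auto simp: indicator_def Suc_le_eq)
        then show ?thesis by (rule tendsto_eventually)
      qed
    qed
    then show ?thesis using A(1) by (simp add: approximable_def)
  qed
qed

text \<open>
  The approximable sets form a sigma-algebra, since products, complements and bounded limits of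
  indicators stay in the closure, and all real functions in \<open>E\<close> are measurable with respect to it.
  The assumption \<open>gen\<close> says that these functions generate the sigma-algebra of \<open>M\<close>.
\<close>

theorem L2_dense:
  assumes gen: "\<And>N. space N = space M \<Longrightarrow> sets N \<subseteq> sets M \<Longrightarrow>
      (\<And>f. (\<lambda>x. complex_of_real (f x)) \<in> E \<Longrightarrow> f \<in> borel_measurable N) \<Longrightarrow> sets M \<subseteq> sets N"
    and A: "A \<in> sets M" and "\<epsilon> > 0"
  shows "\<exists>e\<in>E. (\<integral>x. (norm (indicator A x - e x))\<^sup>2 \<partial>M) < \<epsilon>"
proof -
  interpret S: sigma_algebra "space M" approximable by (rule sigma_algebra_approximable)
  define N where "N = sigma (space M) approximable"
  have sp: "space N = space M" by (simp add: N_def)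
  have sets_N: "sets N = approximable" by (simp add: N_def)
  have "sets M \<subseteq> sets N"
  proof (rule gen)
    show "sets N \<subseteq> sets M" by (auto simp: sets_N approximable_def)
    fix f assume f: "(\<lambda>x. complex_of_real (f x)) \<in> E"
    have fm: "f \<in> borel_measurable M" using L2_closure_of_E[OF f] by (simp add: L2_closure_def)
    have "{x \<in> space M. f x > a} \<in> approximable" for a
      using L2_closure_superlevel[OF L2_closure_of_E[OF f]] fm by (simp add: approximable_def)
    then show "f \<in> borel_measurable N"
      by (intro borel_measurableI_greater) (simp add: sp sets_N)
  qed (rule sp)
  with A have "(\<lambda>x. indicator A x) \<in> L2_closure" by (auto simp: sets_N approximable_def)
  then obtain c where "\<And>\<epsilon>. \<epsilon> > 0 \<Longrightarrow> \<exists>e\<in>E. (\<integral>x. (norm (complex_of_real (indicator A x) - e x))\<^sup>2 \<partial>M) < \<epsilon>"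
    by (rule L2_closureE) (rule that; assumption)
  from this[OF \<open>\<epsilon> > 0\<close>] show ?thesis by (simp add: of_real_indicator)
qed

end

section \<open>Trigonometric polynomials\<close>

definition trig_polys :: "((nat \<Rightarrow> real) \<Rightarrow> complex) set" where
  "trig_polys = {f. \<exists>(N::nat) (D::nat) c \<xi>. f = (\<lambda>x. \<Sum>i<N. c i * cis (\<Sum>j<D. \<xi> i j * x j))}"

lemma trig_polysI: "(\<lambda>x. \<Sum>i<N. c i * cis (\<Sum>j<D. \<xi> i j * x j)) \<in> trig_polys" for N D :: nat
  unfolding trig_polys_def by blast

lemma sum_lessThan_extend:
  fixes D D' :: nat
  assumes "D \<le> D'"
  shows "(\<Sum>j<D. \<xi> j * x j) = (\<Sum>j<D'. (if j < D then \<xi> j else 0) * (x j :: real))"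
proof -
  have "(\<Sum>j<D'. (if j < D then \<xi> j else 0) * x j) = (\<Sum>j<D'. if j \<in> {..<D} then \<xi> j * x j else 0)"
    by (intro sum.cong) auto
  also have "\<dots> = (\<Sum>j\<in>{..<D'} \<inter> {..<D}. \<xi> j * x j)"
    by (simp add: sum.inter_restrict)
  also have "{..<D'} \<inter> {..<D} = {..<D}" using assms by auto
  finally show ?thesis by simp
qed

text \<open>
  The number of coordinates may be enlarged at will by zero frequencies, so that several polynomials
  can be brought to a common number.
\<close>

lemma trig_polysE:
  assumes "f \<in> trig_polys"
  obtains N d :: nat and c \<xi> where "\<And>D. D \<ge> d \<Longrightarrow> f = (\<lambda>x. \<Sum>i<N. c i * cis (\<Sum>j<D. \<xi> i j * x j))"
proof -
  from assms obtain N D :: nat and c \<xi> where f: "f = (\<lambda>x. \<Sum>i<N. c i * cis (\<Sum>j<D. \<xi> i j * x j))"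
    by (auto simp: trig_polys_def)
  show ?thesis
  proof (rule that[where d = D and N = N and c = c and \<xi> = "\<lambda>i j. if j < D then \<xi> i j else 0"])
    fix D' assume "D \<le> D'"
    show "f = (\<lambda>x. \<Sum>i<N. c i * cis (\<Sum>j<D'. (if j < D then \<xi> i j else 0) * x j))"
      unfolding f sum_lessThan_extend[OF \<open>D \<le> D'\<close>] ..
  qed
qed

lemma trig_polys_pairE:
  assumes f: "f \<in> trig_polys" and g: "g \<in> trig_polys"
  obtains N N' D :: nat and c c' \<xi> \<xi>' where
    "f = (\<lambda>x. \<Sum>i<N. c i * cis (\<Sum>j<D. \<xi> i j * x j))"
    "g = (\<lambda>x. \<Sum>i<N'. c' i * cis (\<Sum>j<D. \<xi>' i j * x j))"
proof -
  obtain N D1 c \<xi> where f': "\<And>D. D \<ge> (D1::nat) \<Longrightarrow> f = (\<lambda>x. \<Sum>i<(N::nat). c i * cis (\<Sum>j<D. \<xi> i j * x j))"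
    using f by (rule trig_polysE) (rule that; assumption)
  obtain N' D2 c' \<xi>' where g': "\<And>D. D \<ge> (D2::nat) \<Longrightarrow> g = (\<lambda>x. \<Sum>i<(N'::nat). c' i * cis (\<Sum>j<D. \<xi>' i j * x j))"
    using g by (rule trig_polysE) (rule that; assumption)
  show ?thesis by (rule that[OF f'[OF max.cobounded1] g'[OF max.cobounded2]])
qed

lemma trig_polys_add:
  assumes "f \<in> trig_polys" "g \<in> trig_polys"
  shows "(\<lambda>x. f x + g x) \<in> trig_polys"
proof -
  obtain N N' P c c' \<xi> \<xi>' where f: "f = (\<lambda>x. \<Sum>i<(N::nat). c i * cis (\<Sum>j<(P::nat). \<xi> i j * x j))"
    and g: "g = (\<lambda>x. \<Sum>i<(N'::nat). c' i * cis (\<Sum>j<P. \<xi>' i j * x j))"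
    by (rule trig_polys_pairE[OF assms])
  let ?c = "\<lambda>i. if i < N then c i else c' (i - N)" and ?\<xi> = "\<lambda>i. if i < N then \<xi> i else \<xi>' (i - N)"
  have "f x + g x = (\<Sum>i<N + N'. ?c i * cis (\<Sum>j<P. ?\<xi> i j * x j))" for x
  proof -
    have split: "(\<Sum>i<N + N'. h i) = (\<Sum>i<N. h i) + (\<Sum>i<N'. h (i + N))" for h :: "nat \<Rightarrow> complex"
      using sum.atLeastLessThan_concat[of 0 N "N + N'" h, symmetric] sum.shift_bounds_nat_ivl[of h 0 N N']
      by (simp add: lessThan_atLeast0 add.commute)
    show ?thesis unfolding f g split by simp
  qed
  then show ?thesis using trig_polysI[where N = "N + N'" and D = P and c = ?c and \<xi> = ?\<xi>] by presburger
qed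

lemma trig_polys_const: "(\<lambda>_. c) \<in> trig_polys"
  using trig_polysI[where c = "\<lambda>_. c" and \<xi> = "\<lambda>_ _. 0" and D = 0 and N = 1] by simp

lemma trig_polys_sum:
  assumes "finite I" "\<And>i. i \<in> I \<Longrightarrow> F i \<in> trig_polys"
  shows "(\<lambda>x. \<Sum>i\<in>I. F i x) \<in> trig_polys"
  using assms
proof (induction rule: finite_induct)
  case empty
  then show ?case using trig_polys_const[of 0] by simp
next
  case (insert i I)
  then show ?case by (simp add: trig_polys_add)
qed

lemma trig_polys_mult:
  assumes "f \<in> trig_polys" "g \<in> trig_polys"
  shows "(\<lambda>x. f x * g x) \<in> trig_polys"
proof -
  obtain N N' P c c' \<xi> \<xi>' where f: "f = (\<lambda>x. \<Sum>i<(N::nat). c i * cis (\<Sum>j<(P::nat). \<xi> i j * x j))"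
    and g: "g = (\<lambda>x. \<Sum>i<(N'::nat). c' i * cis (\<Sum>j<P. \<xi>' i j * x j))"
    by (rule trig_polys_pairE[OF assms])
  have "f x * g x = (\<Sum>i<N. \<Sum>l<N'. \<Sum>_<(1::nat). (c i * c' l) * cis (\<Sum>j<P. (\<xi> i j + \<xi>' l j) * x j))" for x
    unfolding f g sum_product
    by (intro sum.cong refl) (simp add: distrib_right sum.distrib cis_mult[symmetric])
  then have "(\<lambda>x. f x * g x) = (\<lambda>x. \<Sum>i<N. \<Sum>l<N'. \<Sum>_<(1::nat). (c i * c' l) * cis (\<Sum>j<P. (\<xi> i j + \<xi>' l j) * x j))"
    by (rule ext)
  also have "\<dots> \<in> trig_polys"
    by (intro trig_polys_sum trig_polysI[where N = 1]) auto
  finally show ?thesis .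
qed

lemma trig_polys_sin: "(\<lambda>x. complex_of_real (sin (\<Sum>j<D. \<xi> j * x j))) \<in> trig_polys" for D :: nat
proof -
  have "(\<lambda>x. complex_of_real (sin (\<Sum>j<D. \<xi> j * x j))) =
     (\<lambda>x. (\<Sum>i<(1::nat). -\<i>/2 * cis (\<Sum>j<D. \<xi> j * x j)) + (\<Sum>i<(1::nat). \<i>/2 * cis (\<Sum>j<D. - \<xi> j * x j)))"
    by (simp add: fun_eq_iff sum_negf complex_eq_iff)
  then show ?thesis
    using trig_polys_add[OF trig_polysI[where c = "\<lambda>_. -\<i>/2" and \<xi> = "\<lambda>_. \<xi>" and D = D and N = 1] trig_polysI[where c = "\<lambda>_. \<i>/2" and \<xi> = "\<lambda>_ j. - \<xi> j" and D = D and N = 1]]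
    by simp
qed

lemma measurable_component_borel [measurable]:
  "(\<lambda>x::nat \<Rightarrow> real. x i) \<in> borel_measurable borel"
  by (rule measurable_product_then_coordinatewise) simp

lemma measurable_cis [measurable]: "cis \<in> borel_measurable borel"
  by (intro borel_measurable_continuous_onI continuous_on_cis continuous_on_id)

lemma trig_polys_measurable: "f \<in> trig_polys \<Longrightarrow> f \<in> borel_measurable borel"
  unfolding trig_polys_def by (auto intro!: borel_measurable_sum borel_measurable_times measurable_compose[OF _ measurable_cis])

lemma trig_polys_bounded: "f \<in> trig_polys \<Longrightarrow> \<exists>c. \<forall>x. norm (f x) \<le> c"
proof -
  assume "f \<in> trig_polys"
  then obtain N D :: nat and c \<xi> where f: "f = (\<lambda>x. \<Sum>i<N. c i * cis (\<Sum>j<D. \<xi> i j * x j))"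
    by (auto simp: trig_polys_def)
  have "norm (f x) \<le> (\<Sum>i<N. norm (c i))" for x
    unfolding f by (rule order_trans[OF norm_sum]) (simp add: norm_mult)
  then show ?thesis by blast
qed

lemma bounded_function_algebra_trig_polys:
  assumes "finite_measure M" "sets M = sets borel"
  shows "bounded_function_algebra M trig_polys"
proof -
  interpret finite_measure M by fact
  have [measurable_cong]: "sets M = sets borel" by fact
  show ?thesis
  proof
    show "e \<in> borel_measurable M" if "e \<in> trig_polys" for e
      using trig_polys_measurable[OF that] by simp
    show "\<exists>c. \<forall>x\<in>space M. norm (e x) \<le> c" if "e \<in> trig_polys" for e
      using trig_polys_bounded[OF that] by blast
  qed (auto intro: trig_polys_const trig_polys_add trig_polys_mult)
qed

lemma trig_polys_L2_dense:
  assumes M: "finite_measure M" "sets M = sets borel" and A: "A \<in> sets M" "\<epsilon> > 0"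
  shows "\<exists>e\<in>trig_polys. (\<integral>x. (norm (indicator A x - e x))\<^sup>2 \<partial>M) < \<epsilon>"
proof -
  interpret bounded_function_algebra M trig_polys
    using M by (rule bounded_function_algebra_trig_polys)
  show ?thesis
  proof (rule L2_dense[OF _ A])
    fix N :: "(nat \<Rightarrow> real) measure"
    assume N: "space N = space M" "sets N \<subseteq> sets M"
      and E: "\<And>f. (\<lambda>x. complex_of_real (f x)) \<in> trig_polys \<Longrightarrow> f \<in> borel_measurable N"
    have "(\<lambda>x. x j) \<in> borel_measurable N" for j
    proof (rule borel_measurable_LIMSEQ_real)
      \<comment> \<open>A coordinate is unbounded, but it is the limit of bounded trigonometric polynomials.\<close>
      show "(\<lambda>x. real n * sin (x j / real n)) \<in> borel_measurable N" for n
      proof -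
        have "(\<lambda>x. sin (\<Sum>i<Suc j. (if i = j then 1 / real n else 0) * x i)) \<in> borel_measurable N"
          by (rule E) (rule trig_polys_sin)
        then show ?thesis by (intro borel_measurable_times) (simp_all add: if_distrib[of "\<lambda>t. t * _"] cong: if_cong)
      qed
      show "(\<lambda>n. real n * sin (x j / real n)) \<longlonglongrightarrow> x j" for x
        by real_asymp
    qed
    then have "(\<lambda>x. x) \<in> borel_measurable N"
      by (rule measurable_coordinatewise_then_product)
    from measurable_sets[OF this] M(2) N(1) sets_eq_imp_space_eq[OF M(2)] show "sets M \<subseteq> sets N"
      by auto
  qed
qed
lemma integrable_bounded_prob:
  fixes f :: "'a \<Rightarrow> 'b::{banach, second_countable_topology}"
  assumes "finite_measure M" "f \<in> borel_measurable M" "\<And>x. norm (f x) \<le> c"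
  shows "integrable M f"
proof -
  interpret finite_measure M by fact
  show ?thesis using assms by (intro integrable_const_bound[where B = c]) auto
qed

lemma integrable_cis:
  assumes "finite_measure M" "g \<in> borel_measurable M"
  shows "integrable M (\<lambda>x. cis (g x))"
  using assms by (intro integrable_bounded_prob[where c = 1]) (auto intro: measurable_compose[OF _ measurable_cis])

lemma measurable_trig [measurable]:
  "(\<lambda>x::nat \<Rightarrow> real. \<Sum>j<D. \<xi> j * x j) \<in> borel_measurable borel" for D :: nat
  by (intro borel_measurable_sum borel_measurable_times) auto

text \<open>
  This replaces the Cauchy-Schwarz inequality for integrals: integrating it with \<open>\<delta>\<close> of the order of the
  \<open>L\<^sup>2\<close> norm of \<open>a\<close> bounds the integral of a product.
\<close>

lemma mult_le_weighted_sq: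
  fixes a b :: real
  assumes "\<delta> > 0"
  shows "a * b \<le> (a\<^sup>2 / \<delta> + \<delta> * b\<^sup>2) / 2"
proof -
  have "0 \<le> (a - \<delta> * b)\<^sup>2" by simp
  then have "2 * a * (\<delta> * b) \<le> a\<^sup>2 + \<delta>\<^sup>2 * b\<^sup>2" by (simp add: power2_diff power_mult_distrib)
  then show ?thesis using assms by (simp add: field_simps power2_eq_square)
qed

lemma norm_le_weighted_sq:
  fixes t :: real
  assumes "\<delta> > 0"
  shows "t \<le> (t\<^sup>2 / \<delta> + \<delta>) / 2"
  using mult_le_weighted_sq[OF assms, of t 1] by simp

lemma integrable_indicator_dist_sq:
  fixes f :: "'a \<Rightarrow> complex"
  assumes "finite_measure M" "A \<in> sets M" "f \<in> borel_measurable M" and f: "\<And>x. norm (f x) \<le> c"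
  shows "integrable M (\<lambda>x. (norm (indicator A x - f x))\<^sup>2)"
proof (rule integrable_bounded_prob[where c = "(1 + c)\<^sup>2"])
  fix x
  have "norm (indicator A x - f x) \<le> 1 + c"
    using norm_triangle_ineq4[of "indicator A x" "f x"] f[of x] by (auto simp: indicator_def split: if_splits)
  then show "norm ((norm (indicator A x - f x))\<^sup>2) \<le> (1 + c)\<^sup>2" by (simp add: power_mono)
qed (use assms in measurable)

text \<open>
  Closeness to an indicator in \<open>L\<^sup>2\<close> gives closeness of the integrals, by way of the \<open>L\<^sup>1\<close> distance.
\<close>

lemma measure_integral_approx:
  fixes f :: "'a \<Rightarrow> complex"
  assumes M: "prob_space M" and A: "A \<in> sets M" and fm: "f \<in> borel_measurable M" and f: "\<And>x. norm (f x) \<le> c"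
    and \<delta>: "\<delta> > 0" and le: "(\<integral>x. (norm (indicator A x - f x))\<^sup>2 \<partial>M) \<le> \<delta>\<^sup>2"
  shows "norm (of_real (measure M A) - (\<integral>x. f x \<partial>M)) \<le> \<delta>"
proof -
  interpret prob_space M by fact
  note sq = integrable_indicator_dist_sq[OF finite_measure_axioms A fm f]
  have int: "integrable M f" using fm f by (intro integrable_bounded_prob finite_measure_axioms)
  have inti: "integrable M (\<lambda>x. indicator A x :: complex)"
    using A by (intro integrable_bounded_prob[where c = 1] finite_measure_axioms) (auto simp: indicator_def)
  have "(\<integral>x. (indicator A x :: complex) \<partial>M) = of_real (measure M A)"
    using integral_complex_of_real[of M "indicator A"] A by (simp add: of_real_indicator)
  then have "of_real (measure M A) - (\<integral>x. f x \<partial>M) = (\<integral>x. indicator A x - f x \<partial>M)"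
    using inti int by simp
  then have "norm (of_real (measure M A) - (\<integral>x. f x \<partial>M)) \<le> (\<integral>x. norm (indicator A x - f x) \<partial>M)"
    by simp
  also have "\<dots> \<le> (\<integral>x. ((norm (indicator A x - f x))\<^sup>2 / \<delta> + \<delta>) / 2 \<partial>M)"
    using inti int sq norm_le_weighted_sq[OF \<delta>]
    by (intro integral_mono integrable_norm Bochner_Integration.integrable_diff) auto
  also have "\<dots> = ((\<integral>x. (norm (indicator A x - f x))\<^sup>2 \<partial>M) / \<delta> + \<delta>) / 2"
    using sq by (simp add: prob_space)
  also have "\<dots> \<le> (\<delta>\<^sup>2 / \<delta> + \<delta>) / 2"
    using le \<delta> by (intro divide_right_mono add_right_mono) auto
  also have "\<dots> = \<delta>" using \<delta> by (simp add: power2_eq_square)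
  finally show ?thesis .
qed

text \<open>
  Uniqueness of characteristic functions on sequences. A single trigonometric polynomial that is
  close to an indicator in \<open>L\<^sup>2\<close> of the sum of the two measures is close to it for both of them, and both
  measures integrate it to the same value.
\<close>

theorem trig_polys_determine_measure:
  assumes P: "prob_space P" "sets P = sets borel" and Q: "prob_space Q" "sets Q = sets borel"
    and eq: "\<And>(D::nat) \<xi>. (\<integral>x. cis (\<Sum>j<D. \<xi> j * x j) \<partial>P) = (\<integral>x. cis (\<Sum>j<D. \<xi> j * x j) \<partial>Q)"
  shows "P = (Q :: (nat \<Rightarrow> real) measure)"
proof -
  interpret P: prob_space P by fact
  interpret Q: prob_space Q by fact
  have [measurable_cong]: "sets P = sets borel" "sets Q = sets borel" by fact+
  have int_eq: "(\<integral>x. e x \<partial>P) = (\<integral>x. e x \<partial>Q)" if "e \<in> trig_polys" for e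
  proof -
    from that obtain N D :: nat and c \<xi> where e: "e = (\<lambda>x. \<Sum>i<N. c i * cis (\<Sum>j<D. \<xi> i j * x j))"
      by (auto simp: trig_polys_def)
    have "integrable P (\<lambda>x. cis (\<Sum>j<D. \<xi> i j * x j))" "integrable Q (\<lambda>x. cis (\<Sum>j<D. \<xi> i j * x j))" for i
      by (intro integrable_cis P.finite_measure_axioms Q.finite_measure_axioms; measurable)+
    then show ?thesis unfolding e by (simp add: integral_sum integral_mult_right_zero eq)
  qed
  define N where "N = measure_of UNIV (sets (borel :: (nat \<Rightarrow> real) measure)) (\<lambda>A. emeasure P A + emeasure Q A)"
  have sN [measurable_cong]: "sets N = sets borel"
    using sets.sets_measure_of_eq[of "borel :: (nat \<Rightarrow> real) measure"] by (simp add: N_def)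
  have N: "emeasure N A = emeasure P A + emeasure Q A" if "A \<in> sets borel" for A
    unfolding N_def
  proof (rule emeasure_measure_of_sigma[OF _ _ _ that])
    show "sigma_algebra UNIV (sets (borel :: (nat \<Rightarrow> real) measure))"
      using sets.sigma_algebra_axioms[of "borel :: (nat \<Rightarrow> real) measure"] by simp
    show "countably_additive (sets borel) (\<lambda>A. emeasure P A + emeasure Q A)"
    proof (rule countably_additiveI)
      fix F :: "nat \<Rightarrow> (nat \<Rightarrow> real) set"
      assume F: "range F \<subseteq> sets borel" "disjoint_family F"
      have "(\<Sum>i. emeasure P (F i) + emeasure Q (F i)) = (\<Sum>i. emeasure P (F i)) + (\<Sum>i. emeasure Q (F i))"
        by (simp add: suminf_add[symmetric])
      also have "\<dots> = emeasure P (\<Union>i. F i) + emeasure Q (\<Union>i. F i)"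
        using F P(2) Q(2) by (simp add: suminf_emeasure)
      finally show "(\<Sum>i. emeasure P (F i) + emeasure Q (F i)) = emeasure P (\<Union>i. F i) + emeasure Q (\<Union>i. F i)" .
    qed
  qed (simp add: positive_def)
  have "finite_measure N"
    using N[of UNIV] P.emeasure_space_1 Q.emeasure_space_1 sets_eq_imp_space_eq[OF P(2)]
      sets_eq_imp_space_eq[OF Q(2)] sets_eq_imp_space_eq[OF sN]
    by (intro finite_measureI) simp
  interpret N: finite_measure N by fact
  have approx: "\<bar>measure R A - Re (\<integral>x. e x \<partial>R)\<bar> \<le> \<delta>"
    if R: "prob_space R" "sets R = sets borel" "\<And>A. A \<in> sets borel \<Longrightarrow> emeasure R A \<le> emeasure N A"
      and e: "e \<in> trig_polys" "(\<integral>x. (norm (indicator A x - e x))\<^sup>2 \<partial>N) < \<delta>\<^sup>2" and \<delta>: "\<delta> > 0" and A: "A \<in> sets borel"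
    for R A e \<delta>
  proof -
    interpret R: prob_space R by fact
    have [measurable_cong]: "sets R = sets borel" by fact
    have [measurable]: "e \<in> borel_measurable borel" by (rule trig_polys_measurable[OF e(1)])
    have [measurable]: "A \<in> sets borel" by fact
    obtain c where c: "\<And>x. norm (e x) \<le> c" using trig_polys_bounded[OF e(1)] by blast
    have int: "integrable R (\<lambda>x. (norm (indicator A x - e x))\<^sup>2)" "integrable N (\<lambda>x. (norm (indicator A x - e x))\<^sup>2)"
      by (auto intro!: integrable_indicator_dist_sq[OF _ _ _ c] R.finite_measure_axioms N.finite_measure_axioms)
    have "(\<integral>\<^sup>+x. ennreal ((norm (indicator A x - e x))\<^sup>2) \<partial>R) \<le> (\<integral>\<^sup>+x. ennreal ((norm (indicator A x - e x))\<^sup>2) \<partial>N)"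
      using R(2,3) sN by (intro nn_integral_mono_measure) (auto simp: le_measure)
    with e(2) int have "(\<integral>x. (norm (indicator A x - e x))\<^sup>2 \<partial>R) \<le> \<delta>\<^sup>2"
      by (simp add: nn_integral_eq_integral)
    then have "norm (complex_of_real (measure R A) - (\<integral>x. e x \<partial>R)) \<le> \<delta>"
      by (intro measure_integral_approx[OF R(1) _ _ c \<delta>]) auto
    then show ?thesis
      using abs_Re_le_cmod[of "complex_of_real (measure R A) - (\<integral>x. e x \<partial>R)"] by simp
  qed
  have "measure P A = measure Q A" if A: "A \<in> sets borel" for A
  proof -
    have "\<bar>measure P A - measure Q A\<bar> \<le> 0 + \<delta>" if "\<delta> > 0" for \<delta>
    proof -
      obtain e where e: "e \<in> trig_polys" "(\<integral>x. (norm (indicator A x - e x))\<^sup>2 \<partial>N) < (\<delta>/2)\<^sup>2"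
        using trig_polys_L2_dense[OF N.finite_measure_axioms sN, of A "(\<delta>/2)\<^sup>2"] A sN \<open>\<delta> > 0\<close> by auto
      have "\<bar>measure P A - Re (\<integral>x. e x \<partial>P)\<bar> \<le> \<delta>/2" "\<bar>measure Q A - Re (\<integral>x. e x \<partial>Q)\<bar> \<le> \<delta>/2"
        using \<open>\<delta> > 0\<close> by (auto simp: N intro!: approx[OF P _ e _ A] approx[OF Q _ e _ A] simp del: divide_le_eq_numeral1 le_divide_eq_numeral1)
      then show ?thesis unfolding int_eq[OF e(1)] by linarith
    qed
    then have "\<bar>measure P A - measure Q A\<bar> \<le> 0" by (rule field_le_epsilon)
    then show ?thesis by simp
  qed
  then show ?thesis
    by (intro measure_eqI) (simp_all add: P(2) Q(2) P.emeasure_eq_measure Q.emeasure_eq_measure)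
qed

section \<open>Positive semidefinite kernels\<close>

text \<open>
  The \<open>k\<close>-th power of an inner product is the inner product of \<open>k\<close>-fold tensor powers, whose
  coordinates are indexed by the multi-indices \<open>J\<close>. For equal families the right-hand side is a sum of
  squares, so powers of positive semidefinite kernels are positive semidefinite.
\<close>

lemma power_sum_kernel:
  fixes x :: "'i \<Rightarrow> nat \<Rightarrow> real" and y :: "'l \<Rightarrow> nat \<Rightarrow> real"
  shows "(\<Sum>i\<in>A. \<Sum>l\<in>B. a i * cnj (b l) * of_real ((\<Sum>j<D. x i j * y l j) ^ k)) =
    (\<Sum>J\<in>PiE {..<k} (\<lambda>_. {..<D}). (\<Sum>i\<in>A. a i * of_real (\<Prod>t<k. x i (J t))) * cnj (\<Sum>l\<in>B. b l * of_real (\<Prod>t<k. y l (J t))))"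
proof -
  let ?\<J> = "PiE {..<k} (\<lambda>_. {..<D})"
  have pow: "(\<Sum>j<D. x i j * y l j) ^ k = (\<Sum>J\<in>?\<J>. (\<Prod>t<k. x i (J t)) * (\<Prod>t<k. y l (J t)))" for i l
    using prod_sum_PiE[of "{..<k}" "\<lambda>_. {..<D}" "\<lambda>_ j. x i j * y l j"]
    by (simp add: prod.distrib)
  have "(\<Sum>i\<in>A. \<Sum>l\<in>B. a i * cnj (b l) * of_real ((\<Sum>j<D. x i j * y l j) ^ k)) =
     (\<Sum>i\<in>A. \<Sum>l\<in>B. \<Sum>J\<in>?\<J>. (a i * of_real (\<Prod>t<k. x i (J t))) * cnj (b l * of_real (\<Prod>t<k. y l (J t))))"
    unfolding pow by (intro sum.cong refl) (simp add: sum_distrib_left mult_ac)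
  also have "\<dots> = (\<Sum>i\<in>A. \<Sum>J\<in>?\<J>. \<Sum>l\<in>B. (a i * of_real (\<Prod>t<k. x i (J t))) * cnj (b l * of_real (\<Prod>t<k. y l (J t))))"
    by (intro sum.cong refl sum.swap)
  also have "\<dots> = (\<Sum>J\<in>?\<J>. \<Sum>i\<in>A. \<Sum>l\<in>B. (a i * of_real (\<Prod>t<k. x i (J t))) * cnj (b l * of_real (\<Prod>t<k. y l (J t))))"
    by (rule sum.swap)
  also have "\<dots> = (\<Sum>J\<in>?\<J>. (\<Sum>i\<in>A. a i * of_real (\<Prod>t<k. x i (J t))) * cnj (\<Sum>l\<in>B. b l * of_real (\<Prod>t<k. y l (J t))))"
    unfolding sum_product cnj_sum ..
  finally show ?thesis .
qed

definition psd_kernel :: "(nat \<Rightarrow> nat \<Rightarrow> real) \<Rightarrow> bool" where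
  "psd_kernel K \<longleftrightarrow> (\<forall>m n. K m n = K n m) \<and>
     (\<forall>I a. finite I \<longrightarrow> 0 \<le> (\<Sum>m\<in>I. \<Sum>n\<in>I. a m * a n * K m n))"

lemma psd_kernel_sym: "psd_kernel K \<Longrightarrow> K m n = K n m"
  unfolding psd_kernel_def by blast

lemma psd_kernel_nonneg: "psd_kernel K \<Longrightarrow> finite I \<Longrightarrow> 0 \<le> (\<Sum>m\<in>I. \<Sum>n\<in>I. a m * a n * K m n)"
  unfolding psd_kernel_def by blast

lemma psd_kernel_diag: "psd_kernel K \<Longrightarrow> 0 \<le> K m m"
  using psd_kernel_nonneg[of K "{m}" "\<lambda>_. 1"] by simp

lemma psd_kernel_zero_row:
  assumes K: "psd_kernel K" and "K i i = 0"
  shows "K m i = 0"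
proof (cases "m = i")
  case False
  have "0 \<le> K m m + 2 * c * K m i" for c
    using psd_kernel_nonneg[OF K, of "{m, i}" "\<lambda>j. if j = m then 1 else c"] False assms(2)
      psd_kernel_sym[OF K, of i m] by simp
  from this[of "- (K m m + 1) / (2 * K m i)"] show ?thesis
    by (cases "K m i = 0") (auto simp: field_simps)
qed (use assms in simp)

definition schur_complement :: "(nat \<Rightarrow> nat \<Rightarrow> real) \<Rightarrow> nat \<Rightarrow> nat \<Rightarrow> nat \<Rightarrow> real" where
  "schur_complement K i m n = K m n - K m i * K n i / K i i"

text \<open>
  If \<open>K i i\<close> is positive, then the quadratic form of the Schur complement at \<open>a\<close> is the minimum over
  all \<open>c\<close> of the form of \<open>K\<close> at \<open>a + c e\<^sub>i\<close>. If \<open>K i i = 0\<close>, the division by zero makes the Schur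
  complement equal to \<open>K\<close>.
\<close>

lemma psd_kernel_schur_complement:
  assumes K: "psd_kernel K"
  shows "psd_kernel (schur_complement K i)"
proof (cases "K i i = 0")
  case True
  then have "schur_complement K i = K" by (intro ext) (simp add: schur_complement_def)
  then show ?thesis using K by simp
next
  case False
  have "0 \<le> (\<Sum>m\<in>I. \<Sum>n\<in>I. a m * a n * schur_complement K i m n)" if I: "finite I" for I a
  proof -
    define S where "S = insert i I"
    have S: "finite S" "i \<in> S" "I \<subseteq> S" using I by (auto simp: S_def)
    define a' where "a' m = (if m \<in> I then a m else 0)" for m
    have ext: "(\<Sum>m\<in>I. a m * h m) = (\<Sum>m\<in>S. a' m * h m)" for h
      using S by (intro sum.mono_neutral_cong_left) (auto simp: a'_def)
    define L where "L = (\<Sum>m\<in>S. a' m * K m i)"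
    define c where "c = - L / K i i"
    have "(\<Sum>m\<in>I. \<Sum>n\<in>I. a m * a n * schur_complement K i m n) = (\<Sum>m\<in>S. a' m * (\<Sum>n\<in>S. a' n * schur_complement K i m n))"
      by (simp add: mult.assoc sum_distrib_left[symmetric] ext)
    also have "\<dots> = (\<Sum>m\<in>S. \<Sum>n\<in>S. a' m * a' n * K m n) - L * L / K i i"
      unfolding schur_complement_def L_def sum_product
      by (simp add: sum_distrib_left right_diff_distrib sum_subtractf sum_divide_distrib mult_ac)
    also have "\<dots> = (\<Sum>m\<in>S. \<Sum>n\<in>S. (a' m + (if m = i then c else 0)) * (a' n + (if n = i then c else 0)) * K m n)"
    proof -
      have d: "(if P then c else 0) * t = (if P then c * t else 0)" "t * (if P then c else 0) = (if P then t * c else 0)" for P t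
        by auto
      have "(\<Sum>m\<in>S. \<Sum>n\<in>S. (a' m + (if m = i then c else 0)) * (a' n + (if n = i then c else 0)) * K m n)
        = (\<Sum>m\<in>S. \<Sum>n\<in>S. a' m * a' n * K m n + (if n = i then a' m * c * K m n else 0)
            + (if m = i then c * a' n * K m n else 0) + (if m = i then if n = i then c * c * K m n else 0 else 0))"
        by (intro sum.cong refl) (simp add: algebra_simps)
      also have "\<dots> = (\<Sum>m\<in>S. \<Sum>n\<in>S. a' m * a' n * K m n) + (\<Sum>m\<in>S. a' m * c * K m i)
            + (\<Sum>n\<in>S. c * a' n * K i n) + c * c * K i i"
      proof -
        have 1: "(\<Sum>m\<in>S. \<Sum>n\<in>S. if m = i then h n else 0) = (\<Sum>n\<in>S. h n)" for h :: "nat \<Rightarrow> real"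
          using S by (subst sum.swap) simp
        have 2: "(\<Sum>m\<in>S. \<Sum>n\<in>S. (if m = i then c * a' n * K m n else 0)) = (\<Sum>n\<in>S. c * a' n * K i n)"
          using 1[of "\<lambda>n. c * a' n * K i n"] by (simp cong: if_cong)
        have 3: "(\<Sum>m\<in>S. \<Sum>n\<in>S. (if m = i then if n = i then c * c * K m n else 0 else 0)) = c * c * K i i"
          using 1[of "\<lambda>n. if n = i then c * c * K i n else 0"] S by (simp cong: if_cong)
        show ?thesis unfolding sum.distrib 2 3 using S by simp
      qed
      also have "\<dots> = (\<Sum>m\<in>S. \<Sum>n\<in>S. a' m * a' n * K m n) + 2 * c * L + c * c * K i i"
      proof -
        have "(\<Sum>m\<in>S. a' m * c * K m i) = c * L" "(\<Sum>n\<in>S. c * a' n * K i n) = c * L"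
          unfolding L_def sum_distrib_left using psd_kernel_sym[OF K, of i] by (auto intro!: sum.cong)
        then show ?thesis by simp
      qed
      finally show ?thesis using False by (simp add: c_def field_simps)
    qed
    also have "\<dots> \<ge> 0" by (rule psd_kernel_nonneg[OF K S(1)])
    finally show ?thesis .
  qed
  moreover have "schur_complement K i m n = schur_complement K i n m" for m n
    using psd_kernel_sym[OF K, of m n] by (simp add: schur_complement_def mult.commute)
  ultimately show ?thesis by (simp add: psd_kernel_def)
qed

text \<open>
  Cholesky decomposition by successive Schur complements: after step \<open>i\<close> the first \<open>i + 1\<close> rows and
  columns vanish. The matrix \<open>c\<close> is lower triangular, so every entry of \<open>K\<close> is a finite sum.
\<close>

theorem psd_kernel_cholesky:
  assumes K: "psd_kernel K"
  obtains c :: "nat \<Rightarrow> nat \<Rightarrow> real"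
  where "\<And>m j. m < j \<Longrightarrow> c m j = 0" "\<And>N m n. m < N \<Longrightarrow> K m n = (\<Sum>j<N. c m j * c n j)"
proof -
  define R where "R = rec_nat K (\<lambda>i L. schur_complement L i)"
  have R0: "R 0 = K" and RS: "R (Suc i) = schur_complement (R i) i" for i by (simp_all add: R_def)
  have psd: "psd_kernel (R i)" for i
    by (induction i) (simp_all add: R0 RS K psd_kernel_schur_complement)
  have zero: "R N m n = 0" if "m < N" for N m n
    using that
  proof (induction N arbitrary: m n)
    case (Suc N)
    show ?case
    proof (cases "m = N")
      case True
      show ?thesis
      proof (cases "R N N N = 0")
        case True
        then show ?thesis
          using \<open>m = N\<close> psd_kernel_zero_row[OF psd True, of n] psd_kernel_sym[OF psd, of N N n]
          by (simp add: RS schur_complement_def)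
      next
        case False
        then show ?thesis
          using \<open>m = N\<close> psd_kernel_sym[OF psd, of N N n] by (simp add: RS schur_complement_def)
      qed
    next
      case False
      then have "m < N" using Suc.prems by simp
      then show ?thesis using Suc.IH by (simp add: RS schur_complement_def)
    qed
  qed simp
  define c where "c m j = R j m j / sqrt (R j j j)" for m j
  have cc: "c m j * c n j = R j m j * R j n j / R j j j" for m n j
    using psd_kernel_diag[OF psd, of j j] by (simp add: c_def)
  have decomp: "K m n = R N m n + (\<Sum>j<N. c m j * c n j)" for N m n
    by (induction N) (simp_all add: R0 RS schur_complement_def cc)
  show ?thesis
  proof (rule that[of c])
    show "c m j = 0" if "m < j" for m j using zero[OF that] by (simp add: c_def)
    show "K m n = (\<Sum>j<N. c m j * c n j)" if "m < N" for N m n using decomp[of m n N] zero[OF that] by simp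
  qed
qed
section \<open>Gaussian processes with a given covariance\<close>

lemma cis_sum: "cis (\<Sum>i\<in>I. f i) = (\<Prod>i\<in>I. cis (f i))"
  by (induction I rule: infinite_finite_induct) (simp_all add: cis_mult[symmetric])

lemma char_iid_gaussian:
  "(\<integral>z. cis (\<Sum>j<D. t j * z j) \<partial>PiM UNIV (\<lambda>_::nat. std_normal_distribution)) =
     of_real (exp (- (\<Sum>j<D. (t j)\<^sup>2) / 2))" for D :: nat
proof -
  interpret N: real_distribution std_normal_distribution by (rule real_dist_normal_dist)
  interpret product_prob_space "\<lambda>_::nat. std_normal_distribution" UNIV ..
  let ?J = "{..<D}"
  have comp [measurable]: "(\<lambda>x. x j) \<in> borel_measurable (PiM ?J (\<lambda>_. std_normal_distribution))" if "j \<in> ?J" for j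
    using measurable_component_singleton[OF that, of "\<lambda>_. std_normal_distribution"] by simp
  have "(\<integral>z. cis (\<Sum>j<D. t j * z j) \<partial>PiM UNIV (\<lambda>_::nat. std_normal_distribution)) =
      (\<integral>z. (\<Prod>j\<in>?J. cis (t j * restrict z ?J j)) \<partial>PiM UNIV (\<lambda>_::nat. std_normal_distribution))"
    by (simp add: cis_sum)
  also have "\<dots> = (\<integral>z. (\<Prod>j\<in>?J. cis (t j * z j)) \<partial>distr (PiM UNIV (\<lambda>_::nat. std_normal_distribution))
      (PiM ?J (\<lambda>_. std_normal_distribution)) (\<lambda>z. restrict z ?J))"
    by (subst integral_distr) (auto intro!: borel_measurable_prod measurable_compose[OF _ measurable_cis] borel_measurable_times comp)
  also have "\<dots> = (\<integral>z. (\<Prod>j\<in>?J. cis (t j * z j)) \<partial>PiM ?J (\<lambda>_. std_normal_distribution))"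
    by (subst distr_PiM_restrict_finite) auto
  also have "\<dots> = (\<Prod>j\<in>?J. \<integral>x. cis (t j * x) \<partial>std_normal_distribution)"
    by (rule product_integral_prod) (auto intro!: integrable_cis N.finite_measure_axioms)
  also have "\<dots> = (\<Prod>j\<in>?J. complex_of_real (exp (- ((t j)\<^sup>2) / 2)))"
  proof (intro prod.cong refl)
    fix j
    have "(\<integral>x. cis (t j * x) \<partial>std_normal_distribution) = char std_normal_distribution (t j)"
      unfolding char_def cis_conv_exp by (simp add: mult.commute)
    then show "(\<integral>x. cis (t j * x) \<partial>std_normal_distribution) = complex_of_real (exp (- ((t j)\<^sup>2) / 2))"
      by (simp add: char_std_normal_distribution)
  qed
  also have "\<dots> = of_real (exp (- (\<Sum>j<D. (t j)\<^sup>2) / 2))"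
  proof -
    have "- (\<Sum>j<D. (t j)\<^sup>2) / 2 = (\<Sum>j<D. - ((t j)\<^sup>2) / 2)"
      by (simp add: sum_negf sum_divide_distrib)
    then have "exp (- (\<Sum>j<D. (t j)\<^sup>2) / 2) = (\<Prod>j<D. exp (- ((t j)\<^sup>2) / 2))"
      by (simp only: exp_sum[OF finite_lessThan])
    then show ?thesis by (simp only: of_real_prod)
  qed
  finally show ?thesis .
qed

text \<open>
  The process is the image of independent standard normal variables under the lower triangular
  Cholesky factor of the covariance.
\<close>

theorem gaussian_process_exists:
  assumes K: "psd_kernel K"
  obtains M :: "(nat \<Rightarrow> real) measure" where "prob_space M" "sets M = sets borel"
    "\<And>(D::nat) \<xi>. (\<integral>x. cis (\<Sum>n<D. \<xi> n * x n) \<partial>M) =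
       of_real (exp (- (\<Sum>n<D. \<Sum>m<D. \<xi> n * \<xi> m * K n m) / 2))"
proof -
  obtain c where c0: "\<And>m j. m < j \<Longrightarrow> c m j = 0" and c: "\<And>N m n. m < N \<Longrightarrow> K m n = (\<Sum>j<N. c m j * c n j)"
    using psd_kernel_cholesky[OF K] by metis
  interpret N: real_distribution std_normal_distribution by (rule real_dist_normal_dist)
  interpret product_prob_space "\<lambda>_::nat. std_normal_distribution" UNIV ..
  define Z where "Z = PiM UNIV (\<lambda>_::nat. std_normal_distribution)"
  have Z: "prob_space Z" unfolding Z_def by (rule prob_space_axioms)
  interpret Z: prob_space Z by (rule Z)
  have sZ [measurable_cong]: "sets Z = sets borel"
  proof -
    have "sets Z = sets (PiM UNIV (\<lambda>_::nat. borel :: real measure))"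
      unfolding Z_def by (rule sets_PiM_cong) auto
    then show ?thesis by (simp add: sets_PiM_equal_borel)
  qed
  define Y where "Y z n = (\<Sum>j<Suc n. c n j * z j)" for z :: "nat \<Rightarrow> real" and n :: nat
  have Y [measurable]: "Y \<in> borel_measurable Z"
    unfolding Y_def by (rule measurable_coordinatewise_then_product) measurable
  define M where "M = distr Z borel Y"
  show ?thesis
  proof (rule that[of M])
    show "prob_space M" unfolding M_def by (rule Z.prob_space_distr) (rule Y)
    show "sets M = sets borel" by (simp add: M_def)
    fix D :: nat and \<xi> :: "nat \<Rightarrow> real"
    define t where "t j = (\<Sum>n<D. \<xi> n * c n j)" for j
    have lin: "(\<Sum>n<D. \<xi> n * Y z n) = (\<Sum>j<D. t j * z j)" for z
    proof -
      have "Y z n = (\<Sum>j<D. c n j * z j)" if "n < D" for n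
        unfolding Y_def using that c0 by (intro sum.mono_neutral_left) auto
      then have "(\<Sum>n<D. \<xi> n * Y z n) = (\<Sum>n<D. \<Sum>j<D. \<xi> n * c n j * z j)"
        by (intro sum.cong refl) (simp add: sum_distrib_left mult_ac)
      also have "\<dots> = (\<Sum>j<D. t j * z j)"
        by (subst sum.swap) (simp add: t_def sum_distrib_right)
      finally show ?thesis .
    qed
    have quad: "(\<Sum>j<D. (t j)\<^sup>2) = (\<Sum>n<D. \<Sum>m<D. \<xi> n * \<xi> m * K n m)"
    proof -
      have "(\<Sum>j<D. (t j)\<^sup>2) = (\<Sum>j<D. \<Sum>n<D. \<Sum>m<D. \<xi> n * \<xi> m * (c n j * c m j))"
        unfolding t_def power2_eq_square sum_product by (simp add: mult_ac)
      also have "\<dots> = (\<Sum>n<D. \<Sum>j<D. \<Sum>m<D. \<xi> n * \<xi> m * (c n j * c m j))"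
        by (rule sum.swap)
      also have "\<dots> = (\<Sum>n<D. \<Sum>m<D. \<Sum>j<D. \<xi> n * \<xi> m * (c n j * c m j))"
        by (intro sum.cong refl sum.swap)
      also have "\<dots> = (\<Sum>n<D. \<Sum>m<D. \<xi> n * \<xi> m * K n m)"
        using c[of _ D] by (intro sum.cong refl) (simp add: sum_distrib_left)
      finally show ?thesis .
    qed
    have "(\<integral>x. cis (\<Sum>n<D. \<xi> n * x n) \<partial>M) = (\<integral>z. cis (\<Sum>n<D. \<xi> n * Y z n) \<partial>Z)"
      unfolding M_def by (rule integral_distr[OF Y]) (intro measurable_compose[OF measurable_trig measurable_cis])
    also have "\<dots> = of_real (exp (- (\<Sum>j<D. (t j)\<^sup>2) / 2))"
      unfolding lin Z_def by (rule char_iid_gaussian)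
    finally show "(\<integral>x. cis (\<Sum>n<D. \<xi> n * x n) \<partial>M) =
       of_real (exp (- (\<Sum>n<D. \<Sum>m<D. \<xi> n * \<xi> m * K n m) / 2))" unfolding quad .
  qed
qed

definition gauss_cov :: "'h::real_inner \<Rightarrow> real" where
  "gauss_cov h = exp (- (norm h)\<^sup>2 / 2)"

text \<open>
  Up to the factors \<open>exp (- \<parallel>d m\<parallel>\<^sup>2 / 2)\<close>, which can be absorbed in the coefficients, the kernel is
  \<open>exp (d m \<bullet> d n)\<close>, a power series with nonnegative coefficients in the positive semidefinite kernel
  \<open>d m \<bullet> d n\<close>.
\<close>

lemma psd_kernel_gauss_cov: "psd_kernel (\<lambda>m n. gauss_cov (d m - d n))"
  for d :: "nat \<Rightarrow> 'h::real_inner"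
  unfolding psd_kernel_def
proof (intro conjI allI impI)
  show "gauss_cov (d m - d n) = gauss_cov (d n - d m)" for m n
    by (simp add: gauss_cov_def norm_minus_commute)
  fix I :: "nat set" and a :: "nat \<Rightarrow> real"
  assume I: "finite I"
  have inner_psd: "psd_kernel (\<lambda>m n. d m \<bullet> d n)"
    unfolding psd_kernel_def
  proof (intro conjI allI impI)
    fix J :: "nat set" and b :: "nat \<Rightarrow> real"
    have "(\<Sum>m\<in>J. \<Sum>n\<in>J. b m * b n * (d m \<bullet> d n)) = (\<Sum>m\<in>J. b m *\<^sub>R d m) \<bullet> (\<Sum>m\<in>J. b m *\<^sub>R d m)"
      by (simp add: inner_sum_left inner_sum_right sum_distrib_left mult_ac inner_commute)
    then show "0 \<le> (\<Sum>m\<in>J. \<Sum>n\<in>J. b m * b n * (d m \<bullet> d n))" by simp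
  qed (rule inner_commute)
  obtain c where c: "\<And>N m n. m < N \<Longrightarrow> d m \<bullet> d n = (\<Sum>j<N. c m j * c n j)"
    using psd_kernel_cholesky[OF inner_psd] by metis
  obtain N where N: "\<And>m. m \<in> I \<Longrightarrow> m < N" using finite_nat_set_iff_bounded[of I] I by auto
  define b where "b m = a m * exp (- (norm (d m))\<^sup>2 / 2)" for m
  have pow: "0 \<le> (\<Sum>m\<in>I. \<Sum>n\<in>I. b m * b n * (d m \<bullet> d n) ^ k)" for k
  proof -
    define F where "F J = (\<Sum>m\<in>I. complex_of_real (b m) * of_real (\<Prod>t<k. c m (J t)))" for J
    have "complex_of_real (\<Sum>m\<in>I. \<Sum>n\<in>I. b m * b n * (d m \<bullet> d n) ^ k) =
        (\<Sum>m\<in>I. \<Sum>n\<in>I. of_real (b m) * cnj (of_real (b n)) * of_real ((\<Sum>j<N. c m j * c n j) ^ k))"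
      unfolding of_real_sum by (intro sum.cong refl) (simp add: c[OF N])
    also have "\<dots> = (\<Sum>J\<in>PiE {..<k} (\<lambda>_. {..<N}). F J * cnj (F J))"
      unfolding F_def by (rule power_sum_kernel)
    also have "\<dots> = complex_of_real (\<Sum>J\<in>PiE {..<k} (\<lambda>_. {..<N}). (norm (F J))\<^sup>2)"
      by (simp only: complex_norm_square[symmetric] of_real_sum)
    finally have "(\<Sum>m\<in>I. \<Sum>n\<in>I. b m * b n * (d m \<bullet> d n) ^ k) = (\<Sum>J\<in>PiE {..<k} (\<lambda>_. {..<N}). (norm (F J))\<^sup>2)"
      by (simp only: of_real_eq_iff)
    then show ?thesis by (simp add: sum_nonneg)
  qed
  have term_eq: "a m * a n * gauss_cov (d m - d n) = b m * b n * exp (d m \<bullet> d n)" for m n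
  proof -
    have "- (norm (d m - d n))\<^sup>2 / 2 = - (norm (d m))\<^sup>2 / 2 + - (norm (d n))\<^sup>2 / 2 + d m \<bullet> d n"
      by (simp add: power2_norm_eq_inner inner_diff_left inner_diff_right inner_commute field_simps)
    then show ?thesis by (simp only: gauss_cov_def b_def exp_add mult_ac)
  qed
  have series: "(\<lambda>k. \<Sum>m\<in>I. \<Sum>n\<in>I. b m * b n * ((d m \<bullet> d n) ^ k /\<^sub>R fact k)) sums (\<Sum>m\<in>I. \<Sum>n\<in>I. b m * b n * exp (d m \<bullet> d n))"
    by (intro sums_sum sums_mult exp_converges)
  have nonneg: "0 \<le> (\<Sum>m\<in>I. \<Sum>n\<in>I. b m * b n * ((d m \<bullet> d n) ^ k /\<^sub>R fact k))" for k
  proof -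
    have "(\<Sum>m\<in>I. \<Sum>n\<in>I. b m * b n * ((d m \<bullet> d n) ^ k /\<^sub>R fact k)) = (\<Sum>m\<in>I. \<Sum>n\<in>I. b m * b n * (d m \<bullet> d n) ^ k) / fact k"
      by (simp add: sum_divide_distrib divide_inverse mult_ac sum_distrib_left)
    then show ?thesis using pow[of k] by simp
  qed
  have "0 \<le> (\<Sum>m\<in>I. \<Sum>n\<in>I. b m * b n * exp (d m \<bullet> d n))"
    by (rule sums_le[OF nonneg sums_zero series])
  then show "0 \<le> (\<Sum>m\<in>I. \<Sum>n\<in>I. a m * a n * gauss_cov (d m - d n))"
    unfolding term_eq .
qed

text \<open>
  By Fatou's lemma: \<open>Z\<^sup>2\<close> is the limit of \<open>2 n\<^sup>2 (1 - cos (Z / n))\<close>, and the characteristic function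
  gives the integral of the latter. No integrability of \<open>Z\<^sup>2\<close> is presupposed. The case \<open>\<sigma> = 0\<close>
  recognises variables that vanish almost surely.
\<close>

lemma second_moment_le:
  fixes Z :: "'a \<Rightarrow> real"
  assumes M: "prob_space M" and Z [measurable]: "Z \<in> borel_measurable M"
    and char: "\<And>t. (\<integral>x. cis (t * Z x) \<partial>M) = of_real (exp (- (t\<^sup>2 * \<sigma>) / 2))"
  shows "(\<integral>\<^sup>+x. ennreal ((Z x)\<^sup>2) \<partial>M) \<le> ennreal \<sigma>"
proof -
  interpret prob_space M by fact
  define u where "u k x = 2 * (real (Suc k))\<^sup>2 * (1 - cos (Z x / real (Suc k)))" for k x
  have u0: "0 \<le> u k x" for k x by (simp add: u_def)
  have um [measurable]: "u k \<in> borel_measurable M" for k unfolding u_def by measurable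
  have int_cos: "integrable M (\<lambda>x. cos (t * Z x))" "(\<integral>x. cos (t * Z x) \<partial>M) = exp (- (t\<^sup>2 * \<sigma>) / 2)" for t
  proof -
    have i: "integrable M (\<lambda>x. cis (t * Z x))" by (intro integrable_cis finite_measure_axioms) measurable
    from integrable_Re[OF i] show "integrable M (\<lambda>x. cos (t * Z x))" by simp
    from integral_Re[OF i] show "(\<integral>x. cos (t * Z x) \<partial>M) = exp (- (t\<^sup>2 * \<sigma>) / 2)" by (simp add: char)
  qed
  have int_u: "(\<integral>\<^sup>+x. ennreal (u k x) \<partial>M) \<le> ennreal \<sigma>" for k
  proof -
    let ?n = "real (Suc k)"
    have iu: "integrable M (u k)"
      unfolding u_def using int_cos(1)[of "1 / ?n"] by (intro integrable_mult_right Bochner_Integration.integrable_diff) auto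
    have "(\<integral>x. u k x \<partial>M) = 2 * ?n\<^sup>2 * (1 - exp (- ((1/?n)\<^sup>2 * \<sigma>) / 2))"
      unfolding u_def using int_cos[of "1 / ?n"] by (simp add: prob_space)
    also have "\<dots> \<le> 2 * ?n\<^sup>2 * ((1/?n)\<^sup>2 * \<sigma> / 2)"
      using exp_ge_add_one_self[of "- ((1/?n)\<^sup>2 * \<sigma>) / 2"] by (intro mult_left_mono) auto
    also have "\<dots> = \<sigma>" by (simp add: power_divide)
    finally have "(\<integral>x. u k x \<partial>M) \<le> \<sigma>" .
    then show ?thesis using iu u0 by (simp add: nn_integral_eq_integral ennreal_leI)
  qed
  have lim: "(\<lambda>k. u k x) \<longlonglongrightarrow> (Z x)\<^sup>2" for x
    unfolding u_def power2_eq_square by real_asymp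
  have "(\<integral>\<^sup>+x. ennreal ((Z x)\<^sup>2) \<partial>M) = (\<integral>\<^sup>+x. liminf (\<lambda>k. ennreal (u k x)) \<partial>M)"
    using lim by (intro nn_integral_cong lim_imp_Liminf[symmetric] tendsto_ennrealI) auto
  also have "\<dots> \<le> liminf (\<lambda>k. \<integral>\<^sup>+x. ennreal (u k x) \<partial>M)"
    by (rule nn_integral_liminf) measurable
  also have "\<dots> \<le> ennreal \<sigma>"
    by (rule order_trans[OF Liminf_mono[where g = "\<lambda>_. ennreal \<sigma>"]]) (auto intro!: always_eventually int_u simp: Liminf_const)
  finally show ?thesis .
qed

lemma AE_zero_if_char_one:
  fixes Z :: "'a \<Rightarrow> real"
  assumes "prob_space M" "Z \<in> borel_measurable M" "\<And>t. (\<integral>x. cis (t * Z x) \<partial>M) = 1"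
  shows "AE x in M. Z x = 0"
proof -
  note [measurable] = assms(2)
  have "(\<integral>\<^sup>+x. ennreal ((Z x)\<^sup>2) \<partial>M) \<le> ennreal 0"
    by (rule second_moment_le) (simp_all add: assms)
  then have "AE x in M. ennreal ((Z x)\<^sup>2) = 0"
    by (subst nn_integral_0_iff_AE[symmetric]) auto
  then show ?thesis by (auto simp: ennreal_eq_0_iff)
qed
section \<open>Near-actions from almost everywhere defined transformations\<close>

lemma AE_measure_preserving:
  assumes "f \<in> measurable M M" "distr M M f = M" "AE x in M. P x"
  shows "AE x in M. P (f x)"
proof -
  have "AE x in distr M M f. P x" by (subst assms(2)) (rule assms(3))
  then show ?thesis by (rule AE_distrD[OF assms(1)])
qed

lemma measurable_funpow: "f \<in> measurable M M \<Longrightarrow> f ^^ k \<in> measurable M M"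
  by (induction k) (auto intro: measurable_comp simp: id_def[symmetric])

lemma AE_funpow:
  assumes f: "f \<in> measurable M M" "distr M M f = M" and P: "AE x in M. P x"
  shows "AE x in M. P ((f ^^ k) x)"
proof (induction k)
  case (Suc k)
  from AE_measure_preserving[OF f this] show ?case by (simp add: funpow_swap1)
qed (use P in simp)

text \<open>
  Members of \<open>inv_mpt\<close> are bijections of the whole space. Let \<open>Y0\<close> be a set of full measure on which
  \<open>S\<close> and \<open>T\<close> invert each other. The points whose orbits under \<open>S\<close> and under \<open>T\<close> stay in \<open>Y0\<close> form a
  set of full measure that both maps preserve; outside it the modification is the identity.
\<close>

theorem inv_mpt_modification:
  assumes S: "S \<in> measurable M M" "distr M M S = M" and T: "T \<in> measurable M M" "distr M M T = M"
    and TS: "AE x in M. T (S x) = x" and ST: "AE x in M. S (T x) = x"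
  obtains R where "R \<in> inv_mpt M" "AE x in M. R x = S x"
proof -
  from TS ST have "AE x in M. T (S x) = x \<and> S (T x) = x" by eventually_elim simp
  then obtain N where N: "N \<in> null_sets M" "{x \<in> space M. \<not> (T (S x) = x \<and> S (T x) = x)} \<subseteq> N"
    by (auto simp: eventually_ae_filter)
  define Y0 where "Y0 = space M - N"
  have Y0: "Y0 \<in> sets M" "\<And>x. x \<in> Y0 \<Longrightarrow> T (S x) = x" "\<And>x. x \<in> Y0 \<Longrightarrow> S (T x) = x"
    using N by (auto simp: Y0_def)
  have AE_Y0: "AE x in M. x \<in> Y0"
    using AE_not_in[OF N(1)] AE_space by eventually_elim (simp add: Y0_def)
  define Y where "Y = {x \<in> space M. \<forall>k. (S ^^ k) x \<in> Y0 \<and> (T ^^ k) x \<in> Y0}"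
  have Y_meas: "Y \<in> sets M"
  proof -
    have "Measurable.pred M (\<lambda>x. (S ^^ k) x \<in> Y0)" "Measurable.pred M (\<lambda>x. (T ^^ k) x \<in> Y0)" for k
      using measurable_funpow[OF S(1), of k] measurable_funpow[OF T(1), of k] Y0(1)
      by (auto intro: pred_sets2)
    then show ?thesis unfolding Y_def by measurable
  qed
  have AE_Y: "AE x in M. x \<in> Y"
  proof -
    have "AE x in M. \<forall>k. (S ^^ k) x \<in> Y0 \<and> (T ^^ k) x \<in> Y0"
      unfolding AE_all_countable AE_conj_iff
      using AE_funpow[OF S AE_Y0] AE_funpow[OF T AE_Y0] by blast
    then show ?thesis using AE_space by eventually_elim (simp add: Y_def)
  qed
  have Y_sub: "Y \<subseteq> space M" by (auto simp: Y_def)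
  have inY0: "x \<in> Y0" if "x \<in> Y" for x
  proof -
    have "(S ^^ 0) x \<in> Y0" using that unfolding Y_def by blast
    then show ?thesis by simp
  qed
  have stable: "f x \<in> Y"
    if x: "x \<in> Y" and f: "f \<in> measurable M M" and gf: "\<And>x. x \<in> Y \<Longrightarrow> g (f x) = x"
      and Y': "Y = {x \<in> space M. \<forall>k. (f ^^ k) x \<in> Y0 \<and> (g ^^ k) x \<in> Y0}" for f g x
  proof -
    have "(f ^^ k) (f x) \<in> Y0 \<and> (g ^^ k) (f x) \<in> Y0" for k
    proof
      have "(f ^^ Suc k) x \<in> Y0" using x unfolding Y' by blast
      then show "(f ^^ k) (f x) \<in> Y0" by (simp add: funpow_swap1)
      show "(g ^^ k) (f x) \<in> Y0"
      proof (cases k)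
        case 0
        have "(f ^^ 1) x \<in> Y0" using x unfolding Y' by blast
        then show ?thesis using 0 by simp
      next
        case (Suc j)
        have "(g ^^ k) (f x) = (g ^^ j) (g (f x))" by (simp add: Suc funpow_swap1)
        also have "\<dots> = (g ^^ j) x" using gf[OF x] by simp
        finally show ?thesis using x unfolding Y' by simp
      qed
    qed
    moreover have "f x \<in> space M" using f x Y_sub by (meson measurable_space subsetD)
    ultimately show ?thesis unfolding Y' by simp
  qed
  have SY: "S x \<in> Y" if "x \<in> Y" for x
    by (rule stable[OF that S(1), of T]) (rule Y0(2)[OF inY0], assumption, rule Y_def)
  have TY: "T x \<in> Y" if "x \<in> Y" for x
    by (rule stable[OF that T(1), of S]) (rule Y0(3)[OF inY0], assumption, simp only: Y_def conj_commute)
  define R where "R x = (if x \<in> Y then S x else x)" for x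
  define R' where "R' x = (if x \<in> Y then T x else x)" for x
  have R'R: "R' (R x) = x" and RR': "R (R' x) = x" for x
    using SY TY Y0(2,3) inY0 by (auto simp: R_def R'_def)
  have meas: "R \<in> measurable M M" "R' \<in> measurable M M"
    unfolding R_def R'_def using Y_meas S(1) T(1)
    by (auto intro!: measurable_If_set simp: Int_absorb2[OF Y_sub] Int_commute)
  have sp: "R x \<in> space M" "R' x \<in> space M" if "x \<in> space M" for x
    using meas that by (auto dest: measurable_space)
  have bij: "bij_betw R (space M) (space M)"
    by (rule bij_betwI[where g = R']) (auto simp: sp R'R RR')
  have "the_inv_into (space M) R x = R' x" if "x \<in> space M" for x
    using bij sp(2)[OF that] RR'[of x] by (intro the_inv_into_f_eq) (auto simp: bij_betw_def)
  then have inv: "the_inv_into (space M) R \<in> measurable M M"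
    using meas(2) by (subst measurable_cong[where g = R']) auto
  have RS: "AE x in M. R x = S x"
    using AE_Y by eventually_elim (simp add: R_def)
  have "distr M M R = M"
    using distr_cong_AE[OF refl refl RS meas(1) S(1)] S(2) by simp
  with bij meas(1) inv have "R \<in> inv_mpt M" by (simp add: inv_mpt_def)
  then show ?thesis using RS by (rule that)
qed

lemma inv_mpt_image_eq_vimage:
  assumes f: "f \<in> inv_mpt M" and A: "A \<subseteq> space M"
  shows "f ` A = the_inv_into (space M) f -` A \<inter> space M"
proof -
  note b = inv_mptD(1)[OF f]
  have fi: "f (the_inv_into (space M) f x) = x" if "x \<in> space M" for x
    using b that by (simp add: bij_betw_def f_the_inv_into_f)
  have "the_inv_into (space M) f (f y) = y" if "y \<in> A" for y
    using b that A by (auto simp: bij_betw_def the_inv_into_f_f)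
  moreover have "f y \<in> space M" if "y \<in> A" for y
    using b that A by (auto simp: bij_betw_def)
  ultimately show ?thesis using fi by (auto simp: image_iff) (metis IntI fi vimageI2)
qed

lemma inv_mpt_image_sets: "f \<in> inv_mpt M \<Longrightarrow> A \<in> sets M \<Longrightarrow> f ` A \<in> sets M"
  using inv_mpt_image_eq_vimage[of f M A] inv_mptD(3)[of f M] sets.sets_into_space[of A M]
  by (auto intro: measurable_sets)

lemma measure_inv_mpt_image:
  assumes f: "f \<in> inv_mpt M" and A: "A \<in> sets M"
  shows "measure M (f ` A) = measure M A"
proof -
  let ?g = "the_inv_into (space M) f"
  have "measure M (f ` A) = measure (distr M M ?g) A"
    using inv_mptD(3)[OF f] A sets.sets_into_space[OF A]
    by (simp add: measure_distr inv_mpt_image_eq_vimage[OF f])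
  then show ?thesis using inv_mptD(4)[OF inv_mpt_inv[OF f]] by simp
qed

lemma aut_image_sets:
  assumes "f \<in> inv_mpt M" "A \<in> sets M"
  shows "aut_image (aut_class M f) A \<in> sets M"
proof -
  have "f \<in> aut_class M f" using assms by (simp add: aut_class_def)
  then have "(SOME h. h \<in> aut_class M f) \<in> aut_class M f" by (rule someI[of "\<lambda>h. h \<in> aut_class M f"])
  then show ?thesis unfolding aut_image_def
    by (intro inv_mpt_image_sets assms) (simp add: aut_class_def)
qed

lemma measure_sym_diff_aut_image:
  assumes f: "f \<in> inv_mpt M" and A: "A \<in> sets M"
  shows "measure M (sym_diff A (aut_image (aut_class M f) A)) = measure M (sym_diff A (f ` A))"
proof (rule measure_eq_AE)
  show "AE x in M. x \<in> sym_diff A (aut_image (aut_class M f) A) \<longleftrightarrow> x \<in> sym_diff A (f ` A)"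
    using aut_image_AE[OF f sets.sets_into_space[OF A]] by eventually_elim auto
qed (use f A in \<open>auto intro!: sets.Un sets.Diff aut_image_sets inv_mpt_image_sets\<close>)

text \<open>
  Continuity at zero is enough. Indeed \<open>\<phi> (g + h) = S T (\<phi> h)\<close> whenever \<open>\<phi> g = S T\<close>, and, for a
  representative \<open>t\<close> of \<open>T\<close>, the image of \<open>A\<close> under \<open>t \<circ> R h\<close> differs from \<open>t ` A\<close> by a set of the same
  measure as the difference of \<open>R h ` A\<close> and \<open>A\<close>.
\<close>

theorem near_actionI:
  fixes R :: "'g::topological_group_add \<Rightarrow> 'a \<Rightarrow> 'a"
  assumes M: "finite_measure M" and R: "\<And>g. R g \<in> inv_mpt M"
    and add: "\<And>g h. AE x in M. R (g + h) x = R g (R h x)"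
    and cont: "\<And>A \<epsilon>. A \<in> sets M \<Longrightarrow> \<epsilon> > 0 \<Longrightarrow> \<forall>\<^sub>F h in nhds 0. measure M (sym_diff A (R h ` A)) < \<epsilon>"
  shows "near_action M (\<lambda>g. aut_class M (R g))"
proof -
  interpret finite_measure M by fact
  interpret Aut: group "Aut M" by (rule group_Aut)
  let ?\<phi> = "\<lambda>g. aut_class M (R g)"
  have carrier: "?\<phi> g \<in> carrier (Aut M)" for g using R by (simp add: carrier_Aut)
  have hom: "?\<phi> (g + h) = ?\<phi> g \<otimes>\<^bsub>Aut M\<^esub> ?\<phi> h" for g h
    using add[of g h] R by (simp add: Aut_mult aut_class_eq_iff)
  have one: "\<one>\<^bsub>Aut M\<^esub> = aut_class M id" by (simp add: Aut_def)
  have "continuous_map euclidean (aut_topology M) ?\<phi>"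
    unfolding aut_topology_def
  proof (rule continuous_on_generated_topo)
    fix U
    assume "U \<in> {S <#\<^bsub>Aut M\<^esub> aut_nhd M A \<epsilon> | S A \<epsilon>. S \<in> carrier (Aut M) \<and> A \<in> sets M \<and> \<epsilon> > 0}"
    then obtain S A \<epsilon> where U: "U = S <#\<^bsub>Aut M\<^esub> aut_nhd M A \<epsilon>" and S: "S \<in> carrier (Aut M)"
      and A: "A \<in> sets M" and \<epsilon>: "\<epsilon> > 0" by auto
    have "\<exists>V. open V \<and> g \<in> V \<and> V \<subseteq> ?\<phi> -` U" if "?\<phi> g \<in> U" for g
    proof -
      from that obtain T where T: "T \<in> aut_nhd M A \<epsilon>" "?\<phi> g = S \<otimes>\<^bsub>Aut M\<^esub> T"
        unfolding U l_coset_def by auto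
      then obtain t where t: "t \<in> inv_mpt M" "T = aut_class M t"
        by (auto simp: aut_nhd_def carrier_Aut)
      have lt: "measure M (sym_diff A (t ` A)) < \<epsilon>"
        using T(1) measure_sym_diff_aut_image[OF t(1) A] by (simp add: aut_nhd_def t(2))
      have pos: "\<epsilon> - measure M (sym_diff A (t ` A)) > 0" using lt by simp
      have near: "\<forall>\<^sub>F h in nhds 0. ?\<phi> (g + h) \<in> U"
        using cont[OF A pos]
      proof (rule eventually_mono)
        fix h assume h: "measure M (sym_diff A (R h ` A)) < \<epsilon> - measure M (sym_diff A (t ` A))"
        have tR: "t \<circ> R h \<in> inv_mpt M" by (rule inv_mpt_comp[OF t(1) R])
        have "measure M (sym_diff A ((t \<circ> R h) ` A)) \<le> measure M (sym_diff A (t ` A) \<union> t ` (sym_diff A (R h ` A)))"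
        proof (rule finite_measure_mono)
          show "sym_diff A ((t \<circ> R h) ` A) \<subseteq> sym_diff A (t ` A) \<union> t ` (sym_diff A (R h ` A))"
            unfolding image_comp[symmetric] by blast
          show "sym_diff A (t ` A) \<union> t ` (sym_diff A (R h ` A)) \<in> sets M"
            using A t(1) R by (intro sets.Un sets.Diff inv_mpt_image_sets) auto
        qed
        also have "\<dots> \<le> measure M (sym_diff A (t ` A)) + measure M (t ` (sym_diff A (R h ` A)))"
          using A t(1) R by (intro measure_Un_le sets.Un sets.Diff inv_mpt_image_sets) auto
        also have "\<dots> = measure M (sym_diff A (t ` A)) + measure M (sym_diff A (R h ` A))"
          using A t(1) R by (subst measure_inv_mpt_image) (auto intro!: sets.Un sets.Diff inv_mpt_image_sets)
        finally have "measure M (sym_diff A ((t \<circ> R h) ` A)) < \<epsilon>" using h by simp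
        then have "aut_class M (t \<circ> R h) \<in> aut_nhd M A \<epsilon>"
          using tR by (simp add: aut_nhd_def carrier_Aut measure_sym_diff_aut_image[OF tR A])
        moreover have "?\<phi> (g + h) = S \<otimes>\<^bsub>Aut M\<^esub> aut_class M (t \<circ> R h)"
        proof -
          have "?\<phi> (g + h) = (S \<otimes>\<^bsub>Aut M\<^esub> T) \<otimes>\<^bsub>Aut M\<^esub> ?\<phi> h" by (simp add: hom T(2))
          also have "\<dots> = S \<otimes>\<^bsub>Aut M\<^esub> (T \<otimes>\<^bsub>Aut M\<^esub> ?\<phi> h)"
            using S carrier t by (intro Aut.m_assoc) (auto simp: carrier_Aut)
          finally show ?thesis using t R by (simp add: Aut_mult)
        qed
        ultimately show "?\<phi> (g + h) \<in> U" unfolding U l_coset_def by blast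
      qed
      have "((\<lambda>g'. - g + g') \<longlongrightarrow> - g + g) (nhds g)"
        by (intro tendsto_add tendsto_const) (simp add: filterlim_ident)
      then have "filterlim (\<lambda>g'. - g + g') (nhds 0) (nhds g)" by simp
      from eventually_compose_filterlim[OF near this]
      have "\<forall>\<^sub>F g' in nhds g. ?\<phi> g' \<in> U" by (simp add: add.assoc[symmetric])
      then show ?thesis by (auto simp: eventually_nhds)
    qed
    then have "open (?\<phi> -` U)" by (subst open_subopen) blast
    then show "openin euclidean (?\<phi> -` U \<inter> topspace euclidean)" by simp
  next
    have mem: "?\<phi> g \<in> ?\<phi> g <#\<^bsub>Aut M\<^esub> aut_nhd M {} 1" for g
    proof -
      have "\<one>\<^bsub>Aut M\<^esub> \<in> aut_nhd M {} 1"
        by (simp add: aut_nhd_def aut_image_def)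
      moreover have "?\<phi> g = ?\<phi> g \<otimes>\<^bsub>Aut M\<^esub> \<one>\<^bsub>Aut M\<^esub>" using carrier by simp
      ultimately show ?thesis unfolding l_coset_def by blast
    qed
    show "?\<phi> ` topspace euclidean \<subseteq> \<Union> {S <#\<^bsub>Aut M\<^esub> aut_nhd M A \<epsilon> | S A \<epsilon>. S \<in> carrier (Aut M) \<and> A \<in> sets M \<and> \<epsilon> > 0}"
    proof (rule image_subsetI)
      fix g
      have "?\<phi> g <#\<^bsub>Aut M\<^esub> aut_nhd M {} 1 \<in> {S <#\<^bsub>Aut M\<^esub> aut_nhd M A \<epsilon> | S A \<epsilon>. S \<in> carrier (Aut M) \<and> A \<in> sets M \<and> \<epsilon> > 0}"
        unfolding mem_Collect_eq
        by (rule exI[of _ "?\<phi> g"], rule exI[of _ "{}"], rule exI[of _ 1], intro conjI)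
           (rule refl carrier sets.empty_sets zero_less_one)+
      then show "?\<phi> g \<in> \<Union> {S <#\<^bsub>Aut M\<^esub> aut_nhd M A \<epsilon> | S A \<epsilon>. S \<in> carrier (Aut M) \<and> A \<in> sets M \<and> \<epsilon> > 0}"
        using mem by (rule UnionI)
    qed
  qed
  moreover have "?\<phi> \<in> hom additive_group (Aut M)"
    using carrier hom by (auto simp: hom_def additive_group_def)
  ultimately show ?thesis by (simp add: near_action_def)
qed
section \<open>The stationary Gaussian process on a Hilbert space\<close>

lemma gauss_cov_0 [simp]: "gauss_cov 0 = 1"
  by (simp add: gauss_cov_def)

lemma gauss_cov_minus: "gauss_cov (u - v) = gauss_cov (v - u)"
  by (simp add: gauss_cov_def norm_minus_commute)

lemma tendsto_gauss_cov [tendsto_intros]: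
  "(f \<longlongrightarrow> l) F \<Longrightarrow> ((\<lambda>x. gauss_cov (f x)) \<longlongrightarrow> gauss_cov l) F"
  unfolding gauss_cov_def by (intro tendsto_intros) simp_all

lemma gauss_cov_eq_1_iff: "gauss_cov h = 1 \<longleftrightarrow> h = 0"
  by (simp add: gauss_cov_def)

lemma gauss_cov_ge: "2 - 2 * gauss_cov h \<le> (norm h)\<^sup>2"
  using exp_ge_add_one_self[of "- (norm h)\<^sup>2 / 2"] by (simp add: gauss_cov_def)

lemma second_countable_dense_sequence:
  obtains d :: "nat \<Rightarrow> 'h::second_countable_topology" where "\<And>U. open U \<Longrightarrow> U \<noteq> {} \<Longrightarrow> \<exists>n. d n \<in> U"
proof -
  obtain D :: "'h set" where D: "countable D" "\<And>U. open U \<Longrightarrow> U \<noteq> {} \<Longrightarrow> \<exists>x\<in>D. x \<in> U"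
    using countable_dense_setE by blast
  have "D \<noteq> {}" using D(2)[of UNIV] by auto
  then have "range (from_nat_into D) = D" using D(1) by (rule range_from_nat_into)
  then show ?thesis using D(2) that[of "from_nat_into D"] by (metis imageE)
qed

text \<open>
  Under \<open>M\<close> the coordinate \<open>x n\<close> is the value of the process at the point \<open>d n\<close>. The points need not
  be distinct.
\<close>

locale stationary_gaussian = prob_space M
  for M :: "(nat \<Rightarrow> real) measure" +
  fixes d :: "nat \<Rightarrow> 'h::real_inner"
  assumes sets_M [measurable_cong]: "sets M = sets borel"
    and dense: "open U \<Longrightarrow> U \<noteq> {} \<Longrightarrow> \<exists>n. d n \<in> U"
    and char_M: "(\<integral>x. cis (\<Sum>n<D. \<xi> n * x n) \<partial>M) =
       of_real (exp (- (\<Sum>n<D. \<Sum>m<D. \<xi> n * \<xi> m * gauss_cov (d n - d m)) / 2))"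
begin

lemma space_M [simp]: "space M = UNIV"
  using sets_eq_imp_space_eq[OF sets_M] by simp

lemma integrable_cis_M: "g \<in> borel_measurable M \<Longrightarrow> integrable M (\<lambda>x. cis (g x))"
  by (intro integrable_cis finite_measure_axioms)

text \<open>
  Coordinates may be repeated here; this is what the extension of the process to limits of arbitrary
  sequences of points needs.
\<close>

lemma char_coordinates:
  assumes I: "finite I"
  shows "(\<integral>x. cis (\<Sum>i\<in>I. \<xi> i * x (n i)) \<partial>M) =
     of_real (exp (- (\<Sum>i\<in>I. \<Sum>l\<in>I. \<xi> i * \<xi> l * gauss_cov (d (n i) - d (n l))) / 2))"
proof -
  obtain D where D: "\<And>i. i \<in> I \<Longrightarrow> n i < D"
    using finite_nat_set_iff_bounded[of "n ` I"] I by auto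
  define \<xi>' where "\<xi>' m = (\<Sum>i\<in>{i\<in>I. n i = m}. \<xi> i)" for m
  have group: "(\<Sum>m<D. \<xi>' m * h m) = (\<Sum>i\<in>I. \<xi> i * h (n i))" for h :: "nat \<Rightarrow> real"
  proof -
    have "(\<Sum>m<D. \<xi>' m * h m) = (\<Sum>m<D. \<Sum>i\<in>{i\<in>I. n i = m}. \<xi> i * h (n i))"
      unfolding \<xi>'_def sum_distrib_right by (intro sum.cong refl) auto
    also have "\<dots> = (\<Sum>i\<in>I. \<xi> i * h (n i))"
      using I D by (intro sum.group) auto
    finally show ?thesis .
  qed
  have "(\<Sum>n<D. \<Sum>m<D. \<xi>' n * \<xi>' m * gauss_cov (d n - d m)) =
     (\<Sum>i\<in>I. \<Sum>l\<in>I. \<xi> i * \<xi> l * gauss_cov (d (n i) - d (n l)))"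
    by (simp add: mult.assoc sum_distrib_left[symmetric] group)
  then show ?thesis using char_M[of \<xi>' D] by (simp add: group)
qed

lemma char_increment:
  "(\<integral>x. cis (t * (x m - x n)) \<partial>M) = of_real (exp (- (t\<^sup>2 * (2 - 2 * gauss_cov (d m - d n))) / 2))"
proof -
  have eq: "t * (a - b) = (\<Sum>i\<in>{True, False}. (if i then t else - t) * (if i then a else b))" for a b :: real
    by (simp add: algebra_simps)
  have "(\<integral>x. cis (\<Sum>i\<in>{True, False}. (if i then t else - t) * x (if i then m else n)) \<partial>M) =
    of_real (exp (- (t\<^sup>2 * (2 - 2 * gauss_cov (d m - d n))) / 2))"
    by (subst char_coordinates) (simp_all add: gauss_cov_minus[of "d n"] power2_eq_square algebra_simps)
  then show ?thesis by (simp add: right_diff_distrib)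
qed

text \<open>
  Approximation at a geometric rate makes the increments along the sequence summable, which gives
  almost sure convergence. The base 8 leaves room for the weights used below.
\<close>

definition approx_index :: "'h \<Rightarrow> nat \<Rightarrow> nat" where
  "approx_index h k = (SOME n. dist (d n) h < (1/8) ^ k)"

lemma dist_approx_index: "dist (d (approx_index h k)) h < (1/8) ^ k"
proof -
  have "h \<in> ball h ((1/8) ^ k)" by simp
  then have "ball h ((1/8) ^ k) \<noteq> {}" by blast
  then obtain n where "d n \<in> ball h ((1/8) ^ k)"
    using dense[OF open_ball] by blast
  then have "dist (d n) h < (1/8) ^ k" by (simp add: dist_commute)
  then show ?thesis unfolding approx_index_def by (rule someI)
qed

lemma approx_index_tendsto: "(\<lambda>k. d (approx_index h k)) \<longlonglongrightarrow> h"
proof (rule metric_tendsto_imp_tendsto[OF _ always_eventually])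
  show "(\<lambda>k. (1/8) ^ k :: real) \<longlonglongrightarrow> 0" by (rule LIMSEQ_power_zero) simp
  show "\<forall>k. dist (d (approx_index h k)) h \<le> dist ((1/8) ^ k :: real) 0"
    using dist_approx_index less_imp_le by (simp add: less_imp_le)
qed

text \<open>
  The value of the process at \<open>h\<close>. The limit exists almost surely (\<open>AE_tendsto_Y\<close>); elsewhere \<open>Y h\<close> has
  a meaningless but measurable value.
\<close>

definition Y :: "'h \<Rightarrow> (nat \<Rightarrow> real) \<Rightarrow> real" where
  "Y h x = lim (\<lambda>k. x (approx_index h k))"

lemma measurable_Y [measurable]: "Y h \<in> borel_measurable borel"
  unfolding Y_def by (rule borel_measurable_lim_metric) measurable

lemma AE_tendsto_Y: "AE x in M. (\<lambda>k. x (approx_index h k)) \<longlonglongrightarrow> Y h x"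
proof -
  define n where "n = approx_index h"
  define Z where "Z k x = x (n (Suc k)) - x (n k)" for k and x :: "nat \<Rightarrow> real"
  have Zm [measurable]: "Z k \<in> borel_measurable M" for k unfolding Z_def by measurable
  have norm_d: "norm (d (n (Suc k)) - d (n k)) \<le> 2 * (1/8) ^ k" for k
  proof -
    have "norm (d (n (Suc k)) - d (n k)) \<le> dist (d (n (Suc k))) h + dist (d (n k)) h"
      unfolding dist_norm[symmetric] by (rule dist_triangle2)
    also have "\<dots> \<le> (1/8) ^ Suc k + (1/8) ^ k"
      unfolding n_def by (intro add_mono less_imp_le dist_approx_index)
    also have "\<dots> \<le> 2 * (1/8) ^ k" by simp
    finally show ?thesis .
  qed
  have sq: "(\<integral>\<^sup>+x. ennreal ((Z k x)\<^sup>2) \<partial>M) \<le> ennreal (4 * (1/64) ^ k)" for k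
  proof -
    have "(\<integral>\<^sup>+x. ennreal ((Z k x)\<^sup>2) \<partial>M) \<le> ennreal (2 - 2 * gauss_cov (d (n (Suc k)) - d (n k)))"
      unfolding Z_def by (intro second_moment_le prob_space_axioms char_increment) measurable
    also have "\<dots> \<le> ennreal (4 * (1/64) ^ k)"
    proof (rule ennreal_leI)
      have "(norm (d (n (Suc k)) - d (n k)))\<^sup>2 \<le> (2 * (1/8) ^ k)\<^sup>2"
        by (intro power_mono norm_d) simp
      also have "\<dots> = 4 * (1/64) ^ k"
        by (simp add: power_mult_distrib power2_eq_square power_mult_distrib[symmetric])
      finally show "2 - 2 * gauss_cov (d (n (Suc k)) - d (n k)) \<le> 4 * (1/64) ^ k"
        using gauss_cov_ge[of "d (n (Suc k)) - d (n k)"] by simp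
    qed
    finally show ?thesis .
  qed
  \<comment> \<open>The second moment of the increment is of order 1/64^k, so the weight (1/2)^k gives a summable first moment.\<close>
  have abs_int: "(\<integral>\<^sup>+x. ennreal \<bar>Z k x\<bar> \<partial>M) \<le> ennreal (5 * (1/2) ^ k)" for k
  proof -
    have "(\<integral>\<^sup>+x. ennreal \<bar>Z k x\<bar> \<partial>M) \<le> (\<integral>\<^sup>+x. ennreal (2 ^ k) * ennreal ((Z k x)\<^sup>2) + ennreal ((1/2) ^ k) \<partial>M)"
    proof (rule nn_integral_mono)
      fix x
      have "\<bar>Z k x\<bar> \<le> (\<bar>Z k x\<bar>\<^sup>2 / (1/2)^k + (1/2)^k) / 2"
        by (rule norm_le_weighted_sq) simp
      also have "\<dots> \<le> \<bar>Z k x\<bar>\<^sup>2 / (1/2)^k + (1/2)^k"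
      proof -
        have half: "w / 2 \<le> w" if "0 \<le> w" for w :: real using that by simp
        show ?thesis by (intro half add_nonneg_nonneg divide_nonneg_nonneg) auto
      qed
      also have "\<dots> = 2 ^ k * (Z k x)\<^sup>2 + (1/2) ^ k"
      proof -
        have p: "(1/2 :: real) ^ k = 1 / 2 ^ k" by (rule power_one_over)
        show ?thesis unfolding p power2_abs by (simp only: divide_divide_eq_right div_by_1 mult.commute)
      qed
      finally have "ennreal \<bar>Z k x\<bar> \<le> ennreal (2 ^ k * (Z k x)\<^sup>2 + (1/2) ^ k)" by (rule ennreal_leI)
      then show "ennreal \<bar>Z k x\<bar> \<le> ennreal (2 ^ k) * ennreal ((Z k x)\<^sup>2) + ennreal ((1/2) ^ k)"
        by (simp add: ennreal_mult)
    qed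
    also have "\<dots> = ennreal (2 ^ k) * (\<integral>\<^sup>+x. ennreal ((Z k x)\<^sup>2) \<partial>M) + ennreal ((1/2) ^ k)"
      by (simp add: nn_integral_add nn_integral_cmult emeasure_space_1[simplified])
    also have "\<dots> \<le> ennreal (2 ^ k) * ennreal (4 * (1/64) ^ k) + ennreal ((1/2) ^ k)"
      by (intro add_right_mono mult_left_mono sq) simp
    also have "\<dots> = ennreal (2 ^ k * (4 * (1/64) ^ k) + (1/2) ^ k)"
      by (simp add: ennreal_mult)
    also have "\<dots> \<le> ennreal (5 * (1/2) ^ k)"
    proof (rule ennreal_leI)
      have "2 ^ k * (1/64) ^ k = (1/32 :: real) ^ k" by (simp add: power_mult_distrib[symmetric])
      moreover have "(1/32 :: real) ^ k \<le> (1/2) ^ k" by (rule power_mono) auto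
      ultimately show "2 ^ k * (4 * (1/64) ^ k) + (1/2) ^ k \<le> 5 * (1/2 :: real) ^ k" by simp
    qed
    finally show ?thesis .
  qed
  have "(\<integral>\<^sup>+x. (\<Sum>k. ennreal \<bar>Z k x\<bar>) \<partial>M) = (\<Sum>k. \<integral>\<^sup>+x. ennreal \<bar>Z k x\<bar> \<partial>M)"
    by (rule nn_integral_suminf) measurable
  also have "\<dots> \<le> (\<Sum>k. ennreal (5 * (1/2) ^ k))"
    by (intro suminf_le abs_int) auto
  also have "\<dots> < \<infinity>"
    by (subst suminf_ennreal2) (auto intro!: summable_mult complete_algebra_summable_geometric)
  finally have "AE x in M. (\<Sum>k. ennreal \<bar>Z k x\<bar>) \<noteq> \<infinity>"
    by (intro nn_integral_noteq_infinite) auto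
  then show ?thesis
  proof eventually_elim
    case (elim x)
    then have "summable (\<lambda>k. \<bar>Z k x\<bar>)"
      by (intro summable_suminf_not_top) (auto simp: top_ennreal.rep_eq)
    then have "summable (\<lambda>k. Z k x)" by (rule summable_rabs_cancel)
    then have "(\<lambda>k. (\<Sum>i<k. Z i x) + x (n 0)) \<longlonglongrightarrow> (\<Sum>i. Z i x) + x (n 0)"
      by (intro tendsto_add summable_LIMSEQ tendsto_const)
    moreover have "(\<Sum>i<k. Z i x) + x (n 0) = x (n k)" for k
      unfolding Z_def by (subst sum_lessThan_telescope) simp
    ultimately have "convergent (\<lambda>k. x (n k))" by (auto simp: convergent_def)
    then show ?case unfolding Y_def n_def convergent_LIMSEQ_iff .
  qed
qed

text \<open>
  The joint law of the process at finitely many points, from which everything else about the shift is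
  read off. It is the limit of the law at the approximating points.
\<close>

theorem char_Y:
  assumes I: "finite I"
  shows "(\<integral>x. cis (\<Sum>i\<in>I. \<xi> i * Y (v i) x) \<partial>M) =
     of_real (exp (- (\<Sum>i\<in>I. \<Sum>l\<in>I. \<xi> i * \<xi> l * gauss_cov (v i - v l)) / 2))"
proof (rule LIMSEQ_unique)
  have "AE x in M. \<forall>i\<in>I. (\<lambda>k. x (approx_index (v i) k)) \<longlonglongrightarrow> Y (v i) x"
    using I AE_tendsto_Y by (intro AE_finite_allI) auto
  then show "(\<lambda>k. \<integral>x. cis (\<Sum>i\<in>I. \<xi> i * x (approx_index (v i) k)) \<partial>M) \<longlonglongrightarrow> (\<integral>x. cis (\<Sum>i\<in>I. \<xi> i * Y (v i) x) \<partial>M)"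
  proof (intro integral_dominated_convergence[where w = "\<lambda>_. 1"])
    assume "AE x in M. \<forall>i\<in>I. (\<lambda>k. x (approx_index (v i) k)) \<longlonglongrightarrow> Y (v i) x"
    then show "AE x in M. (\<lambda>k. cis (\<Sum>i\<in>I. \<xi> i * x (approx_index (v i) k))) \<longlonglongrightarrow> cis (\<Sum>i\<in>I. \<xi> i * Y (v i) x)"
      by eventually_elim (intro tendsto_intros; blast)
  qed (auto intro!: measurable_compose[OF _ measurable_cis] borel_measurable_sum borel_measurable_times)
  show "(\<lambda>k. \<integral>x. cis (\<Sum>i\<in>I. \<xi> i * x (approx_index (v i) k)) \<partial>M) \<longlonglongrightarrow>
    of_real (exp (- (\<Sum>i\<in>I. \<Sum>l\<in>I. \<xi> i * \<xi> l * gauss_cov (v i - v l)) / 2))"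
    unfolding char_coordinates[OF I] by (intro tendsto_intros approx_index_tendsto) simp
qed

lemma char_Y_increment:
  "(\<integral>x. cis (t * (Y u x - Y v x)) \<partial>M) = of_real (exp (- (t\<^sup>2 * (2 - 2 * gauss_cov (u - v))) / 2))"
proof -
  have "(\<integral>x. cis (\<Sum>i\<in>{True, False}. (if i then t else - t) * Y (if i then u else v) x) \<partial>M) =
    of_real (exp (- (t\<^sup>2 * (2 - 2 * gauss_cov (u - v))) / 2))"
    by (subst char_Y) (simp_all add: gauss_cov_minus[of v] power2_eq_square algebra_simps)
  then show ?thesis by (simp add: right_diff_distrib)
qed

lemma AE_Y_dense: "AE x in M. Y (d n) x = x n"
proof -
  have "(\<integral>x. cis (t * (Y (d n) x - x n)) \<partial>M) = 1" for t
  proof (rule LIMSEQ_unique)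
    show "(\<lambda>k. \<integral>x. cis (t * (x (approx_index (d n) k) - x n)) \<partial>M) \<longlonglongrightarrow> (\<integral>x. cis (t * (Y (d n) x - x n)) \<partial>M)"
    proof (rule integral_dominated_convergence[where w = "\<lambda>_. 1"])
      show "AE x in M. (\<lambda>k. cis (t * (x (approx_index (d n) k) - x n))) \<longlonglongrightarrow> cis (t * (Y (d n) x - x n))"
        using AE_tendsto_Y[of "d n"] by eventually_elim (intro tendsto_intros)
    qed (auto intro!: measurable_compose[OF _ measurable_cis] borel_measurable_times borel_measurable_diff)
    have "(\<lambda>k. complex_of_real (exp (- (t\<^sup>2 * (2 - 2 * gauss_cov (d (approx_index (d n) k) - d n))) / 2))) \<longlonglongrightarrow>
       of_real (exp (- (t\<^sup>2 * (2 - 2 * gauss_cov (d n - d n))) / 2))"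
      by (intro tendsto_intros approx_index_tendsto) simp
    then show "(\<lambda>k. \<integral>x. cis (t * (x (approx_index (d n) k) - x n)) \<partial>M) \<longlonglongrightarrow> 1"
      unfolding char_increment by simp
  qed
  then have "AE x in M. Y (d n) x - x n = 0"
    by (intro AE_zero_if_char_one prob_space_axioms) measurable
  then show ?thesis by simp
qed

definition S :: "'h \<Rightarrow> (nat \<Rightarrow> real) \<Rightarrow> nat \<Rightarrow> real" where
  "S h x = (\<lambda>n. Y (d n + h) x)"

lemma measurable_S_borel: "S h \<in> borel_measurable borel"
  unfolding S_def by (rule measurable_coordinatewise_then_product) measurable

lemma measurable_S: "S h \<in> measurable M M"
  using measurable_S_borel measurable_cong_sets[OF sets_M sets_M] by blast

text \<open>
  Stationarity: the covariances of the points \<open>d j + h\<close> are those of the points \<open>d j\<close>.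
\<close>

theorem distr_S: "distr M M (S h) = M"
proof (rule trig_polys_determine_measure)
  show "prob_space (distr M M (S h))" by (rule prob_space_distr) (rule measurable_S)
  fix D :: nat and \<xi>
  have "(\<integral>x. cis (\<Sum>j<D. \<xi> j * x j) \<partial>distr M M (S h)) = (\<integral>x. cis (\<Sum>j<D. \<xi> j * Y (d j + h) x) \<partial>M)"
    by (subst integral_distr[OF measurable_S]) (auto simp: S_def intro!: measurable_compose[OF _ measurable_cis])
  also have "\<dots> = (\<integral>x. cis (\<Sum>j<D. \<xi> j * x j) \<partial>M)"
    by (simp add: char_Y char_M)
  finally show "(\<integral>x. cis (\<Sum>j<D. \<xi> j * x j) \<partial>distr M M (S h)) = (\<integral>x. cis (\<Sum>j<D. \<xi> j * x j) \<partial>M)" .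
qed (simp_all add: sets_M prob_space_axioms)

lemma AE_S: "AE x in M. P x \<Longrightarrow> AE x in M. P (S h x)"
  by (rule AE_measure_preserving[OF measurable_S distr_S])

lemma measurable_Y_M: "Y h \<in> borel_measurable M"
  using measurable_Y measurable_cong_sets[OF sets_M refl] by blast

lemma measurable_Y_S: "(\<lambda>x. Y v (S h x)) \<in> borel_measurable M"
  using measurable_S measurable_Y_M by (rule measurable_compose)

lemma measurable_cis_diff:
  "f \<in> borel_measurable M \<Longrightarrow> g \<in> borel_measurable M \<Longrightarrow> (\<lambda>x. cis (t * (f x - g x))) \<in> borel_measurable M"
  by (intro measurable_compose[OF _ measurable_cis] borel_measurable_times borel_measurable_diff borel_measurable_const)

text \<open>
  Both sides are limits of \<open>Y (d n + h) x\<close> along \<open>d n \<rightarrow> v\<close>, the left one because \<open>S h\<close> preserves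
  null sets and the right one by continuity of the covariance.
\<close>

lemma AE_Y_S: "AE x in M. Y v (S h x) = Y (v + h) x"
proof -
  have "(\<integral>x. cis (t * (Y v (S h x) - Y (v + h) x)) \<partial>M) = 1" for t
  proof (rule LIMSEQ_unique)
    show "(\<lambda>k. \<integral>x. cis (t * (Y (d (approx_index v k) + h) x - Y (v + h) x)) \<partial>M) \<longlonglongrightarrow>
        (\<integral>x. cis (t * (Y v (S h x) - Y (v + h) x)) \<partial>M)"
    proof (rule integral_dominated_convergence[where w = "\<lambda>_. 1"])
      show "AE x in M. (\<lambda>k. cis (t * (Y (d (approx_index v k) + h) x - Y (v + h) x))) \<longlonglongrightarrow>
          cis (t * (Y v (S h x) - Y (v + h) x))"
        using AE_S[OF AE_tendsto_Y[of v], of h]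
      proof eventually_elim
        case (elim x)
        have "(\<lambda>k. Y (d (approx_index v k) + h) x) \<longlonglongrightarrow> Y v (S h x)"
          using elim unfolding S_def .
        then show ?case by (intro tendsto_intros)
      qed
      show "(\<lambda>x. cis (t * (Y v (S h x) - Y (v + h) x))) \<in> borel_measurable M"
        by (intro measurable_cis_diff measurable_Y_S measurable_Y_M)
      show "(\<lambda>x. cis (t * (Y (d (approx_index v k) + h) x - Y (v + h) x))) \<in> borel_measurable M" for k
        by (intro measurable_cis_diff measurable_Y_M)
    qed simp_all
    have "(\<lambda>k. complex_of_real (exp (- (t\<^sup>2 * (2 - 2 * gauss_cov ((d (approx_index v k) + h) - (v + h)))) / 2))) \<longlonglongrightarrow>
       of_real (exp (- (t\<^sup>2 * (2 - 2 * gauss_cov ((v + h) - (v + h)))) / 2))"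
      by (intro tendsto_intros approx_index_tendsto) simp
    then show "(\<lambda>k. \<integral>x. cis (t * (Y (d (approx_index v k) + h) x - Y (v + h) x)) \<partial>M) \<longlonglongrightarrow> 1"
      unfolding char_Y_increment by simp
  qed
  then have "AE x in M. Y v (S h x) - Y (v + h) x = 0"
    by (intro AE_zero_if_char_one prob_space_axioms borel_measurable_diff measurable_Y_S measurable_Y_M)
  then show ?thesis by simp
qed

lemma AE_S_add: "AE x in M. S g (S h x) = S (g + h) x"
proof -
  have "AE x in M. \<forall>n. Y (d n + g) (S h x) = Y (d n + g + h) x"
    unfolding AE_all_countable by (intro allI AE_Y_S)
  then show ?thesis by eventually_elim (simp add: S_def add.assoc)
qed

lemma AE_S_0: "AE x in M. S 0 x = x"
proof -
  have "AE x in M. \<forall>n. Y (d n) x = x n"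
    unfolding AE_all_countable by (intro allI AE_Y_dense)
  then show ?thesis by eventually_elim (simp add: S_def)
qed

lemma AE_S_eqD:
  assumes "AE x in M. S g x = S h x"
  shows "g = h"
proof -
  have "AE x in M. cis (1 * (Y (d 0 + g) x - Y (d 0 + h) x)) = 1"
    using assms by eventually_elim (simp add: S_def fun_eq_iff)
  then have "(\<integral>x. cis (1 * (Y (d 0 + g) x - Y (d 0 + h) x)) \<partial>M) = (\<integral>x. 1 \<partial>M)"
    by (intro integral_cong_AE measurable_cis_diff measurable_Y_M borel_measurable_const)
  then have "complex_of_real (exp (- (1\<^sup>2 * (2 - 2 * gauss_cov ((d 0 + g) - (d 0 + h)))) / 2)) = 1"
    unfolding char_Y_increment by (simp add: prob_space[simplified])
  then show ?thesis by (simp add: gauss_cov_eq_1_iff)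
qed

end

section \<open>Whirliness through power series\<close>

text \<open>
  By Montel's theorem a subsequence of the power series converges on the unit disc to a holomorphic
  function. It vanishes on an interval, hence at zero.
\<close>

lemma bounded_power_series_vanishing:
  fixes \<alpha> :: "nat \<Rightarrow> nat \<Rightarrow> complex"
  assumes K: "\<And>m k. norm (\<alpha> m k) \<le> K" and \<rho>0: "\<rho>0 < 1"
    and lim: "\<And>\<rho>. \<rho>0 < \<rho> \<Longrightarrow> 0 < \<rho> \<Longrightarrow> \<rho> < 1 \<Longrightarrow> (\<lambda>m. \<Sum>k. \<alpha> m k * of_real \<rho> ^ k) \<longlonglongrightarrow> 0"
    and L: "(\<lambda>m. \<alpha> m 0) \<longlonglongrightarrow> L"
  shows "L = 0"
proof -
  define \<Phi> where "\<Phi> m z = (\<Sum>k. \<alpha> m k * z ^ k)" for m z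
  have K0: "0 \<le> K" using K[of 0 0] norm_ge_zero order_trans by blast
  have summable: "summable (\<lambda>k. norm (\<alpha> m k * z ^ k))" and bound: "norm (\<Phi> m z) \<le> K / (1 - norm z)"
    if z: "norm z < 1" for m z
  proof -
    have geo: "(\<lambda>k. K * norm z ^ k) sums (K * (1 / (1 - norm z)))"
      using z by (intro sums_mult geometric_sums) simp
    have le: "norm (\<alpha> m k * z ^ k) \<le> K * norm z ^ k" for k
      using K[of m k] by (simp add: norm_mult norm_power mult_right_mono)
    show s: "summable (\<lambda>k. norm (\<alpha> m k * z ^ k))"
      by (rule summable_comparison_test'[OF sums_summable[OF geo], of 0]) (use le in simp)
    have "norm (\<Phi> m z) \<le> (\<Sum>k. norm (\<alpha> m k * z ^ k))"
      unfolding \<Phi>_def by (rule summable_norm[OF s])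
    also have "\<dots> \<le> (\<Sum>k. K * norm z ^ k)"
      by (intro suminf_le le s sums_summable[OF geo])
    also have "\<dots> = K / (1 - norm z)" using sums_unique[OF geo] by simp
    finally show "norm (\<Phi> m z) \<le> K / (1 - norm z)" .
  qed
  have hol: "\<Phi> m holomorphic_on ball 0 1" for m
  proof (rule power_series_holomorphic)
    fix w :: complex assume "w \<in> ball 0 1"
    then have "summable (\<lambda>k. \<alpha> m k * w ^ k)"
      using summable_norm_cancel[OF summable] by simp
    then show "(\<lambda>n. \<alpha> m n * (w - 0) ^ n) sums \<Phi> m w"
      unfolding \<Phi>_def by (simp add: summable_sums)
  qed
  obtain g r where g: "g holomorphic_on ball 0 1" and r: "strict_mono (r :: nat \<Rightarrow> nat)"
    and conv: "\<And>z. z \<in> ball 0 1 \<Longrightarrow> (\<lambda>n. \<Phi> (r n) z) \<longlonglongrightarrow> g z"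
  proof (rule Montel[of "ball 0 1" "range \<Phi>" \<Phi>])
    show "h holomorphic_on ball 0 1" if "h \<in> range \<Phi>" for h using that hol by auto
    fix C :: "complex set" assume C: "compact C" "C \<subseteq> ball 0 1"
    show "\<exists>B. \<forall>h\<in>range \<Phi>. \<forall>z\<in>C. norm (h z) \<le> B"
    proof (cases "C = {}")
      case False
      obtain z0 where z0: "z0 \<in> C" "\<And>z. z \<in> C \<Longrightarrow> norm z \<le> norm z0"
        using continuous_attains_sup[OF C(1) False, of norm] continuous_on_norm_id by blast
      have "norm (\<Phi> m z) \<le> K / (1 - norm z0)" if "z \<in> C" for m z
      proof -
        have "norm z0 < 1" "norm z < 1" using C(2) z0(1) that by auto
        then have "norm (\<Phi> m z) \<le> K / (1 - norm z)" by (intro bound)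
        also have "\<dots> \<le> K / (1 - norm z0)"
          using z0(2)[OF that] \<open>norm z0 < 1\<close> K0 by (intro divide_left_mono) auto
        finally show ?thesis .
      qed
      then show ?thesis by blast
    qed simp
  qed (auto intro: that)
  define \<rho>1 where "\<rho>1 = max 0 \<rho>0"
  define \<rho>2 where "\<rho>2 = (\<rho>1 + 1) / 2"
  have \<rho>12: "0 \<le> \<rho>1" "\<rho>1 < 1" "\<rho>0 \<le> \<rho>1" "\<rho>1 < \<rho>2" "\<rho>2 < 1" using \<rho>0 by (auto simp: \<rho>1_def \<rho>2_def)
  have g0: "g 0 = 0"
  proof (rule analytic_continuation[OF g, where U = "complex_of_real ` {\<rho>1<..<1}" and \<xi> = "of_real \<rho>2"])
    show "g z = 0" if "z \<in> complex_of_real ` {\<rho>1<..<1}" for z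
    proof -
      from that obtain \<rho> where \<rho>: "z = of_real \<rho>" "\<rho>1 < \<rho>" "\<rho> < 1" by auto
      then have "z \<in> ball 0 1" using \<rho>12 by simp
      moreover have "(\<lambda>n. \<Phi> (r n) z) \<longlonglongrightarrow> 0"
        using LIMSEQ_subseq_LIMSEQ[OF lim[of \<rho>] r] \<rho> \<rho>12 by (simp add: \<Phi>_def comp_def)
      ultimately show ?thesis using conv LIMSEQ_unique by blast
    qed
    show "complex_of_real \<rho>2 islimpt complex_of_real ` {\<rho>1<..<1}"
    proof (rule islimptI)
      fix T assume T: "complex_of_real \<rho>2 \<in> T" "open T"
      have "open (of_real -` T :: real set)"
        using T(2) by (rule open_vimage) (intro continuous_intros)
      then have "open ((of_real -` T :: real set) \<inter> {\<rho>1<..<1})" by auto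
      moreover have "\<rho>2 \<in> (of_real -` T :: real set) \<inter> {\<rho>1<..<1}" using T(1) \<rho>12 by auto
      ultimately obtain y where "y \<in> (of_real -` T :: real set) \<inter> {\<rho>1<..<1}" "y \<noteq> \<rho>2"
        by (metis islimptE[OF islimpt_UNIV])
      then show "\<exists>y\<in>complex_of_real ` {\<rho>1<..<1}. y \<in> T \<and> y \<noteq> complex_of_real \<rho>2" by auto
    qed
  qed (use \<rho>12 in auto)
  have "\<Phi> m 0 = \<alpha> m 0" for m unfolding \<Phi>_def by simp
  then have "(\<lambda>n. \<alpha> (r n) 0) \<longlonglongrightarrow> 0" using conv[of 0] g0 by simp
  moreover have "(\<lambda>n. \<alpha> (r n) 0) \<longlonglongrightarrow> L" using LIMSEQ_subseq_LIMSEQ[OF L r] by (simp add: comp_def)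
  ultimately show "L = 0" using LIMSEQ_unique by blast
qed

text \<open>
  The coefficient of \<open>\<rho>\<^sup>k\<close> in the correlation of two trigonometric polynomials, which is the inner
  product of their components in the \<open>k\<close>-th Wiener chaos. Here \<open>x i\<close> and \<open>y l\<close> are the frequencies
  in an orthonormal Gaussian basis, and \<open>a\<close> and \<open>b\<close> are the coefficients after Wick normalisation.
\<close>

definition chaos_form :: "nat \<Rightarrow> nat \<Rightarrow> nat \<Rightarrow> (nat \<Rightarrow> complex) \<Rightarrow> (nat \<Rightarrow> nat \<Rightarrow> real) \<Rightarrow> nat \<Rightarrow> (nat \<Rightarrow> complex) \<Rightarrow> (nat \<Rightarrow> nat \<Rightarrow> real) \<Rightarrow> complex" where
  "chaos_form D k N a x N' b y =
     (\<Sum>i<N. \<Sum>l<N'. a i * cnj (b l) * of_real ((\<Sum>p<D. x i p * y l p) ^ k)) / of_real (fact k)"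

text \<open>
  The squared norm of the component in the \<open>k\<close>-th Wiener chaos.
\<close>

definition chaos_norm2 :: "nat \<Rightarrow> nat \<Rightarrow> nat \<Rightarrow> (nat \<Rightarrow> complex) \<Rightarrow> (nat \<Rightarrow> nat \<Rightarrow> real) \<Rightarrow> real" where
  "chaos_norm2 D k N a x =
     (\<Sum>J\<in>PiE {..<k} (\<lambda>_. {..<D}). (norm (\<Sum>i<N. a i * of_real (\<Prod>t<k. x i (J t))))\<^sup>2) / fact k"

lemma chaos_norm2_nonneg: "0 \<le> chaos_norm2 D k N a x"
  by (simp add: chaos_norm2_def sum_nonneg)

lemma chaos_form_diag: "chaos_form D k N a x N a x = of_real (chaos_norm2 D k N a x)"
  unfolding chaos_form_def chaos_norm2_def power_sum_kernel
  by (simp only: complex_norm_square[symmetric] of_real_sum of_real_divide)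

lemma chaos_form_Cauchy_Schwarz:
  "(norm (chaos_form D k N a x N' b y))\<^sup>2 \<le> chaos_norm2 D k N a x * chaos_norm2 D k N' b y"
proof -
  let ?\<J> = "PiE {..<k} (\<lambda>_. {..<D})"
  define F where "F J = (\<Sum>i<N. a i * of_real (\<Prod>t<k. x i (J t)))" for J
  define G where "G J = (\<Sum>i<N'. b i * of_real (\<Prod>t<k. y i (J t)))" for J
  have form: "chaos_form D k N a x N' b y = (\<Sum>J\<in>?\<J>. F J * cnj (G J)) / of_real (fact k)"
    unfolding chaos_form_def power_sum_kernel F_def G_def ..
  have "norm (\<Sum>J\<in>?\<J>. F J * cnj (G J)) \<le> (\<Sum>J\<in>?\<J>. norm (F J) * norm (G J))"
    by (rule order_trans[OF norm_sum]) (simp add: norm_mult)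
  then have "(norm (\<Sum>J\<in>?\<J>. F J * cnj (G J)))\<^sup>2 \<le> (\<Sum>J\<in>?\<J>. norm (F J) * norm (G J))\<^sup>2"
    by (intro power_mono) auto
  also have "\<dots> \<le> (\<Sum>J\<in>?\<J>. (norm (F J))\<^sup>2) * (\<Sum>J\<in>?\<J>. (norm (G J))\<^sup>2)"
    by (rule Cauchy_Schwarz_ineq_sum)
  finally have *: "(norm (\<Sum>J\<in>?\<J>. F J * cnj (G J)))\<^sup>2 \<le> (\<Sum>J\<in>?\<J>. (norm (F J))\<^sup>2) * (\<Sum>J\<in>?\<J>. (norm (G J))\<^sup>2)" .
  have "(norm (chaos_form D k N a x N' b y))\<^sup>2 = (norm (\<Sum>J\<in>?\<J>. F J * cnj (G J)))\<^sup>2 / (fact k * fact k)"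
    unfolding form by (simp add: norm_divide power_divide power2_eq_square)
  also have "\<dots> \<le> (\<Sum>J\<in>?\<J>. (norm (F J))\<^sup>2) * (\<Sum>J\<in>?\<J>. (norm (G J))\<^sup>2) / (fact k * fact k)"
    using * by (intro divide_right_mono) auto
  finally show ?thesis by (simp add: chaos_norm2_def F_def G_def)
qed

context stationary_gaussian begin

definition cov_form :: "nat \<Rightarrow> 'h \<Rightarrow> (nat \<Rightarrow> real) \<Rightarrow> (nat \<Rightarrow> real) \<Rightarrow> real" where
  "cov_form D h \<xi> \<eta> = (\<Sum>j<D. \<Sum>l<D. \<xi> j * \<eta> l * gauss_cov (d j - d l - h))"

lemma measurable_linear_S: "(\<lambda>x. \<Sum>j<D. \<eta> j * S h x j) \<in> borel_measurable M" for D :: nat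
  unfolding S_def by (intro borel_measurable_sum borel_measurable_times borel_measurable_const measurable_Y_M)

lemma measurable_linear: "(\<lambda>x. \<Sum>j<D. \<eta> j * x j) \<in> borel_measurable M" for D :: nat
  using measurable_trig measurable_cong_sets[OF sets_M refl] by blast

text \<open>
  The joint characteristic function of the process and of its shift: the exponent is the variance of
  the difference of the two linear forms.
\<close>

lemma char_mixed:
  "(\<integral>x. cis ((\<Sum>j<D. \<xi> j * x j) - (\<Sum>j<D. \<eta> j * S h x j)) \<partial>M) =
     of_real (exp (- (cov_form D 0 \<xi> \<xi> + cov_form D 0 \<eta> \<eta> - 2 * cov_form D h \<xi> \<eta>) / 2))"
proof -
  let ?I = "{..<D} <+> {..<D}"
  let ?c = "case_sum \<xi> (\<lambda>j. - \<eta> j)" and ?v = "case_sum d (\<lambda>j. d j + h)"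
  have Plus: "(\<Sum>i\<in>?I. f i) = (\<Sum>j<D. f (Inl j)) + (\<Sum>j<D. f (Inr j))" for f :: "nat + nat \<Rightarrow> real"
    by (simp add: sum.Plus)
  have lin: "(\<Sum>i\<in>?I. ?c i * Y (?v i) x) = (\<Sum>j<D. \<xi> j * Y (d j) x) - (\<Sum>j<D. \<eta> j * S h x j)" for x
    unfolding Plus by (simp add: S_def sum_negf)
  have swap: "(\<Sum>j<D. \<Sum>l<D. \<eta> j * \<xi> l * gauss_cov (d j + h - d l)) = cov_form D h \<xi> \<eta>"
  proof -
    have "gauss_cov (d j + h - d l) = gauss_cov (d l - d j - h)" for j l
      using gauss_cov_minus[of "d j + h" "d l"] by (simp add: diff_diff_add)
    then show ?thesis unfolding cov_form_def by (subst sum.swap) (simp add: mult_ac)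
  qed
  have quad: "(\<Sum>i\<in>?I. \<Sum>l\<in>?I. ?c i * ?c l * gauss_cov (?v i - ?v l)) =
     cov_form D 0 \<xi> \<xi> + cov_form D 0 \<eta> \<eta> - 2 * cov_form D h \<xi> \<eta>"
  proof -
    have "(\<Sum>j<D. \<Sum>l<D. \<xi> j * \<eta> l * gauss_cov (d j - (d l + h))) = cov_form D h \<xi> \<eta>"
      unfolding cov_form_def by (simp add: diff_diff_add)
    then show ?thesis
      unfolding Plus using swap by (simp add: sum.distrib sum_subtractf sum_negf cov_form_def)
  qed
  have "(\<integral>x. cis ((\<Sum>j<D. \<xi> j * x j) - (\<Sum>j<D. \<eta> j * S h x j)) \<partial>M) = (\<integral>x. cis (\<Sum>i\<in>?I. ?c i * Y (?v i) x) \<partial>M)"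
  proof (rule integral_cong_AE)
    have "AE x in M. \<forall>n. Y (d n) x = x n"
      unfolding AE_all_countable by (intro allI AE_Y_dense)
    then show "AE x in M. cis ((\<Sum>j<D. \<xi> j * x j) - (\<Sum>j<D. \<eta> j * S h x j)) = cis (\<Sum>i\<in>?I. ?c i * Y (?v i) x)"
      unfolding lin by eventually_elim simp
    show "(\<lambda>x. cis ((\<Sum>j<D. \<xi> j * x j) - (\<Sum>j<D. \<eta> j * S h x j))) \<in> borel_measurable M"
      by (intro measurable_compose[OF _ measurable_cis] borel_measurable_diff measurable_linear measurable_linear_S)
    show "(\<lambda>x. cis (\<Sum>i\<in>?I. ?c i * Y (?v i) x)) \<in> borel_measurable M"
      by (intro measurable_compose[OF _ measurable_cis] borel_measurable_sum borel_measurable_times borel_measurable_const measurable_Y_M)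
  qed
  also have "\<dots> = of_real (exp (- (cov_form D 0 \<xi> \<xi> + cov_form D 0 \<eta> \<eta> - 2 * cov_form D h \<xi> \<eta>) / 2))"
    unfolding quad[symmetric] by (rule char_Y) simp
  finally show ?thesis .
qed

text \<open>
  When the shift multiplies the covariances by \<open>\<rho>\<close>, the mixed term in \<open>char_mixed\<close> becomes
  \<open>exp (\<rho> q)\<close>, where \<open>q\<close> is an inner product in Cholesky coordinates; expand the exponential. This is
  used with \<open>h = 0\<close>, \<open>\<rho> = 1\<close> to compute norms and with \<open>h\<close> orthogonal to the points \<open>d j\<close> to compute
  correlations.
\<close>

lemma chaos_expansion:
  fixes C :: "nat \<Rightarrow> nat \<Rightarrow> real"
  assumes C: "\<And>m n. m < D \<Longrightarrow> gauss_cov (d m - d n) = (\<Sum>p<D. C m p * C n p)"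
    and \<rho>: "\<And>j l. j < D \<Longrightarrow> l < D \<Longrightarrow> gauss_cov (d j - d l - h) = \<rho> * gauss_cov (d j - d l)"
  defines "a \<equiv> \<lambda>c \<xi> i. c i * complex_of_real (exp (- cov_form D 0 (\<xi> i) (\<xi> i) / 2))"
    and "x \<equiv> \<lambda>\<xi> i p. \<Sum>j<D. \<xi> i j * C j p"
  shows "(\<lambda>k. chaos_form D k N (a c \<xi>) (x \<xi>) N' (a c' \<eta>) (x \<eta>) * of_real \<rho> ^ k) sums
     (\<integral>z. (\<Sum>i<N. c i * cis (\<Sum>j<D. \<xi> i j * z j)) * cnj (\<Sum>l<N'. c' l * cis (\<Sum>j<D. \<eta> l j * S h z j)) \<partial>M)"
proof -
  have cov: "cov_form D h u v = \<rho> * (\<Sum>p<D. (\<Sum>j<D. u j * C j p) * (\<Sum>j<D. v j * C j p))" for u v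
  proof -
    have "(\<Sum>p<D. (\<Sum>j<D. u j * C j p) * (\<Sum>j<D. v j * C j p)) = (\<Sum>p<D. \<Sum>j<D. \<Sum>l<D. u j * v l * (C j p * C l p))"
      unfolding sum_product by (simp add: mult_ac)
    also have "\<dots> = (\<Sum>j<D. \<Sum>p<D. \<Sum>l<D. u j * v l * (C j p * C l p))" by (rule sum.swap)
    also have "\<dots> = (\<Sum>j<D. \<Sum>l<D. \<Sum>p<D. u j * v l * (C j p * C l p))" by (intro sum.cong refl sum.swap)
    also have "\<dots> = (\<Sum>j<D. \<Sum>l<D. u j * v l * gauss_cov (d j - d l))"
      by (intro sum.cong refl) (simp add: sum_distrib_left C)
    finally have eq: "(\<Sum>p<D. (\<Sum>j<D. u j * C j p) * (\<Sum>j<D. v j * C j p)) = (\<Sum>j<D. \<Sum>l<D. u j * v l * gauss_cov (d j - d l))" .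
    show ?thesis
      unfolding eq unfolding cov_form_def sum_distrib_left by (intro sum.cong refl) (simp add: \<rho>)
  qed
  define e where "e i l z = cis ((\<Sum>j<D. \<xi> i j * z j) - (\<Sum>j<D. \<eta> l j * S h z j))" for i l z
  have int_e: "integrable M (e i l)" for i l
    unfolding e_def by (intro integrable_cis_M borel_measurable_diff measurable_linear measurable_linear_S)
  have "(\<integral>z. (\<Sum>i<N. c i * cis (\<Sum>j<D. \<xi> i j * z j)) * cnj (\<Sum>l<N'. c' l * cis (\<Sum>j<D. \<eta> l j * S h z j)) \<partial>M)
     = (\<integral>z. (\<Sum>i<N. \<Sum>l<N'. (c i * cnj (c' l)) * e i l z) \<partial>M)"
  proof (rule Bochner_Integration.integral_cong[OF refl])
    fix z
    show "(\<Sum>i<N. c i * cis (\<Sum>j<D. \<xi> i j * z j)) * cnj (\<Sum>l<N'. c' l * cis (\<Sum>j<D. \<eta> l j * S h z j)) =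
       (\<Sum>i<N. \<Sum>l<N'. (c i * cnj (c' l)) * e i l z)"
      unfolding cnj_sum sum_product e_def
      by (intro sum.cong refl) (simp add: cis_cnj cis_mult mult_ac)
  qed
  also have "\<dots> = (\<Sum>i<N. \<Sum>l<N'. (c i * cnj (c' l)) * (\<integral>z. e i l z \<partial>M))"
  proof -
    have "(\<integral>z. (\<Sum>i<N. \<Sum>l<N'. (c i * cnj (c' l)) * e i l z) \<partial>M) = (\<Sum>i<N. \<integral>z. (\<Sum>l<N'. (c i * cnj (c' l)) * e i l z) \<partial>M)"
      by (intro Bochner_Integration.integral_sum Bochner_Integration.integrable_sum integrable_mult_right int_e)
    also have "\<dots> = (\<Sum>i<N. \<Sum>l<N'. \<integral>z. (c i * cnj (c' l)) * e i l z \<partial>M)"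
      by (intro sum.cong refl Bochner_Integration.integral_sum integrable_mult_right int_e)
    finally show ?thesis by simp
  qed
  also have "\<dots> = (\<Sum>i<N. \<Sum>l<N'. a c \<xi> i * cnj (a c' \<eta> l) * of_real (exp (cov_form D h (\<xi> i) (\<eta> l))))"
  proof (intro sum.cong refl)
    fix i l
    have "- (cov_form D 0 (\<xi> i) (\<xi> i) + cov_form D 0 (\<eta> l) (\<eta> l) - 2 * cov_form D h (\<xi> i) (\<eta> l)) / 2 =
       - cov_form D 0 (\<xi> i) (\<xi> i) / 2 + - cov_form D 0 (\<eta> l) (\<eta> l) / 2 + cov_form D h (\<xi> i) (\<eta> l)"
      by (simp add: field_simps)
    then have "(\<integral>z. e i l z \<partial>M) = of_real (exp (- cov_form D 0 (\<xi> i) (\<xi> i) / 2) * exp (- cov_form D 0 (\<eta> l) (\<eta> l) / 2) * exp (cov_form D h (\<xi> i) (\<eta> l)))"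
      unfolding e_def char_mixed by (simp only: exp_add)
    then show "c i * cnj (c' l) * (\<integral>z. e i l z \<partial>M) = a c \<xi> i * cnj (a c' \<eta> l) * of_real (exp (cov_form D h (\<xi> i) (\<eta> l)))"
      unfolding a_def by simp
  qed
  finally have eq: "(\<integral>z. (\<Sum>i<N. c i * cis (\<Sum>j<D. \<xi> i j * z j)) * cnj (\<Sum>l<N'. c' l * cis (\<Sum>j<D. \<eta> l j * S h z j)) \<partial>M)
     = (\<Sum>i<N. \<Sum>l<N'. a c \<xi> i * cnj (a c' \<eta> l) * of_real (exp (cov_form D h (\<xi> i) (\<eta> l))))" .
  have "(\<lambda>k. \<Sum>i<N. \<Sum>l<N'. a c \<xi> i * cnj (a c' \<eta> l) * of_real (cov_form D h (\<xi> i) (\<eta> l) ^ k /\<^sub>R fact k)) sums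
      (\<Sum>i<N. \<Sum>l<N'. a c \<xi> i * cnj (a c' \<eta> l) * of_real (exp (cov_form D h (\<xi> i) (\<eta> l))))"
    by (intro sums_sum sums_mult sums_of_real exp_converges)
  moreover have "(\<Sum>i<N. \<Sum>l<N'. a c \<xi> i * cnj (a c' \<eta> l) * of_real (cov_form D h (\<xi> i) (\<eta> l) ^ k /\<^sub>R fact k)) =
      chaos_form D k N (a c \<xi>) (x \<xi>) N' (a c' \<eta>) (x \<eta>) * of_real \<rho> ^ k" for k
    unfolding chaos_form_def cov x_def sum_divide_distrib sum_distrib_right
    by (intro sum.cong refl) (simp add: power_mult_distrib divide_inverse mult_ac)
  ultimately show ?thesis unfolding eq by simp
qed

lemma integrable_trig_poly:
  assumes "f \<in> trig_polys" shows "integrable M f"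
proof -
  obtain c where "\<And>x. norm (f x) \<le> c" using trig_polys_bounded[OF assms] by blast
  moreover have "f \<in> borel_measurable M"
    using trig_polys_measurable[OF assms] measurable_cong_sets[OF sets_M refl] by blast
  ultimately show ?thesis by (intro integrable_bounded_prob finite_measure_axioms)
qed

text \<open>
  The coefficients \<open>\<alpha> k\<close> do not depend on \<open>r\<close>. A vector \<open>h\<close> of norm \<open>r\<close> orthogonal to the points \<open>d j\<close>
  that occur in \<open>f\<close> and \<open>g\<close> gives \<open>\<parallel>d j - d l - h\<parallel>\<^sup>2 = \<parallel>d j - d l\<parallel>\<^sup>2 + r\<^sup>2\<close>, so the shift by \<open>h\<close> multiplies
  all covariances by \<open>exp (- r\<^sup>2 / 2)\<close>.
\<close>

theorem trig_polys_correlation: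
  assumes f: "f \<in> trig_polys" and g: "g \<in> trig_polys"
    and orth: "\<And>F::'h set. finite F \<Longrightarrow> \<exists>u. norm u = 1 \<and> (\<forall>v\<in>F. u \<bullet> v = 0)"
  obtains \<alpha> :: "nat \<Rightarrow> complex" where
    "\<alpha> 0 = (\<integral>x. f x \<partial>M) * cnj (\<integral>x. g x \<partial>M)"
    "\<And>k. (norm (\<alpha> k))\<^sup>2 \<le> (\<integral>x. (norm (f x))\<^sup>2 \<partial>M) * (\<integral>x. (norm (g x))\<^sup>2 \<partial>M)"
    "\<And>r. r > 0 \<Longrightarrow> \<exists>h. norm h = r \<and>
        (\<lambda>k. \<alpha> k * of_real (exp (- r\<^sup>2 / 2)) ^ k) sums (\<integral>x. f x * cnj (g (S h x)) \<partial>M)"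
proof -
  obtain N N' D c c' \<xi> \<eta> where fD: "f = (\<lambda>x. \<Sum>i<(N::nat). c i * cis (\<Sum>j<(D::nat). \<xi> i j * x j))"
    and gD: "g = (\<lambda>x. \<Sum>i<(N'::nat). c' i * cis (\<Sum>j<D. \<eta> i j * x j))"
    by (rule trig_polys_pairE[OF f g])
  obtain C :: "nat \<Rightarrow> nat \<Rightarrow> real" where C0: "\<And>N m n. m < N \<Longrightarrow> gauss_cov (d m - d n) = (\<Sum>j<N. C m j * C n j)"
    using psd_kernel_cholesky[OF psd_kernel_gauss_cov[of d]] by metis
  have C: "\<And>m n. m < D \<Longrightarrow> gauss_cov (d m - d n) = (\<Sum>j<D. C m j * C n j)" by (rule C0)
  define a where "a = (\<lambda>c (\<xi> :: nat \<Rightarrow> nat \<Rightarrow> real) i. c i * complex_of_real (exp (- cov_form D 0 (\<xi> i) (\<xi> i) / 2)))"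
  define y where "y = (\<lambda>(\<xi> :: nat \<Rightarrow> nat \<Rightarrow> real) i p. \<Sum>j<D. \<xi> i j * C j p)"
  define \<alpha> where "\<alpha> k = chaos_form D k N (a c \<xi>) (y \<xi>) N' (a c' \<eta>) (y \<eta>)" for k
  \<comment> \<open>All terms of the expansion at \<open>h = 0\<close> are nonnegative, so each is at most the sum.\<close>
  have diag: "chaos_norm2 D k n (a b \<zeta>) (y \<zeta>) \<le> (\<integral>x. (norm (\<Sum>i<n. b i * cis (\<Sum>j<D. \<zeta> i j * x j)))\<^sup>2 \<partial>M)" for k n b \<zeta>
  proof -
    let ?e = "\<lambda>x. \<Sum>i<n. b i * cis (\<Sum>j<D. \<zeta> i j * x j)"
    have "(\<lambda>k. of_real (chaos_norm2 D k n (a b \<zeta>) (y \<zeta>)) * of_real 1 ^ k) sums (\<integral>x. ?e x * cnj (?e (S 0 x)) \<partial>M)"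
      using chaos_expansion[OF C, of 0 1 n b \<zeta> n b \<zeta>]
      unfolding a_def y_def chaos_form_diag by simp
    moreover have "(\<integral>x. ?e x * cnj (?e (S 0 x)) \<partial>M) = (\<integral>x. of_real ((norm (?e x))\<^sup>2) \<partial>M)"
    proof (rule integral_cong_AE)
      show "AE x in M. ?e x * cnj (?e (S 0 x)) = of_real ((norm (?e x))\<^sup>2)"
        using AE_S_0 by eventually_elim (simp only: complex_norm_square)
      have e: "?e \<in> borel_measurable M"
        by (rule borel_measurable_integrable[OF integrable_trig_poly[OF trig_polysI]])
      have eS: "(\<lambda>x. ?e (S 0 x)) \<in> borel_measurable M"
        using measurable_S e by (rule measurable_compose)
      show "(\<lambda>x. ?e x * cnj (?e (S 0 x))) \<in> borel_measurable M"
        using e eS by (intro borel_measurable_times measurable_compose[OF eS borel_measurable_continuous_onI] continuous_intros)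
      show "(\<lambda>x. complex_of_real ((norm (?e x))\<^sup>2)) \<in> borel_measurable M"
        by (rule measurable_compose[OF e borel_measurable_continuous_onI]) (intro continuous_intros)
    qed
    ultimately have "(\<lambda>k. complex_of_real (chaos_norm2 D k n (a b \<zeta>) (y \<zeta>))) sums complex_of_real (\<integral>x. (norm (?e x))\<^sup>2 \<partial>M)"
      by (simp only: integral_complex_of_real of_real_1 power_one mult_1_right)
    then have "(\<lambda>k. chaos_norm2 D k n (a b \<zeta>) (y \<zeta>)) sums (\<integral>x. (norm (?e x))\<^sup>2 \<partial>M)"
      by (simp only: sums_of_real_iff)
    from sum_le_suminf[OF sums_summable[OF this], of "{k}"] sums_unique[OF this] show ?thesis by (simp add: chaos_norm2_nonneg)
  qed
  show ?thesis
  proof (rule that[of \<alpha>])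
    have mean: "(\<integral>x. (\<Sum>i<n. b i * cis (\<Sum>j<D. \<zeta> i j * x j)) \<partial>M) = (\<Sum>i<n. a b \<zeta> i)" for n b \<zeta>
    proof -
      have "(\<integral>x. (\<Sum>i<n. b i * cis (\<Sum>j<D. \<zeta> i j * x j)) \<partial>M) = (\<Sum>i<n. b i * (\<integral>x. cis (\<Sum>j<D. \<zeta> i j * x j) \<partial>M))"
        by (simp add: integral_sum integrable_cis_M measurable_linear)
      then show ?thesis by (simp add: a_def char_M cov_form_def)
    qed
    show "\<alpha> 0 = (\<integral>x. f x \<partial>M) * cnj (\<integral>x. g x \<partial>M)"
      unfolding fD gD mean by (simp add: \<alpha>_def chaos_form_def sum_product)
    show "(norm (\<alpha> k))\<^sup>2 \<le> (\<integral>x. (norm (f x))\<^sup>2 \<partial>M) * (\<integral>x. (norm (g x))\<^sup>2 \<partial>M)" for k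
      unfolding \<alpha>_def fD gD
      by (rule order_trans[OF chaos_form_Cauchy_Schwarz])
         (intro mult_mono diag chaos_norm2_nonneg Bochner_Integration.integral_nonneg zero_le_power2)
    fix r :: real assume r: "r > 0"
    obtain u where u: "norm u = 1" "\<And>v. v \<in> d ` {..<D} \<Longrightarrow> u \<bullet> v = 0"
      using orth[of "d ` {..<D}"] by auto
    have "gauss_cov (d j - d l - r *\<^sub>R u) = exp (- r\<^sup>2 / 2) * gauss_cov (d j - d l)" if "j < D" "l < D" for j l
    proof -
      define w where "w = d j - d l"
      have uw: "u \<bullet> w = 0" unfolding w_def inner_diff_right using u(2) that by auto
      then have wu: "w \<bullet> u = 0" by (simp only: inner_commute)
      have uu: "u \<bullet> u = 1" using u(1) by (simp only: norm_eq_1)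
      have "(norm (w - r *\<^sub>R u))\<^sup>2 = (norm w)\<^sup>2 + r\<^sup>2"
        unfolding power2_norm_eq_inner inner_diff_left inner_diff_right inner_scaleR_left inner_scaleR_right uw wu uu
        by (simp add: power2_eq_square)
      then have "- (norm (w - r *\<^sub>R u))\<^sup>2 / 2 = - r\<^sup>2 / 2 + - (norm w)\<^sup>2 / 2" by simp
      then show ?thesis unfolding gauss_cov_def w_def[symmetric] by (simp only: exp_add)
    qed
    from chaos_expansion[OF C this, of N c \<xi> N' c' \<eta>]
    have "(\<lambda>k. \<alpha> k * of_real (exp (- r\<^sup>2 / 2)) ^ k) sums (\<integral>x. f x * cnj (g (S (r *\<^sub>R u) x)) \<partial>M)"
      unfolding \<alpha>_def a_def y_def fD gD .
    moreover have "norm (r *\<^sub>R u) = r" using u(1) r by simp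
    ultimately show "\<exists>h. norm h = r \<and> (\<lambda>k. \<alpha> k * of_real (exp (- r\<^sup>2 / 2)) ^ k) sums (\<integral>x. f x * cnj (g (S h x)) \<partial>M)"
      by blast
  qed
qed

end

section \<open>The shift is a faithful whirly near-action\<close>

lemma infinite_dim_orthogonal_vector:
  fixes F :: "'h::real_inner set"
  assumes inf: "\<nexists>B :: 'h set. finite B \<and> span B = UNIV" and F: "finite F"
  shows "\<exists>u. norm u = 1 \<and> (\<forall>v\<in>F. u \<bullet> v = 0)"
proof -
  obtain C where C: "finite C" "span C = span F" "pairwise orthogonal C"
    using basis_orthogonal[OF F] by blast
  have "span C \<noteq> UNIV" using inf C(1) by blast
  then obtain v where v: "v \<notin> span C" by blast
  define w where "w = v - (\<Sum>b\<in>C. ((b \<bullet> v) / (b \<bullet> b)) *\<^sub>R b)"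
  have "(\<Sum>b\<in>C. ((b \<bullet> v) / (b \<bullet> b)) *\<^sub>R b) \<in> span C"
    by (intro span_sum span_scale span_base)
  then have w0: "w \<noteq> 0" using v by (auto simp: w_def)
  have "orthogonal w b" if b: "b \<in> C" for b
  proof -
    have "b \<bullet> (\<Sum>b'\<in>C. ((b' \<bullet> v) / (b' \<bullet> b')) *\<^sub>R b') = (\<Sum>b'\<in>C. if b' = b then b \<bullet> v else 0)"
      unfolding inner_sum_right
    proof (intro sum.cong refl)
      fix b' assume "b' \<in> C"
      then have "b' \<noteq> b \<Longrightarrow> b \<bullet> b' = 0"
        using C(3) b by (auto simp: pairwise_def orthogonal_def)
      then show "b \<bullet> (((b' \<bullet> v) / (b' \<bullet> b')) *\<^sub>R b') = (if b' = b then b \<bullet> v else 0)" by auto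
    qed
    then have "b \<bullet> w = 0" using C(1) b by (simp add: w_def inner_diff_right)
    then show ?thesis by (simp add: orthogonal_def inner_commute)
  qed
  then have "orthogonal w y" if "y \<in> F" for y
    using orthogonal_to_span[of y C w] that C(2) span_base[of y F] by blast
  then have "\<forall>y\<in>F. (w /\<^sub>R norm w) \<bullet> y = 0" by (simp add: orthogonal_def)
  moreover have "norm (w /\<^sub>R norm w) = 1" using w0 by simp
  ultimately show ?thesis by blast
qed

context stationary_gaussian begin

lemma integrable_bounded_M:
  fixes f :: "(nat \<Rightarrow> real) \<Rightarrow> 'b::{banach, second_countable_topology}"
  shows "f \<in> borel_measurable M \<Longrightarrow> (\<And>x. norm (f x) \<le> c) \<Longrightarrow> integrable M f"
  by (rule integrable_bounded_prob[OF finite_measure_axioms])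

lemma measurable_S_comp: "f \<in> borel_measurable M \<Longrightarrow> (\<lambda>x. f (S h x)) \<in> borel_measurable M"
  using measurable_S by (rule measurable_compose)

lemma integral_S:
  fixes f :: "(nat \<Rightarrow> real) \<Rightarrow> 'b::{banach, second_countable_topology}"
  assumes "f \<in> borel_measurable M"
  shows "(\<integral>x. f (S h x) \<partial>M) = (\<integral>x. f x \<partial>M)"
  using integral_distr[OF measurable_S assms, of h] by (simp only: distr_S)

lemma trig_poly_measurable_M: "f \<in> trig_polys \<Longrightarrow> f \<in> borel_measurable M"
  by (rule borel_measurable_integrable[OF integrable_trig_poly])

lemma indicator_measurable_M: "A \<in> sets M \<Longrightarrow> (\<lambda>x. indicator A x :: complex) \<in> borel_measurable M"
  by (rule borel_measurable_indicator)

lemma measurable_dist_sq: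
  assumes "u \<in> borel_measurable M" "v \<in> borel_measurable M"
  shows "(\<lambda>x. (norm (u x - v x :: complex))\<^sup>2) \<in> borel_measurable M"
  by (rule measurable_compose[OF borel_measurable_diff[OF assms] borel_measurable_continuous_onI])
     (intro continuous_intros)

lemma integrable_dist_sq_M:
  assumes "u \<in> borel_measurable M" "v \<in> borel_measurable M"
    "\<And>x. norm (u x) \<le> b" "\<And>x. norm (v x) \<le> c"
  shows "integrable M (\<lambda>x. (norm (u x - v x :: complex))\<^sup>2)"
proof (rule integrable_bounded_M[OF measurable_dist_sq[OF assms(1,2)]])
  fix x
  have "norm (u x - v x) \<le> b + c" using norm_triangle_ineq4[of "u x" "v x"] assms(3,4)[of x] by linarith
  then show "norm ((norm (u x - v x))\<^sup>2) \<le> (b + c)\<^sup>2" by (simp add: power_mono)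
qed

lemma norm_indicator_le: "norm (indicator A x :: complex) \<le> 1"
  by (simp add: indicator_def)

lemma integral_indicator_sq: "A \<in> sets M \<Longrightarrow> (\<integral>x. (norm (indicator A x :: complex))\<^sup>2 \<partial>M) = measure M A"
proof -
  assume A: "A \<in> sets M"
  have "(norm (indicator A x :: complex))\<^sup>2 = indicator A x" for x by (simp add: indicator_def)
  then show ?thesis using A by simp
qed

lemma trig_poly_approx_bounds:
  assumes f: "f \<in> trig_polys" and A: "A \<in> sets M" and \<delta>: "0 < \<delta>" "\<delta> \<le> 1"
    and fA: "(\<integral>x. (norm (indicator A x - f x))\<^sup>2 \<partial>M) < \<delta>\<^sup>2"
  shows "(\<integral>x. (norm (f x))\<^sup>2 \<partial>M) \<le> 4" "norm (of_real (measure M A) - (\<integral>x. f x \<partial>M)) \<le> \<delta>"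
proof -
  obtain c where c: "\<And>x. norm (f x) \<le> c" using trig_polys_bounded[OF f] by blast
  note fm = trig_poly_measurable_M[OF f] and Am = indicator_measurable_M[OF A]
  have i1: "integrable M (\<lambda>x. (norm (indicator A x - f x))\<^sup>2)"
    by (rule integrable_dist_sq_M[OF Am fm norm_indicator_le c])
  have i2: "integrable M (\<lambda>x. (norm (indicator A x :: complex))\<^sup>2)"
    using integrable_dist_sq_M[OF Am borel_measurable_const[of 0] norm_indicator_le, of 0] by simp
  have i3: "integrable M (\<lambda>x. (norm (f x))\<^sup>2)"
    using integrable_dist_sq_M[OF fm borel_measurable_const[of 0] c, of 0] by simp
  have "(\<integral>x. (norm (f x))\<^sup>2 \<partial>M) \<le> (\<integral>x. 2 * (norm (indicator A x - f x))\<^sup>2 + 2 * (norm (indicator A x :: complex))\<^sup>2 \<partial>M)"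
  proof (intro integral_mono i3 Bochner_Integration.integrable_add integrable_mult_right i1 i2)
    fix x
    show "(norm (f x))\<^sup>2 \<le> 2 * (norm (indicator A x - f x))\<^sup>2 + 2 * (norm (indicator A x :: complex))\<^sup>2"
      using norm_add_sq_le[of "f x - indicator A x" "indicator A x"] by (simp add: norm_minus_commute)
  qed
  also have "\<dots> = 2 * (\<integral>x. (norm (indicator A x - f x))\<^sup>2 \<partial>M) + 2 * measure M A"
    using i1 i2 by (simp add: integral_indicator_sq[OF A])
  also have "\<dots> \<le> 2 * 1 + 2 * 1"
    using fA power_mono[OF \<delta>(2), of 2] \<delta>(1) by (intro add_mono mult_left_mono prob_le_1) auto
  finally show "(\<integral>x. (norm (f x))\<^sup>2 \<partial>M) \<le> 4" by simp
  show "norm (of_real (measure M A) - (\<integral>x. f x \<partial>M)) \<le> \<delta>"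
    by (rule measure_integral_approx[OF prob_space_axioms A fm c \<delta>(1) less_imp_le[OF fA]])
qed

text \<open>
  If \<open>f\<close> and \<open>g\<close> are close to the indicators of \<open>A\<close> and \<open>B\<close>, and \<open>B\<close> shifted does not meet \<open>A\<close>, then the
  correlation of \<open>f\<close> with the shift of \<open>g\<close> is close to that of the indicators, which is zero.
\<close>

lemma disjoint_correlation_bound:
  assumes f: "f \<in> trig_polys" and g: "g \<in> trig_polys" and A: "A \<in> sets M" and B: "B \<in> sets M"
    and \<delta>: "0 < \<delta>" "\<delta> \<le> 1"
    and fA: "(\<integral>x. (norm (indicator A x - f x))\<^sup>2 \<partial>M) < \<delta>\<^sup>2"
    and gB: "(\<integral>x. (norm (indicator B x - g x))\<^sup>2 \<partial>M) < \<delta>\<^sup>2"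
    and disj: "AE x in M. \<not> (x \<in> A \<and> S h x \<in> B)"
  shows "norm (\<integral>x. f x * cnj (g (S h x)) \<partial>M) \<le> 4 * \<delta>"
proof -
  obtain c where c: "\<And>x. norm (f x) \<le> c" using trig_polys_bounded[OF f] by blast
  obtain c' where c': "\<And>x. norm (g x) \<le> c'" using trig_polys_bounded[OF g] by blast
  note fm = trig_poly_measurable_M[OF f] and gm = trig_poly_measurable_M[OF g]
  note Am = indicator_measurable_M[OF A] and Bm = indicator_measurable_M[OF B]
  define u where "u x = (norm (indicator A x - f x))\<^sup>2" for x
  define v where "v x = (norm (g x))\<^sup>2" for x
  define w where "w x = (norm (indicator B x - g x))\<^sup>2" for x
  have iu: "integrable M u" unfolding u_def by (rule integrable_dist_sq_M[OF Am fm norm_indicator_le c])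
  have vm: "v \<in> borel_measurable M" unfolding v_def using measurable_dist_sq[OF gm borel_measurable_const[of 0]] by simp
  have wm: "w \<in> borel_measurable M" unfolding w_def by (rule measurable_dist_sq[OF Bm gm])
  have iv: "integrable M (\<lambda>x. v (S h x))"
    unfolding v_def
    using integrable_dist_sq_M[OF measurable_S_comp[OF gm] borel_measurable_const[of 0] c', of 0] by simp
  have iw: "integrable M (\<lambda>x. w (S h x))"
    unfolding w_def by (rule integrable_dist_sq_M[OF measurable_S_comp[OF Bm] measurable_S_comp[OF gm] norm_indicator_le c'])
  have bound: "norm (f x * cnj (g (S h x))) \<le> (u x / \<delta> + \<delta> * v (S h x)) / 2 + (w (S h x) / \<delta> + \<delta>) / 2"
    if "\<not> (x \<in> A \<and> S h x \<in> B)" for x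
  proof -
    let ?y = "S h x"
    have zero: "indicator A x * cnj (indicator B ?y) = (0 :: complex)" using that by (auto simp: indicator_def)
    have "f x * cnj (g ?y) = (f x - indicator A x) * cnj (g ?y) + indicator A x * cnj (g ?y - indicator B ?y)"
      using zero by (simp add: algebra_simps)
    then have "norm (f x * cnj (g ?y)) \<le> norm (indicator A x - f x) * norm (g ?y) + norm (indicator A x :: complex) * norm (indicator B ?y - g ?y)"
      using norm_triangle_ineq[of "(f x - indicator A x) * cnj (g ?y)" "indicator A x * cnj (g ?y - indicator B ?y)"]
      by (simp only: norm_mult complex_mod_cnj norm_minus_commute)
    also have "\<dots> \<le> norm (indicator A x - f x) * norm (g ?y) + 1 * norm (indicator B ?y - g ?y)"
      by (intro add_left_mono mult_right_mono norm_indicator_le norm_ge_zero)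
    also have "\<dots> \<le> (u x / \<delta> + \<delta> * v ?y) / 2 + (w ?y / \<delta> + \<delta>) / 2"
      unfolding u_def v_def w_def mult_1
      by (intro add_mono mult_le_weighted_sq norm_le_weighted_sq \<delta>)
    finally show ?thesis .
  qed
  have ifg: "integrable M (\<lambda>x. f x * cnj (g (S h x)))"
  proof (rule integrable_bounded_M)
    show "(\<lambda>x. f x * cnj (g (S h x))) \<in> borel_measurable M"
      by (intro borel_measurable_times fm measurable_compose[OF measurable_S_comp[OF gm] borel_measurable_continuous_onI] continuous_intros)
    show "norm (f x * cnj (g (S h x))) \<le> c * c'" for x
      unfolding norm_mult complex_mod_cnj
      by (rule mult_mono[OF c c' order_trans[OF norm_ge_zero c] norm_ge_zero])
  qed
  have "norm (\<integral>x. f x * cnj (g (S h x)) \<partial>M) \<le> (\<integral>x. norm (f x * cnj (g (S h x))) \<partial>M)"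
    by (rule integral_norm_bound)
  also have "\<dots> \<le> (\<integral>x. (u x / \<delta> + \<delta> * v (S h x)) / 2 + (w (S h x) / \<delta> + \<delta>) / 2 \<partial>M)"
  proof (rule integral_mono_AE)
    show "integrable M (\<lambda>x. norm (f x * cnj (g (S h x))))" using ifg by (rule integrable_norm)
    show "integrable M (\<lambda>x. (u x / \<delta> + \<delta> * v (S h x)) / 2 + (w (S h x) / \<delta> + \<delta>) / 2)"
      using iu iv iw by simp
    show "AE x in M. norm (f x * cnj (g (S h x))) \<le> (u x / \<delta> + \<delta> * v (S h x)) / 2 + (w (S h x) / \<delta> + \<delta>) / 2"
      using disj by eventually_elim (rule bound)
  qed
  also have "\<dots> = ((\<integral>x. u x \<partial>M) / \<delta> + \<delta> * (\<integral>x. v x \<partial>M)) / 2 + ((\<integral>x. w x \<partial>M) / \<delta> + \<delta>) / 2"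
    using iu iv iw integral_S[OF vm, of h] integral_S[OF wm, of h] by (simp add: prob_space[simplified])
  also have "\<dots> \<le> (\<delta>\<^sup>2 / \<delta> + \<delta> * 4) / 2 + (\<delta>\<^sup>2 / \<delta> + \<delta>) / 2"
    using fA gB trig_poly_approx_bounds(1)[OF g B \<delta> gB] \<delta>(1)
    unfolding u_def v_def w_def
    by (intro add_mono divide_right_mono mult_left_mono) auto
  also have "\<dots> \<le> 4 * \<delta>" using \<delta> by (simp add: power2_eq_square)
  finally show ?thesis .
qed

text \<open>
  Only the shifts by vectors of norm below \<open>r0\<close> are controlled, that is, correlations \<open>\<rho>\<close> close to one.
  Analyticity in \<open>\<rho>\<close> carries the information to \<open>\<rho> = 0\<close>, where \<open>A\<close> and the shift of \<open>B\<close> become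
  independent.
\<close>

theorem whirly_core:
  assumes A: "A \<in> sets M" and B: "B \<in> sets M" and r0: "r0 > 0"
    and orth: "\<And>F::'h set. finite F \<Longrightarrow> \<exists>u. norm u = 1 \<and> (\<forall>v\<in>F. u \<bullet> v = 0)"
    and disj: "\<And>h. norm h < r0 \<Longrightarrow> AE x in M. \<not> (x \<in> A \<and> S h x \<in> B)"
  shows "measure M A * measure M B = 0"
proof -
  let ?\<mu> = "complex_of_real (measure M A * measure M B)"
  have step: "\<exists>\<alpha>. (\<forall>k. norm (\<alpha> k) \<le> 4) \<and> norm (\<alpha> 0 - ?\<mu>) \<le> 3 * \<delta> \<and>
      (\<forall>r. 0 < r \<longrightarrow> r < r0 \<longrightarrow> norm (\<Sum>k. \<alpha> k * of_real (exp (- r\<^sup>2 / 2)) ^ k) \<le> 4 * \<delta>)"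
    if \<delta>: "0 < \<delta>" "\<delta> \<le> 1" for \<delta> :: real
  proof -
    have d2: "0 < \<delta>\<^sup>2" using \<delta> by simp
    obtain f where f: "f \<in> trig_polys" "(\<integral>x. (norm (indicator A x - f x))\<^sup>2 \<partial>M) < \<delta>\<^sup>2"
      using trig_polys_L2_dense[OF finite_measure_axioms sets_M A d2] by blast
    obtain g where g: "g \<in> trig_polys" "(\<integral>x. (norm (indicator B x - g x))\<^sup>2 \<partial>M) < \<delta>\<^sup>2"
      using trig_polys_L2_dense[OF finite_measure_axioms sets_M B d2] by blast
    obtain \<alpha> :: "nat \<Rightarrow> complex" where \<alpha>0: "\<alpha> 0 = (\<integral>x. f x \<partial>M) * cnj (\<integral>x. g x \<partial>M)"
      and \<alpha>: "\<And>k. (norm (\<alpha> k))\<^sup>2 \<le> (\<integral>x. (norm (f x))\<^sup>2 \<partial>M) * (\<integral>x. (norm (g x))\<^sup>2 \<partial>M)"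
      and sums: "\<And>r. r > 0 \<Longrightarrow> \<exists>h. norm h = r \<and>
        (\<lambda>k. \<alpha> k * of_real (exp (- r\<^sup>2 / 2)) ^ k) sums (\<integral>x. f x * cnj (g (S h x)) \<partial>M)"
      using trig_polys_correlation[OF f(1) g(1) orth] by blast
    note bf = trig_poly_approx_bounds[OF f(1) A \<delta> f(2)] and bg = trig_poly_approx_bounds[OF g(1) B \<delta> g(2)]
    have "norm (\<alpha> k) \<le> 4" for k
    proof -
      have "(norm (\<alpha> k))\<^sup>2 \<le> 4 * 4"
        by (rule order_trans[OF \<alpha>]) (intro mult_mono bf(1) bg(1); simp)
      then have "(norm (\<alpha> k))\<^sup>2 \<le> 4\<^sup>2" by simp
      then show ?thesis by (rule power2_le_imp_le) simp
    qed
    moreover have "norm (\<alpha> 0 - ?\<mu>) \<le> 3 * \<delta>"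
    proof -
      let ?a = "complex_of_real (measure M A)" and ?b = "complex_of_real (measure M B)"
      let ?f = "\<integral>x. f x \<partial>M" and ?g = "\<integral>x. g x \<partial>M"
      have nb: "norm (?b - ?g) \<le> \<delta>" "norm (?a - ?f) \<le> \<delta>" using bf(2) bg(2) by auto
      have "norm ?g \<le> norm ?b + norm (?b - ?g)" using norm_triangle_ineq4[of ?b "?b - ?g"] by simp
      moreover have "norm ?b = measure M B" by simp
      ultimately have g2: "norm ?g \<le> 2" using nb \<delta> prob_le_1[of B] by linarith
      have alg: "F * cnj G - a * b = (F - a) * cnj G + a * cnj (G - b)" if "cnj b = b" for F G a b :: complex
        using that by (simp add: left_diff_distrib right_diff_distrib)
      have "\<alpha> 0 - ?\<mu> = (?f - ?a) * cnj ?g + ?a * cnj (?g - ?b)"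
        unfolding \<alpha>0 of_real_mult by (rule alg) (rule complex_cnj_complex_of_real)
      then have "norm (\<alpha> 0 - ?\<mu>) \<le> norm (?a - ?f) * norm ?g + norm ?a * norm (?b - ?g)"
        using norm_triangle_ineq[of "(?f - ?a) * cnj ?g" "?a * cnj (?g - ?b)"]
        by (simp only: norm_mult complex_mod_cnj norm_minus_commute)
      also have "\<dots> \<le> \<delta> * 2 + 1 * \<delta>"
        using nb g2 \<delta> prob_le_1[of A] by (intro add_mono mult_mono) auto
      finally show ?thesis by simp
    qed
    moreover have "norm (\<Sum>k. \<alpha> k * of_real (exp (- r\<^sup>2 / 2)) ^ k) \<le> 4 * \<delta>" if r: "0 < r" "r < r0" for r
    proof -
      obtain h where h: "norm h = r"
        "(\<lambda>k. \<alpha> k * of_real (exp (- r\<^sup>2 / 2)) ^ k) sums (\<integral>x. f x * cnj (g (S h x)) \<partial>M)"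
        using sums[OF r(1)] by blast
      have "norm h < r0" using h(1) r(2) by simp
      from disjoint_correlation_bound[OF f(1) g(1) A B \<delta> f(2) g(2) disj[OF this]]
      show ?thesis using sums_unique[OF h(2)] by simp
    qed
    ultimately show ?thesis by blast
  qed
  define P where "P m \<alpha> \<longleftrightarrow> (\<forall>k. norm (\<alpha> k) \<le> 4) \<and> norm (\<alpha> 0 - ?\<mu>) \<le> 3 * inverse (real (Suc m)) \<and>
      (\<forall>r. 0 < r \<longrightarrow> r < r0 \<longrightarrow> norm (\<Sum>k. \<alpha> k * of_real (exp (- r\<^sup>2 / 2)) ^ k) \<le> 4 * inverse (real (Suc m)))"
    for m and \<alpha> :: "nat \<Rightarrow> complex"
  have "\<exists>\<alpha>. P m \<alpha>" for m
    unfolding P_def by (rule step) (auto simp: inverse_le_1_iff)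
  then obtain \<alpha> :: "nat \<Rightarrow> nat \<Rightarrow> complex" where P: "\<And>m. P m (\<alpha> m)"
    by metis
  have \<alpha>: "\<And>m k. norm (\<alpha> m k) \<le> 4"
    "\<And>m. norm (\<alpha> m 0 - ?\<mu>) \<le> 3 * inverse (real (Suc m))"
    "\<And>m r. 0 < r \<Longrightarrow> r < r0 \<Longrightarrow> norm (\<Sum>k. \<alpha> m k * of_real (exp (- r\<^sup>2 / 2)) ^ k) \<le> 4 * inverse (real (Suc m))"
    using P unfolding P_def by blast+
  have null: "(\<lambda>m. c * inverse (real (Suc m))) \<longlonglongrightarrow> 0" for c :: real
    using tendsto_mult_right_zero[OF LIMSEQ_inverse_real_of_nat] by simp
  have "?\<mu> = 0"
  proof (rule bounded_power_series_vanishing[OF \<alpha>(1)])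
    show "exp (- r0\<^sup>2 / 2) < 1" using r0 by simp
    show "(\<lambda>m. \<alpha> m 0) \<longlonglongrightarrow> ?\<mu>"
      by (rule LIM_zero_cancel, rule Lim_null_comparison[OF always_eventually null[of 3]]) (intro allI \<alpha>(2))
    fix \<rho> :: real assume \<rho>: "exp (- r0\<^sup>2 / 2) < \<rho>" "0 < \<rho>" "\<rho> < 1"
    define r where "r = sqrt (- 2 * ln \<rho>)"
    have ln: "ln \<rho> < 0" using \<rho> by simp
    have r2: "r\<^sup>2 = - 2 * ln \<rho>" using ln by (simp add: r_def)
    have r: "0 < r" using ln by (simp add: r_def)
    have "- r0\<^sup>2 / 2 < ln \<rho>" using \<rho> by (metis exp_less_cancel_iff exp_ln)
    then have "r\<^sup>2 < r0\<^sup>2" using r2 by simp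
    then have "r < r0" using r0 by (simp add: power_less_imp_less_base)
    moreover have "exp (- r\<^sup>2 / 2) = \<rho>" using r2 \<rho> by simp
    ultimately have "norm (\<Sum>k. \<alpha> m k * of_real \<rho> ^ k) \<le> 4 * inverse (real (Suc m))" for m
      using \<alpha>(3)[OF r, of m] by simp
    then show "(\<lambda>m. \<Sum>k. \<alpha> m k * of_real \<rho> ^ k) \<longlonglongrightarrow> 0"
      by (intro Lim_null_comparison[OF always_eventually null[of 4]] allI)
  qed
  then show ?thesis by (simp only: of_real_eq_0_iff)
qed

lemma trig_poly_shift_continuous:
  assumes f: "f \<in> trig_polys"
  shows "((\<lambda>h. \<integral>x. (norm (f x - f (S h x)))\<^sup>2 \<partial>M) \<longlongrightarrow> 0) (nhds 0)"
proof -
  obtain N D c \<xi> where fD: "f = (\<lambda>x. \<Sum>i<(N::nat). c i * cis (\<Sum>j<(D::nat). \<xi> i j * x j))"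
    using f by (auto simp: trig_polys_def)
  define e where "e h i x = (\<Sum>j<D. \<xi> i j * x j) - (\<Sum>j<D. \<xi> i j * S h x j)" for h i x
  define \<kappa> where "\<kappa> h i = exp (- (cov_form D 0 (\<xi> i) (\<xi> i) + cov_form D 0 (\<xi> i) (\<xi> i) - 2 * cov_form D h (\<xi> i) (\<xi> i)) / 2)" for h i
  have int_cos: "integrable M (\<lambda>x. cos (e h i x))" "(\<integral>x. cos (e h i x) \<partial>M) = \<kappa> h i" for h i
  proof -
    have i: "integrable M (\<lambda>x. cis (e h i x))" unfolding e_def
      by (intro integrable_cis_M borel_measurable_diff measurable_linear measurable_linear_S)
    from integrable_Re[OF i] show "integrable M (\<lambda>x. cos (e h i x))" by simp
    from integral_Re[OF i] show "(\<integral>x. cos (e h i x) \<partial>M) = \<kappa> h i"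
      unfolding e_def char_mixed \<kappa>_def by simp
  qed
  have pt: "(norm (f x - f (S h x)))\<^sup>2 \<le> real N * (\<Sum>i<N. (norm (c i))\<^sup>2 * (2 - 2 * cos (e h i x)))" for h x
  proof -
    let ?t = "\<lambda>i. cis (\<Sum>j<D. \<xi> i j * x j) - cis (\<Sum>j<D. \<xi> i j * S h x j)"
    have nt: "(norm (?t i))\<^sup>2 = 2 - 2 * cos (e h i x)" for i
    proof -
      have "(norm (cis s - cis t))\<^sup>2 = 2 - 2 * cos (s - t)" for s t
        unfolding cmod_power2 by (simp add: cos_diff power2_diff) (use sin_cos_squared_add[of s] sin_cos_squared_add[of t] in algebra)
      then show ?thesis by (simp add: e_def)
    qed
    have "norm (f x - f (S h x)) = norm (\<Sum>i<N. c i * ?t i)"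
      unfolding fD by (simp add: sum_subtractf right_diff_distrib)
    also have "\<dots> \<le> (\<Sum>i<N. 1 * (norm (c i) * norm (?t i)))"
      by (rule order_trans[OF norm_sum]) (simp add: norm_mult)
    finally have "(norm (f x - f (S h x)))\<^sup>2 \<le> (\<Sum>i<N. 1 * (norm (c i) * norm (?t i)))\<^sup>2"
      by (intro power_mono) auto
    also have "\<dots> \<le> (\<Sum>i<N. 1\<^sup>2) * (\<Sum>i<N. (norm (c i) * norm (?t i))\<^sup>2)"
      by (rule Cauchy_Schwarz_ineq_sum)
    finally show ?thesis by (simp add: power_mult_distrib nt)
  qed
  obtain b where b: "\<And>x. norm (f x) \<le> b" using trig_polys_bounded[OF f] by blast
  note fm = trig_poly_measurable_M[OF f]
  have le: "(\<integral>x. (norm (f x - f (S h x)))\<^sup>2 \<partial>M) \<le> real N * (\<Sum>i<N. (norm (c i))\<^sup>2 * (2 - 2 * \<kappa> h i))" for h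
  proof -
    have "(\<integral>x. (norm (f x - f (S h x)))\<^sup>2 \<partial>M) \<le> (\<integral>x. real N * (\<Sum>i<N. (norm (c i))\<^sup>2 * (2 - 2 * cos (e h i x))) \<partial>M)"
      by (intro integral_mono pt integrable_dist_sq_M[OF fm measurable_S_comp[OF fm] b b] integrable_mult_right
          Bochner_Integration.integrable_sum Bochner_Integration.integrable_diff int_cos) simp
    also have "\<dots> = real N * (\<Sum>i<N. (norm (c i))\<^sup>2 * (2 - 2 * \<kappa> h i))"
      using int_cos by (simp add: Bochner_Integration.integral_sum prob_space[simplified])
    finally show ?thesis .
  qed
  have \<kappa>: "((\<lambda>h. \<kappa> h i) \<longlongrightarrow> 1) (nhds 0)" for i
  proof -
    have "((\<lambda>h. cov_form D h (\<xi> i) (\<xi> i)) \<longlongrightarrow> cov_form D 0 (\<xi> i) (\<xi> i)) (nhds 0)"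
      unfolding cov_form_def by (intro tendsto_intros filterlim_ident)
    then have "((\<lambda>h. \<kappa> h i) \<longlongrightarrow> exp (- (cov_form D 0 (\<xi> i) (\<xi> i) + cov_form D 0 (\<xi> i) (\<xi> i) - 2 * cov_form D 0 (\<xi> i) (\<xi> i)) / 2)) (nhds 0)"
      unfolding \<kappa>_def by (intro tendsto_intros) simp_all
    then show ?thesis by simp
  qed
  have "((\<lambda>h. real N * (\<Sum>i<N. (norm (c i))\<^sup>2 * (2 - 2 * \<kappa> h i))) \<longlongrightarrow> real N * (\<Sum>i<N. (norm (c i))\<^sup>2 * (2 - 2 * 1))) (nhds 0)"
    by (intro tendsto_intros \<kappa>)
  then have "((\<lambda>h. real N * (\<Sum>i<N. (norm (c i))\<^sup>2 * (2 - 2 * \<kappa> h i))) \<longlongrightarrow> 0) (nhds 0)" by simp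
  then show ?thesis
    by (rule tendsto_sandwich[rotated 3, where f = "\<lambda>_. 0"]) (auto intro!: always_eventually le)
qed

text \<open>
  For trigonometric polynomials in place of indicators this is continuity of the covariance; the error
  of the approximation does not grow under the shift because the shift preserves \<open>M\<close>.
\<close>

theorem measure_shift_continuous:
  assumes A: "A \<in> sets M" and \<epsilon>: "\<epsilon> > 0"
  shows "\<forall>\<^sub>F h in nhds 0. measure M (sym_diff A (S h -` A)) < \<epsilon>"
proof -
  have e12: "\<epsilon>/12 > 0" using \<epsilon> by simp
  then obtain f where f: "f \<in> trig_polys" "(\<integral>x. (norm (indicator A x - f x))\<^sup>2 \<partial>M) < \<epsilon>/12"
    using trig_polys_L2_dense[OF finite_measure_axioms sets_M A] by blast
  obtain b where b: "\<And>x. norm (f x) \<le> b" using trig_polys_bounded[OF f(1)] by blast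
  note fm = trig_poly_measurable_M[OF f(1)] and Am = indicator_measurable_M[OF A]
  have "\<forall>\<^sub>F h in nhds 0. (\<integral>x. (norm (f x - f (S h x)))\<^sup>2 \<partial>M) < \<epsilon>/12"
    by (rule order_tendstoD(2)[OF trig_poly_shift_continuous[OF f(1)] e12])
  then show ?thesis
  proof eventually_elim
    case (elim h)
    define u where "u x = (norm (indicator A x - f x))\<^sup>2" for x
    define w where "w x = (norm (f x - f (S h x)))\<^sup>2" for x
    have um: "u \<in> borel_measurable M" unfolding u_def by (rule measurable_dist_sq[OF Am fm])
    have iu: "integrable M u" unfolding u_def by (rule integrable_dist_sq_M[OF Am fm norm_indicator_le b])
    have iuS: "integrable M (\<lambda>x. u (S h x))" unfolding u_def
      by (rule integrable_dist_sq_M[OF measurable_S_comp[OF Am] measurable_S_comp[OF fm] norm_indicator_le b])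
    have iw: "integrable M w" unfolding w_def by (rule integrable_dist_sq_M[OF fm measurable_S_comp[OF fm] b b])
    have vim: "S h -` A \<in> sets M" using measurable_sets[OF measurable_S A, of h] by simp
    have sd: "sym_diff A (S h -` A) \<in> sets M" using A vim by auto
    have "measure M (sym_diff A (S h -` A)) = (\<integral>x. indicator (sym_diff A (S h -` A)) x \<partial>M)"
      using sd by simp
    also have "\<dots> \<le> (\<integral>x. 2 * u x + (4 * w x + 4 * u (S h x)) \<partial>M)"
    proof (intro integral_mono Bochner_Integration.integrable_add integrable_mult_right iu iuS iw)
      show "integrable M (\<lambda>x. indicator (sym_diff A (S h -` A)) x :: real)"
        using sd by (simp add: emeasure_finite less_top[symmetric])
      fix x
      let ?a = "indicator A x :: complex" and ?b = "indicator A (S h x) :: complex"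
      have "indicator (sym_diff A (S h -` A)) x = (norm (?a - ?b))\<^sup>2"
        by (auto simp: indicator_def)
      also have "\<dots> \<le> 2 * (norm (?a - f x))\<^sup>2 + 2 * (norm (f x - ?b))\<^sup>2"
        using norm_add_sq_le[of "?a - f x" "f x - ?b"] by simp
      also have "\<dots> \<le> 2 * u x + 2 * (2 * w x + 2 * u (S h x))"
        using norm_add_sq_le[of "f x - f (S h x)" "f (S h x) - ?b"]
        unfolding u_def w_def by (simp add: norm_minus_commute)
      finally show "indicator (sym_diff A (S h -` A)) x \<le> 2 * u x + (4 * w x + 4 * u (S h x))" by simp
    qed
    also have "\<dots> = 2 * (\<integral>x. u x \<partial>M) + (4 * (\<integral>x. w x \<partial>M) + 4 * (\<integral>x. u x \<partial>M))"
      using iu iuS iw integral_S[OF um, of h] by simp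
    also have "\<dots> < \<epsilon>" using elim f(2) \<epsilon> unfolding u_def w_def by linarith
    finally show ?case .
  qed
qed

text \<open>
  An everywhere bijective version of the shift.
\<close>

definition R :: "'h \<Rightarrow> (nat \<Rightarrow> real) \<Rightarrow> nat \<Rightarrow> real" where
  "R h = (SOME R. R \<in> inv_mpt M \<and> (AE x in M. R x = S h x))"

lemma R: "R h \<in> inv_mpt M" "AE x in M. R h x = S h x"
proof -
  have inv: "AE x in M. S (- h) (S h x) = x" for h
    using AE_S_add[of "- h" h] AE_S_0 by eventually_elim simp
  have inv': "AE x in M. S h (S (- h) x) = x" using inv[of "- h"] by simp
  obtain T where "T \<in> inv_mpt M" "AE x in M. T x = S h x"
    by (rule inv_mpt_modification[OF measurable_S distr_S measurable_S distr_S inv inv'])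
  then have "\<exists>R. R \<in> inv_mpt M \<and> (AE x in M. R x = S h x)" by blast
  then have "R h \<in> inv_mpt M \<and> (AE x in M. R h x = S h x)"
    unfolding R_def by (rule someI_ex)
  then show "R h \<in> inv_mpt M" "AE x in M. R h x = S h x" by auto
qed

lemma AE_R_add: "AE x in M. R (g + h) x = R g (R h x)"
  using R(2)[of "g + h"] AE_inv_mpt[OF R(1)[of h] R(2)[of g]] R(2)[of h] AE_S_add[of g h]
  by eventually_elim simp

lemma AE_R_image:
  assumes "A \<in> sets M"
  shows "AE x in M. x \<in> R h ` A \<longleftrightarrow> S (- h) x \<in> A"
proof -
  let ?g = "the_inv_into (space M) (R h)"
  have "AE x in M. R h (S (- h) x) = S h (S (- h) x)" by (rule AE_S[OF R(2)])
  then show ?thesis using AE_S_add[of h "- h"] AE_S_0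
  proof eventually_elim
    case (elim x)
    then have "R h (S (- h) x) = x" by simp
    then have "?g x = S (- h) x"
      using inv_mptD(1)[OF R(1)[of h]] by (intro the_inv_into_f_eq) (auto simp: bij_betw_def)
    then show ?case
      using assms by (simp add: inv_mpt_image_eq_vimage[OF R(1)])
  qed
qed

definition shift_action :: "'h \<Rightarrow> ((nat \<Rightarrow> real) \<Rightarrow> nat \<Rightarrow> real) set" where
  "shift_action h = aut_class M (R h)"

theorem near_action_shift: "near_action M shift_action"
  unfolding shift_action_def
proof (rule near_actionI)
  fix A \<epsilon> assume A: "A \<in> sets M" and "(\<epsilon>::real) > 0"
  have "((\<lambda>h. - h) \<longlongrightarrow> (- 0 :: 'h)) (nhds 0)" by (intro tendsto_minus filterlim_ident)
  then have "filterlim (\<lambda>h. - h) (nhds 0) (nhds (0 :: 'h))" by simp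
  from eventually_compose_filterlim[OF measure_shift_continuous[OF A \<open>\<epsilon> > 0\<close>] this]
  show "\<forall>\<^sub>F h in nhds 0. measure M (sym_diff A (R h ` A)) < \<epsilon>"
  proof eventually_elim
    case (elim h)
    have vim: "S (- h) -` A \<in> sets M" using measurable_sets[OF measurable_S A] by simp
    have "measure M (sym_diff A (R h ` A)) = measure M (sym_diff A (S (- h) -` A))"
    proof (rule measure_eq_AE)
      show "AE x in M. x \<in> sym_diff A (R h ` A) \<longleftrightarrow> x \<in> sym_diff A (S (- h) -` A)"
        using AE_R_image[OF A, of h] by eventually_elim auto
    qed (use A vim inv_mpt_image_sets[OF R(1) A] in auto)
    then show ?case using elim by simp
  qed
qed (simp_all add: finite_measure_axioms R(1) AE_R_add)

theorem faithful_shift: "faithful shift_action"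
  unfolding faithful_def shift_action_def
proof (rule injI)
  fix g h assume "aut_class M (R g) = aut_class M (R h)"
  then have "AE x in M. R g x = R h x" by (simp add: aut_class_eq_iff[OF R(1)])
  then have "AE x in M. S g x = S h x" using R(2)[of g] R(2)[of h] by eventually_elim simp
  then show "g = h" by (rule AE_S_eqD)
qed

theorem whirly_shift:
  assumes orth: "\<And>F::'h set. finite F \<Longrightarrow> \<exists>u. norm u = 1 \<and> (\<forall>v\<in>F. u \<bullet> v = 0)"
  shows "whirly M shift_action"
  unfolding whirly_def
proof (intro ballI impI allI)
  fix A B and U :: "'h set"
  assume A: "A \<in> sets M" and B: "B \<in> sets M" and pos: "measure M A > 0" "measure M B > 0"
    and U: "open U" "0 \<in> U"
  obtain r0 where r0: "r0 > 0" "ball 0 r0 \<subseteq> U" using U open_contains_ball by blast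
  show "\<exists>g\<in>U. measure M (A \<inter> aut_image (shift_action g) B) > 0"
  proof (rule ccontr)
    assume none: "\<not> (\<exists>g\<in>U. measure M (A \<inter> aut_image (shift_action g) B) > 0)"
    have "AE x in M. \<not> (x \<in> A \<and> S h x \<in> B)" if h: "norm h < r0" for h
    proof -
      have "- h \<in> U" using r0 h by auto
      with none have "\<not> measure M (A \<inter> aut_image (shift_action (- h)) B) > 0" by blast
      then have "measure M (A \<inter> aut_image (shift_action (- h)) B) = 0"
        using measure_nonneg[of M "A \<inter> aut_image (shift_action (- h)) B"] by linarith
      moreover have s: "A \<inter> aut_image (shift_action (- h)) B \<in> sets M"
        using A aut_image_sets[OF R(1) B] by (auto simp: shift_action_def)
      ultimately have "A \<inter> aut_image (shift_action (- h)) B \<in> null_sets M"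
        by (auto simp: emeasure_eq_measure)
      then have "AE x in M. x \<notin> A \<inter> aut_image (shift_action (- h)) B" by (rule AE_not_in)
      moreover have "AE x in M. x \<in> aut_image (shift_action (- h)) B \<longleftrightarrow> x \<in> R (- h) ` B"
        unfolding shift_action_def by (rule aut_image_AE[OF R(1)]) simp
      ultimately show ?thesis using AE_R_image[OF B, of "- h"] by eventually_elim auto
    qed
    from whirly_core[OF A B r0(1) orth this] pos show False by simp
  qed
qed

end

section \<open>Standard Lebesgue spaces on real sequences\<close>

text \<open>
  On an atom, \<open>f\<close> is almost everywhere on one side of each rational number, hence almost everywhere
  constant.
\<close>

lemma nonatomicI:
  fixes f :: "'a \<Rightarrow> real"
  assumes M: "finite_measure M" and f [measurable]: "f \<in> borel_measurable M"
    and null: "\<And>t. measure M {x \<in> space M. f x = t} = 0"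
  shows "nonatomic M"
  unfolding nonatomic_def
proof
  interpret finite_measure M by fact
  assume "\<exists>A\<in>sets M. measure M A > 0 \<and> (\<forall>B\<in>sets M. B \<subseteq> A \<longrightarrow> measure M B = 0 \<or> measure M B = measure M A)"
  then obtain A where A [measurable]: "A \<in> sets M" and pos: "measure M A > 0"
    and atom: "\<And>B. B \<in> sets M \<Longrightarrow> B \<subseteq> A \<Longrightarrow> measure M B = 0 \<or> measure M B = measure M A" by blast
  define L where "L q = {x \<in> space M. x \<in> A \<and> f x \<le> q}" for q
  define G where "G q = {x \<in> space M. x \<in> A \<and> \<not> f x \<le> q}" for q
  have LG [measurable]: "L q \<in> sets M" "G q \<in> sets M" for q unfolding L_def G_def by measurable
  have mem: "x \<in> L q \<longleftrightarrow> x \<in> space M \<and> x \<in> A \<and> f x \<le> q" "x \<in> G q \<longleftrightarrow> x \<in> space M \<and> x \<in> A \<and> \<not> f x \<le> q" for x q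
    by (auto simp: L_def G_def)
  have AE_q: "AE x in M. x \<in> A \<longrightarrow> (if measure M (L q) = 0 then q < f x else f x \<le> q)" for q
  proof (cases "measure M (L q) = 0")
    case True
    then have "L q \<in> null_sets M" by (simp add: LG null_sets_def emeasure_eq_measure)
    then have "AE x in M. x \<notin> L q" by (rule AE_not_in)
    then show ?thesis using AE_space by eventually_elim (auto simp: mem True)
  next
    case False
    have "L q \<union> G q = A" "L q \<inter> G q = {}" using sets.sets_into_space[OF A] by (auto simp: mem)
    then have "measure M A = measure M (L q) + measure M (G q)"
      using finite_measure_Union[OF LG] by metis
    moreover have "measure M (L q) = measure M A" using atom[OF LG(1), of q] False mem(1) by blast
    ultimately have "G q \<in> null_sets M" by (simp add: LG null_sets_def emeasure_eq_measure)
    then have "AE x in M. x \<notin> G q" by (rule AE_not_in)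
    then show ?thesis using AE_space by eventually_elim (auto simp: mem False)
  qed
  have "AE x in M. \<forall>q::rat. x \<in> A \<longrightarrow> (if measure M (L (of_rat q)) = 0 then of_rat q < f x else f x \<le> of_rat q)"
    unfolding AE_all_countable by (intro allI AE_q)
  then obtain N where N: "N \<in> null_sets M"
    "\<And>x q. x \<in> space M \<Longrightarrow> x \<notin> N \<Longrightarrow> x \<in> A \<Longrightarrow> (if measure M (L (of_rat q)) = 0 then of_rat q < f x else f x \<le> of_rat q)"
    by (elim AE_E3) blast
  have le: "f y \<le> f x" if "x \<in> A - N" "y \<in> A - N" for x y
  proof (rule ccontr)
    assume "\<not> f y \<le> f x"
    then obtain q :: rat where q: "f x < of_rat q" "of_rat q < f y" using of_rat_dense[of "f x" "f y"] by auto
    have "x \<in> space M" "y \<in> space M" using that sets.sets_into_space[OF A] by auto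
    then show False using N(2)[of x q] N(2)[of y q] that q by (auto split: if_splits)
  qed
  have "measure M (A - N) = measure M A"
    using measure_Diff_null_set[OF A N(1)] by simp
  then obtain x0 where x0: "x0 \<in> A - N" using pos by (metis all_not_in_conv less_irrefl measure_empty)
  have "A - N \<subseteq> {x \<in> space M. f x = f x0}"
    using le[OF x0] le[OF _ x0] sets.sets_into_space[OF A] by (auto intro: antisym)
  then have "measure M (A - N) \<le> measure M {x \<in> space M. f x = f x0}"
    by (intro finite_measure_mono) measurable
  then show False using null pos \<open>measure M (A - N) = measure M A\<close> by simp
qed

lemma standard_lebesgue_spaceI:
  fixes M :: "(nat \<Rightarrow> real) measure"
  assumes "prob_space M" "sets M = sets borel" "\<And>t. measure M {x. x 0 = t} = 0"
  shows "standard_lebesgue_space M"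
proof -
  interpret prob_space M by fact
  have sp: "space M = UNIV" using sets_eq_imp_space_eq[OF assms(2)] by simp
  have "second_countable (euclidean :: (nat \<Rightarrow> real) topology)"
  proof -
    obtain B :: "(nat \<Rightarrow> real) set set" where B: "countable B" "topological_basis B"
      using ex_countable_basis by blast
    show ?thesis
      unfolding second_countable_def
    proof (intro exI[of _ B] conjI ballI allI impI)
      show "openin euclidean V" if "V \<in> B" for V using topological_basis_open[OF B(2) that] by simp
      fix U and x :: "nat \<Rightarrow> real" assume "openin euclidean U \<and> x \<in> U"
      then have "open U" "x \<in> U" by auto
      then show "\<exists>V\<in>B. x \<in> V \<and> V \<subseteq> U" using topological_basisE[OF B(2)] by metis
    qed (rule B(1))
  qed
  then have "standard_borel_space M"
    unfolding standard_borel_space_def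
    by (intro exI[of _ euclidean]) (simp add: completely_metrizable_space_euclidean sp assms(2) sets_borel)
  moreover have "nonatomic M"
  proof (rule nonatomicI[OF finite_measure_axioms])
    show "(\<lambda>x. x 0) \<in> borel_measurable M"
      using measurable_component_borel[of 0] measurable_cong_sets[OF assms(2) refl] by blast
  qed (simp add: sp assms(3))
  ultimately show ?thesis using assms(1) by (simp add: standard_lebesgue_space_def)
qed

lemma (in stationary_gaussian) standard_lebesgue_space_M: "standard_lebesgue_space M"
proof (rule standard_lebesgue_spaceI[OF prob_space_axioms sets_M])
  fix t :: real
  have m: "(\<lambda>x. x 0) \<in> borel_measurable M"
    using measurable_component_borel[of 0] measurable_cong_sets[OF sets_M refl] by blast
  let ?N = "distr M borel (\<lambda>x. x 0)"
  have "?N = std_normal_distribution"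
  proof (rule Levy_uniqueness)
    show "real_distribution ?N" by (rule real_distribution_distr[OF m])
    show "char ?N = char std_normal_distribution"
    proof
      fix s
      have "char ?N s = (\<integral>x. cis (\<Sum>j<1. s * x j) \<partial>M)"
        unfolding char_def cis_conv_exp by (subst integral_distr[OF m]) simp_all
      also have "\<dots> = of_real (exp (- (s\<^sup>2) / 2))"
        using char_M[of "\<lambda>_. s" 1] by (simp add: power2_eq_square)
      finally show "char ?N s = char std_normal_distribution s"
        by (simp add: char_std_normal_distribution)
    qed
  qed (rule real_dist_normal_dist)
  then have "emeasure ?N {t} = emeasure std_normal_distribution {t}" by simp
  also have "\<dots> = 0"
    by (subst emeasure_density) (auto intro!: nn_integral_null_set)
  also have "emeasure ?N {t} = emeasure M {x. x 0 = t}"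
    by (subst emeasure_distr[OF m]) (auto intro!: arg_cong[where f = "emeasure M"])
  finally show "measure M {x. x 0 = t} = 0" by (simp add: measure_def)
qed

section \<open>A spatial action by rotations of a product of circles\<close>

text \<open>
  The real line stands in for the circle: rotation acts on \<open>[0, 1)\<close>, which carries the measure, and
  fixes all other points. This keeps the underlying space equal to that of all real sequences.
\<close>

definition rot :: "real \<Rightarrow> real \<Rightarrow> real" where
  "rot t y = (if 0 \<le> y \<and> y < 1 then frac (y + t) else y)"

lemma frac_diff_of_int: "frac (x - of_int k) = frac x"
  by (simp add: frac_def)

lemma rot_0: "rot 0 y = y"
  by (simp add: rot_def frac_eq)

lemma rot_add: "rot s (rot t y) = rot (s + t) y"
proof (cases "0 \<le> y \<and> y < 1")
  case True
  have "frac (frac (y + t) + s) = frac (y + t + s - of_int \<lfloor>y + t\<rfloor>)"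
    by (simp add: frac_def algebra_simps)
  then have "frac (frac (y + t) + s) = frac (y + t + s)"
    by (simp only: frac_diff_of_int)
  then show ?thesis using True by (simp add: rot_def frac_lt_1 ac_simps)
qed (auto simp: rot_def)

abbreviation circle_measure :: "real measure" where
  "circle_measure \<equiv> uniform_measure lborel {0..<1}"

lemma emeasure_lborel_translate:
  assumes "B \<in> sets borel"
  shows "emeasure lborel {y :: real. y + c \<in> B} = emeasure lborel B"
proof -
  have "emeasure lborel B = emeasure (distr lborel borel ((+) c)) B" by (simp only: lborel_distr_plus)
  also have "\<dots> = emeasure lborel {y. y + c \<in> B}"
    using assms by (subst emeasure_distr) (auto intro!: arg_cong[where f = "emeasure lborel"] simp: add.commute)
  finally show ?thesis ..
qed

lemma measurable_rot_pair: "(\<lambda>p. rot (fst p) (snd p)) \<in> borel_measurable (borel \<Otimes>\<^sub>M borel)"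
  unfolding rot_def frac_def by measurable

lemma measurable_rot: "rot t \<in> borel_measurable borel"
  unfolding rot_def[abs_def] frac_def by measurable

text \<open>
  With \<open>s = frac t\<close>, the rotation translates \<open>[0, 1 - s)\<close> by \<open>s\<close> and \<open>[1 - s, 1)\<close> by \<open>s - 1\<close>.
\<close>

lemma emeasure_circle_rot:
  assumes A: "A \<in> sets borel"
  shows "emeasure circle_measure (rot t -` A) = emeasure circle_measure A"
proof -
  define s where "s = frac t"
  have s: "0 \<le> s" "s < 1" by (auto simp: s_def frac_lt_1)
  have rot: "rot t y = (if y + s < 1 then y + s else y + (s - 1))" if "0 \<le> y" "y < 1" for y
  proof -
    have "y + t = y + s + of_int \<lfloor>t\<rfloor>" by (simp add: s_def frac_def)
    then have "y + s = y + t - of_int \<lfloor>t\<rfloor>" by simp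
    then have "frac (y + t) = frac (y + s)" by (simp only: frac_diff_of_int)
    also have "\<dots> = (if y + s < 1 then y + s else y + (s - 1))"
    proof (cases "y + s < 1")
      case True
      then show ?thesis using that s by (simp add: frac_eq)
    next
      case False
      then have "frac (y + s - of_int 1) = y + s - of_int 1" unfolding frac_eq using that s by auto
      then show ?thesis using False frac_diff_of_int[of "y + s" 1] by simp
    qed
    finally show ?thesis using that by (simp add: rot_def)
  qed
  have vim: "rot t -` A \<in> sets borel" using measurable_sets[OF measurable_rot A, of t] by simp
  have split: "{0..<1} \<inter> rot t -` A = {y. y + s \<in> A \<inter> {s..<1}} \<union> {y. y + (s - 1) \<in> A \<inter> {0..<s}}"
    using s by (auto simp: rot split: if_splits)
  have m: "{y. y + s \<in> A \<inter> {s..<1}} \<in> sets borel" "{y. y + (s - 1) \<in> A \<inter> {0..<s}} \<in> sets borel"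
  proof -
    have "(\<lambda>y. y + c) -` B \<in> sets borel" if "B \<in> sets borel" for c :: real and B
      using measurable_sets[of "\<lambda>y. y + c" borel borel B] that by simp
    then show "{y. y + s \<in> A \<inter> {s..<1}} \<in> sets borel" "{y. y + (s - 1) \<in> A \<inter> {0..<s}} \<in> sets borel"
      using A by (auto simp: vimage_def)
  qed
  have "emeasure lborel ({0..<1} \<inter> rot t -` A) =
      emeasure lborel {y. y + s \<in> A \<inter> {s..<1}} + emeasure lborel {y. y + (s - 1) \<in> A \<inter> {0..<s}}"
    unfolding split using m by (subst plus_emeasure) auto
  also have "\<dots> = emeasure lborel (A \<inter> {s..<1}) + emeasure lborel (A \<inter> {0..<s})"
    using A by (intro arg_cong2[where f = "(+)"] emeasure_lborel_translate) auto
  also have "\<dots> = emeasure lborel ((A \<inter> {s..<1}) \<union> (A \<inter> {0..<s}))"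
    using A by (intro plus_emeasure) auto
  also have "(A \<inter> {s..<1}) \<union> (A \<inter> {0..<s}) = {0..<1} \<inter> A" using s by auto
  finally show ?thesis using A vim by simp
qed

lemma prob_space_circle: "prob_space circle_measure"
  by (rule prob_space_uniform_measure) auto

lemma spatial_action_inv_mpt:
  assumes a: "spatial_action M a"
  shows "a g \<in> inv_mpt M"
proof -
  have m: "a g \<in> measurable M M" for g
  proof -
    have "(\<lambda>(g, x). a g x) \<circ> Pair g \<in> measurable M M"
      using a by (intro measurable_comp[OF measurable_Pair1']) (auto simp: spatial_action_def)
    then show ?thesis by (simp add: comp_def)
  qed
  have inv: "a (- g) (a g x) = x" if "x \<in> space M" for g x
    using a that by (simp add: spatial_action_def)
  have sp: "a g x \<in> space M" if "x \<in> space M" for g x using measurable_space[OF m that] .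
  have inv': "a g (a (- g) x) = x" if "x \<in> space M" for x using inv[OF that, of "- g"] by simp
  have bij: "bij_betw (a g) (space M) (space M)"
    by (rule bij_betwI[where g = "a (- g)"]) (auto simp: sp inv inv')
  have "the_inv_into (space M) (a g) x = a (- g) x" if "x \<in> space M" for x
    using bij sp[OF that] inv'[OF that] by (intro the_inv_into_f_eq) (auto simp: bij_betw_def)
  then have "the_inv_into (space M) (a g) \<in> measurable M M"
    using m[of "- g"] by (subst measurable_cong[where g = "a (- g)"]) auto
  then show ?thesis using bij m a by (simp add: inv_mpt_def spatial_action_def)
qed

theorem spatial_action_exists:
  obtains M :: "(nat \<Rightarrow> real) measure" and a :: "'h::{real_inner, second_countable_topology} \<Rightarrow> (nat \<Rightarrow> real) \<Rightarrow> nat \<Rightarrow> real"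
  where "standard_lebesgue_space M" "spatial_action M a" "faithful (induced_near_action M a)"
proof -
  obtain d :: "nat \<Rightarrow> 'h" where d: "\<And>U. open U \<Longrightarrow> U \<noteq> {} \<Longrightarrow> \<exists>n. d n \<in> U"
    by (rule second_countable_dense_sequence) (rule that; assumption)
  interpret P: product_prob_space "\<lambda>_::nat. circle_measure" UNIV
    using prob_space_circle by (simp add: product_prob_spaceI)
  define M where "M = PiM (UNIV :: nat set) (\<lambda>_. circle_measure)"
  interpret M: prob_space M unfolding M_def by (rule P.prob_space_axioms)
  have sets_M [measurable_cong]: "sets M = sets borel"
  proof -
    have "sets M = sets (PiM UNIV (\<lambda>_::nat. borel :: real measure))"
      unfolding M_def by (rule sets_PiM_cong) auto
    then show ?thesis by (simp add: sets_PiM_equal_borel)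
  qed
  have space_M: "space M = UNIV" using sets_eq_imp_space_eq[OF sets_M] by simp
  define a where "a h x n = rot (h \<bullet> d n) (x n)" for h :: 'h and x :: "nat \<Rightarrow> real" and n :: nat
  have coord: "(\<lambda>x. x n) \<in> borel_measurable M" for n
    using measurable_component_borel[of n] measurable_cong_sets[OF sets_M refl] by blast
  have meas: "(\<lambda>p. a (fst p) (snd p)) \<in> measurable (borel \<Otimes>\<^sub>M M) M"
  proof -
    have "(\<lambda>p. a (fst p) (snd p)) \<in> borel_measurable (borel \<Otimes>\<^sub>M M)"
    proof (rule measurable_coordinatewise_then_product)
      fix n
      have "(\<lambda>h. h \<bullet> d n) \<in> borel_measurable borel"
        by (intro borel_measurable_continuous_onI continuous_intros)
      then have "(\<lambda>p. (fst p \<bullet> d n, snd p n)) \<in> measurable (borel \<Otimes>\<^sub>M M) (borel \<Otimes>\<^sub>M borel)"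
        by (intro measurable_Pair measurable_compose[OF measurable_fst] measurable_compose[OF measurable_snd coord])
      from measurable_compose[OF this measurable_rot_pair]
      show "(\<lambda>p. a (fst p) (snd p) n) \<in> borel_measurable (borel \<Otimes>\<^sub>M M)"
        by (simp add: a_def)
    qed
    then show ?thesis using measurable_cong_sets[OF refl sets_M] by blast
  qed
  have am: "a h \<in> measurable M M" for h
    using measurable_comp[OF measurable_Pair1'[of h borel M] meas] by (simp add: comp_def)
  have distr: "distr M M (a h) = M" for h
  proof (rule sym, rule measure_eqI_PiM_infinite[where I = UNIV and M = "\<lambda>_. circle_measure"])
    show "sets M = sets (PiM UNIV (\<lambda>_::nat. circle_measure))" by (simp add: M_def)
    then show "sets (distr M M (a h)) = sets (PiM UNIV (\<lambda>_::nat. circle_measure))" by simp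
    fix A :: "nat \<Rightarrow> real set" and J :: "nat set"
    assume J: "finite J" and A: "\<And>i. i \<in> J \<Longrightarrow> A i \<in> sets circle_measure"
    let ?emb = "\<lambda>A. prod_emb UNIV (\<lambda>_::nat. circle_measure) J (PiE J A)"
    have emb: "?emb A = {x. \<forall>j\<in>J. x j \<in> A j}" for A :: "nat \<Rightarrow> real set"
      by (auto simp: prod_emb_def space_PiM PiE_iff)
    have emeasure_emb: "emeasure M (?emb A) = (\<Prod>j\<in>J. emeasure circle_measure (A j))"
      if "\<And>j. j \<in> J \<Longrightarrow> A j \<in> sets borel" for A
      unfolding M_def using J that by (intro P.emeasure_PiM_emb) auto
    have "?emb A \<in> sets M" unfolding M_def using J A by (intro sets_PiM_I) auto
    then have "emeasure (distr M M (a h)) (?emb A) = emeasure M (?emb (\<lambda>j. rot (h \<bullet> d j) -` A j))"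
      by (subst emeasure_distr[OF am]) (auto simp: emb a_def space_M intro!: arg_cong[where f = "emeasure M"])
    also have "\<dots> = (\<Prod>j\<in>J. emeasure circle_measure (rot (h \<bullet> d j) -` A j))"
      using A measurable_sets[OF measurable_rot] by (intro emeasure_emb) fastforce
    also have "\<dots> = (\<Prod>j\<in>J. emeasure circle_measure (A j))"
      using A by (intro prod.cong refl emeasure_circle_rot) auto
    also have "\<dots> = emeasure M (?emb A)" using A by (intro emeasure_emb[symmetric]) auto
    finally show "emeasure M (?emb A) = emeasure (distr M M (a h)) (?emb A)" ..
  qed (rule M.finite_measure_axioms)
  have spatial: "spatial_action M a"
    unfolding spatial_action_def
    using meas distr by (auto simp: a_def rot_0 rot_add inner_add_left case_prod_beta)
  have faithful: "faithful (induced_near_action M a)"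
    unfolding faithful_def induced_near_action_def
  proof (rule injI)
    fix g h assume "aut_class M (a g) = aut_class M (a h)"
    then have "AE x in M. a g x = a h x"
      using aut_class_eq_iff[OF spatial_action_inv_mpt[OF spatial]] by blast
    moreover have "AE x in M. \<forall>n. 0 \<le> x n \<and> x n < 1"
      unfolding AE_all_countable
    proof
      fix n
      have "AE y in circle_measure. 0 \<le> y \<and> y < 1"
        by (rule AE_uniform_measureI) auto
      then show "AE x in M. 0 \<le> x n \<and> x n < 1"
        unfolding M_def by (intro AE_PiM_component prob_space_circle) auto
    qed
    ultimately have "AE x in M. a g x = a h x \<and> (\<forall>n. 0 \<le> x n \<and> x n < 1)" by eventually_elim simp
    then obtain x where x: "a g x = a h x" "\<And>n. 0 \<le> x n \<and> x n < 1"
      using eventually_happens'[OF M.ae_filter_bot] by blast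
    have int: "(g - h) \<bullet> d n \<in> \<int>" for n
    proof -
      have "frac (x n + g \<bullet> d n) = frac (x n + h \<bullet> d n)"
        using fun_cong[OF x(1), of n] x(2)[of n] by (simp add: a_def rot_def)
      then have "(g - h) \<bullet> d n = of_int (\<lfloor>x n + g \<bullet> d n\<rfloor> - \<lfloor>x n + h \<bullet> d n\<rfloor>)"
        by (simp add: frac_def inner_diff_left)
      then show ?thesis by (metis Ints_of_int)
    qed
    \<comment> \<open>The integers are closed and the points \<open>d n\<close> are dense.\<close>
    have all_int: "(g - h) \<bullet> v \<in> \<int>" for v
    proof (rule ccontr)
      assume v: "(g - h) \<bullet> v \<notin> \<int>"
      have "open ((\<lambda>v. (g - h) \<bullet> v) -` (- \<int>))"
        by (intro open_vimage continuous_intros) (simp add: open_Compl closed_Ints)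
      from d[OF this] v obtain n where "(g - h) \<bullet> d n \<notin> \<int>" by auto
      then show False using int by blast
    qed
    show "g = h"
    proof (rule ccontr)
      assume "g \<noteq> h"
      then have ne: "(g - h) \<bullet> (g - h) \<noteq> 0" by simp
      have "(g - h) \<bullet> ((1 / (2 * ((g - h) \<bullet> (g - h)))) *\<^sub>R (g - h)) = 1/2"
        using ne by (simp only: inner_scaleR_right) (simp add: field_simps)
      then have "(1/2 :: real) \<in> \<int>" using all_int by metis
      then obtain k where "(1/2 :: real) = of_int k" by (rule Ints_cases)
      then have "2 * k = 1" by linarith
      then show False by presburger
    qed
  qed
  have "standard_lebesgue_space M"
  proof (rule standard_lebesgue_spaceI[OF M.prob_space_axioms sets_M])
    fix t :: real
    have "emeasure M {x. x 0 = t} = emeasure circle_measure {t}"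
      using P.emeasure_PiM_Collect_single[of 0 "{t}"] space_M by (simp add: M_def)
    also have "\<dots> = 0"
    proof -
      have "{0..<1} \<inter> {t} \<in> null_sets lborel"
        by (rule null_sets_subset[of "{t}"]) auto
      then show ?thesis by (simp add: null_sets_def)
    qed
    finally show "measure M {x. x 0 = t} = 0" by (simp add: measure_def)
  qed
  then show ?thesis using spatial faithful by (rule that)
qed

section \<open>Faithful spatial and whirly actions of a Hilbert space\<close>

theorem mainTheorem7:
  assumes infinite_dim: "\<nexists>B :: 'h::{real_inner, polish_space} set. finite B \<and> span B = UNIV"
  shows "(\<exists>(M :: (nat \<Rightarrow> real) measure) (a :: 'h \<Rightarrow> (nat \<Rightarrow> real) \<Rightarrow> (nat \<Rightarrow> real)).
            standard_lebesgue_space M \<and> spatial_action M a \<and> faithful (induced_near_action M a))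
       \<and> (\<exists>(M :: (nat \<Rightarrow> real) measure) (\<phi> :: 'h \<Rightarrow> ((nat \<Rightarrow> real) \<Rightarrow> (nat \<Rightarrow> real)) set).
            standard_lebesgue_space M \<and> near_action M \<phi> \<and> faithful \<phi> \<and> whirly M \<phi>)"
proof
  show "\<exists>(M :: (nat \<Rightarrow> real) measure) (a :: 'h \<Rightarrow> (nat \<Rightarrow> real) \<Rightarrow> (nat \<Rightarrow> real)).
      standard_lebesgue_space M \<and> spatial_action M a \<and> faithful (induced_near_action M a)"
    by (rule spatial_action_exists) blast
  obtain d :: "nat \<Rightarrow> 'h" where d: "\<And>U. open U \<Longrightarrow> U \<noteq> {} \<Longrightarrow> \<exists>n. d n \<in> U"
    by (rule second_countable_dense_sequence) (rule that; assumption)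
  obtain M :: "(nat \<Rightarrow> real) measure" where M: "prob_space M" "sets M = sets borel"
    "\<And>(D::nat) \<xi>. (\<integral>x. cis (\<Sum>n<D. \<xi> n * x n) \<partial>M) =
       of_real (exp (- (\<Sum>n<D. \<Sum>m<D. \<xi> n * \<xi> m * gauss_cov (d n - d m)) / 2))"
    by (rule gaussian_process_exists[OF psd_kernel_gauss_cov[of d]]) (rule that; assumption)
  interpret stationary_gaussian M d
    using M d by (simp add: stationary_gaussian_def stationary_gaussian_axioms_def)
  have "whirly M shift_action"
    by (rule whirly_shift) (rule infinite_dim_orthogonal_vector[OF infinite_dim])
  then show "\<exists>(M :: (nat \<Rightarrow> real) measure) (\<phi> :: 'h \<Rightarrow> ((nat \<Rightarrow> real) \<Rightarrow> (nat \<Rightarrow> real)) set).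
      standard_lebesgue_space M \<and> near_action M \<phi> \<and> faithful \<phi> \<and> whirly M \<phi>"
    using standard_lebesgue_space_M near_action_shift faithful_shift by blast
qed

end
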